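(* For each $n \in \mathbf{N}$, let $W_n = (w_{ij}^{(n)})_{i,j=1}^n$ be a random $n \times n$ Hermitian matrix whose upper triangular entries $w_{ij}^{(n)}$, $1 \le i \le j \le n$, are jointly independent, have mean zero, and have finite variances. Assume that $W_1, W_2, \ldots$ are defined on the same probability space. Suppose that \[ \lim_{n\to\infty} \frac{1}{n}\sum_{i=1}^n \biggl| \sum_{j=1}^n \Bigl( \operatorname{Var}\bigl[w_{ij}^{(n)}\bigr] - \frac{1}{n} \Bigr) \biggr| = 0, \] that there is some finite $C \ge 0$ such that \[ \lim_{n\to\infty} \frac{1}{n}\sum_{i=1}^n \biggl( \sum_{j=1}^n \operatorname{Var}\bigl[w_{ij}^{(n)}\bigr] - C \biggr)_+ = 0, \] and that for every $\epsilon>0$, \[ \lim_{n\to\infty} \frac{1}{n}\sum_{i,j=1}^n \mathbf{E}\bigl[\,|w_{ij}^{(n)}|^2\,\mathbf{1}(|w_{ij}^{(n)}|>\epsilon)\,\bigr] = 0. \] Then, almost surely, $\mu_{W_n} \Rightarrow \mu_{\mathrm{sc}}$ (weak convergence) as $n \to \infty$.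
   Context: Upper triangular entries include the diagonal. For an $n\times n$ Hermitian matrix $A$ with eigenvalues $\lambda_1(A)\ge\cdots\ge\lambda_n(A)$ (with multiplicity), the spectral distribution is $\mu_A := \frac1n\sum_{i=1}^n \delta_{\lambda_i(A)}$, a Borel probability measure on $\mathbf{R}$. A random $n\times n$ Hermitian matrix is a random element of the space of $n\times n$ Hermitian matrices, identified with $\mathbf{C}^{n(n-1)/2}\times\mathbf{R}^n$ with its Borel $\sigma$-algebra. For a complex random variable $w$, $\operatorname{Var}[w] = \mathbf{E}|w-\mathbf{E}w|^2$. $x_+ := \max\{x,0\}$. The semicircle distribution is $\mu_{\mathrm{sc}}(dx) = \frac{1}{2\pi}\sqrt{(4-x^2)_+}\,dx$. *)

theory Defs
  imports "HOL-Probability.Probability" "Jordan_Normal_Form.Char_Poly"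
begin

definition cvar :: "'a measure \<Rightarrow> ('a \<Rightarrow> complex) \<Rightarrow> real" where
  "cvar M X = (\<integral>\<omega>. (cmod (X \<omega> - (\<integral>\<omega>'. X \<omega>' \<partial>M)))\<^sup>2 \<partial>M)"

definition sq_mat :: "nat \<Rightarrow> (nat \<Rightarrow> nat \<Rightarrow> complex) \<Rightarrow> complex Matrix.mat" where
  "sq_mat n f = Matrix.mat n n (\<lambda>(i,j). f i j)"

text \<open>Spectral distribution (1/n) sum_i delta_{lambda_i(A)} of a Hermitian matrix,
  eigenvalues counted with multiplicity (roots of the characteristic polynomial);
  as a Borel measure on the reals.\<close>
definition spectral_measure :: "complex Matrix.mat \<Rightarrow> real measure" where
  "spectral_measure A =
     distr (measure_pmf (pmf_of_multiset (image_mset Re (proots (char_poly A))))) borel (\<lambda>x. x)"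

definition semicircle :: "real measure" where
  "semicircle = density lborel (\<lambda>x. ennreal (sqrt (max (4 - x\<^sup>2) 0) / (2 * pi)))"

end

theory Submission
  imports Defs "Jordan_Normal_Form.Schur_Decomposition"
    "HOL-Real_Asymp.Real_Asymp"
begin

text \<open>
  Weak convergence follows from convergence of the Stieltjes transforms at the points \<open>z = \<i> k\<close> for
  integers \<open>k \<ge> 2\<close>: in the variable \<open>u = exp (-t)\<close> these values are the moments of
  \<open>u * char M (ln u)\<close> on \<open>[0, 1]\<close>, which by the Weierstrass approximation theorem determine the
  characteristic function, while large \<open>k\<close> controls the tails.

  The Stieltjes transform of the spectral distribution is the normalised trace of the resolvent
  \<open>G = (W - z)\<^sup>-\<^sup>1\<close>. Deleting row and column \<open>k\<close> of \<open>W\<close> changes the trace of \<open>G\<close> by at most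
  \<open>1 / Im z\<close>, so bounded differences over the \<open>n\<close> independent columns and the Borel--Cantelli lemma reduce
  almost sure convergence to convergence of the mean.

  For the mean, let \<open>m\<close> be the root of \<open>m\<^sup>2 + z m + 1 = 0\<close> given by the semicircle distribution
  and \<open>d i = G i i - m\<close>. Expanding \<open>z G i i + 1 = \<Sum>j. W i j * G j i\<close>, tested against the conjugate
  of \<open>d i\<close>, to second order in each single entry \<open>W i j\<close> gives approximately
  \<open>- \<Sum>j. Var (W i j) * G j j * G i i\<close>, with an error controlled by the Lindeberg condition. Subtracting the
  equation of \<open>m\<close> leaves a self-consistent inequality that contracts because \<open>Im z \<ge> 2\<close>; summed over
  \<open>i\<close> it bounds the mean of \<open>E |d i|\<^sup>2\<close> by the average deviation of the row variances from one.
\<close>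

section \<open>Resolvents of Hermitian matrices\<close>

text \<open>Only second moments are at hand, and single variances need not be of order 1/n. Testing
  against the conjugate of \<open>d i\<close> yields the second moment of \<open>d i\<close> at
  once, without first showing that \<open>G i i\<close> is close to its mean. When the expansion
  runs over single entries, each error carries either min(1, |w|), which the Lindeberg condition
  makes small, or squares of off-diagonal entries of \<open>G\<close>, whose row sums the Ward
  identity bounds by a constant. Row sums of variances may be large in exceptional rows; symmetry of
  the variances turns the coupling of \<open>d i\<close> with \<open>d j\<close> into a sum weighted
  by row sums, so that only the average of |row sum - 1| enters. The choice Im z \<ge> 2 makes all
  entries of \<open>G\<close>, and \<open>m\<close>, at most 1/2 in modulus; the coupling then has
  total weight 3/4 + 1/4 = 1 against |z| \<ge> 2, which leaves room to absorb it. Integers k keep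
  the number of exceptional null sets countable; they start at 2 because the factor u that tames ln
  at 0 uses up one power.\<close>

definition resolvent :: "nat \<Rightarrow> complex \<Rightarrow> (nat \<Rightarrow> nat \<Rightarrow> complex) \<Rightarrow> nat \<Rightarrow> nat \<Rightarrow> complex" where
  "resolvent n z f i j =
     (let A = sq_mat n (\<lambda>i j. f i j - (if i = j then z else 0)) in cofactor A j i / det A)"

definition hermitian :: "nat \<Rightarrow> (nat \<Rightarrow> nat \<Rightarrow> complex) \<Rightarrow> bool" where
  "hermitian n f \<longleftrightarrow> (\<forall>i<n. \<forall>j<n. f j i = cnj (f i j))"

lemma hermitianD: "hermitian n f \<Longrightarrow> i < n \<Longrightarrow> j < n \<Longrightarrow> f j i = cnj (f i j)"
  unfolding hermitian_def by blast

lemma sq_mat_carrier [simp]: "sq_mat n f \<in> carrier_mat n n"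
  by (simp add: sq_mat_def)

text \<open>The quadratic form of a Hermitian array is real, and on an eigenvector it is the
  eigenvalue times a positive number. Serves twice: for the invertibility of \<open>A - z\<close>
  off the real axis and for the reality of the roots of the characteristic polynomial.\<close>

lemma hermitian_eigenvalue_real:
  assumes h: "hermitian n f" and ev: "\<And>i. i < n \<Longrightarrow> (\<Sum>j<n. f i j * v j) = z * v i"
    and nz: "i < n" "v i \<noteq> 0"
  shows "Im z = 0"
proof -
  define S where "S = (\<Sum>i<n. (cmod (v i))\<^sup>2)"
  define Q where "Q = (\<Sum>i<n. cnj (v i) * (\<Sum>j<n. f i j * v j))"
  have "Q = (\<Sum>i<n. cnj (v i) * (z * v i))"
    unfolding Q_def by (intro sum.cong) (auto simp: ev)
  also have "\<dots> = z * of_real S"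
    unfolding S_def of_real_sum sum_distrib_left
    by (intro sum.cong) (simp_all only: complex_norm_square mult_ac)
  finally have 1: "Q = z * of_real S" .
  have "cnj Q = (\<Sum>i<n. \<Sum>j<n. v i * (cnj (f i j) * cnj (v j)))"
    unfolding Q_def by (simp add: sum_distrib_left)
  also have "\<dots> = (\<Sum>j<n. \<Sum>i<n. v i * (cnj (f i j) * cnj (v j)))"
    by (rule sum.swap)
  also have "\<dots> = Q"
    unfolding Q_def sum_distrib_left
    by (intro sum.cong refl) (simp add: hermitianD[OF h, symmetric])
  finally have "Im Q = 0" by (metis Reals_cnj_iff complex_is_Real_iff)
  with 1 have "Im z * S = 0" by simp
  moreover have "S > 0"
    unfolding S_def by (rule sum_pos2[of _ i]) (use nz in auto)
  ultimately show ?thesis by simp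
qed

lemma hermitian_det_nonzero:
  assumes h: "hermitian n f" and z: "Im z \<noteq> 0"
  shows "det (sq_mat n (\<lambda>i j. f i j - (if i = j then z else 0))) \<noteq> 0"
proof
  let ?A = "sq_mat n (\<lambda>i j. f i j - (if i = j then z else 0))"
  assume "det ?A = 0"
  then obtain v where v: "v \<in> carrier_vec n" "v \<noteq> 0\<^sub>v n" "?A *\<^sub>v v = 0\<^sub>v n"
    using det_0_iff_vec_prod_zero_field[of ?A n] by auto
  then obtain i where i: "i < n" "v $ i \<noteq> 0"
    unfolding vec_eq_iff by auto
  have "(\<Sum>j<n. f i j * v $ j) = z * v $ i" if "i < n" for i
  proof -
    have 0: "(?A *\<^sub>v v) $ i = 0" using v that by simp
    have "(?A *\<^sub>v v) $ i = (\<Sum>j<n. (f i j - (if i = j then z else 0)) * v $ j)"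
      using v(1) that by (auto simp: sq_mat_def scalar_prod_def atLeast0LessThan intro!: sum.cong)
    also have "\<dots> = (\<Sum>j<n. f i j * v $ j) - (\<Sum>j<n. if i = j then z * v $ j else 0)"
      unfolding sum_subtractf[symmetric] by (intro sum.cong) (auto simp: algebra_simps)
    also have "(\<Sum>j<n. if i = j then z * v $ j else 0) = z * v $ i" using that by simp
    finally show ?thesis using 0 by simp
  qed
  from hermitian_eigenvalue_real[OF h this i] z show False by simp
qed

text \<open>Entrywise form of the two adjugate identities. Both sides matter: later the right
  equation of one matrix is played against the left equation of another.\<close>

lemma
  assumes h: "hermitian n f" and z: "Im z \<noteq> 0" and ij: "i < n" "j < n"
  shows resolvent_right: "(\<Sum>k<n. f i k * resolvent n z f k j) = z * resolvent n z f i j + of_bool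
      (i = j)"
    and resolvent_left: "(\<Sum>k<n. resolvent n z f i k * f k j) = z * resolvent n z f i j + of_bool
        (i = j)"
proof -
  let ?A = "sq_mat n (\<lambda>i j. f i j - (if i = j then z else 0))"
  note nz = hermitian_det_nonzero[OF h z]
  have R: "resolvent n z f i j = adj_mat ?A $$ (i,j) / det ?A" if "i < n" "j < n" for i j
    using that by (simp add: resolvent_def adj_mat_def sq_mat_def Let_def)
  have d: "dim_row (adj_mat ?A) = n" "dim_col (adj_mat ?A) = n"
    by (auto simp: adj_mat_def sq_mat_def)
  have "(?A * adj_mat ?A) $$ (i,j) = det ?A * of_bool (i = j)"
    using ij by (simp add: adj_mat(2)[of ?A n])
  moreover have "(?A * adj_mat ?A) $$ (i,j) = (\<Sum>k<n. (f i k - (if i = k then z else 0)) * adj_mat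
      ?A $$ (k,j))"
    using ij by (auto simp: times_mat_def scalar_prod_def d sq_mat_def atLeast0LessThan
        adj_mat_def intro!: sum.cong)
  ultimately have "(\<Sum>k<n. (f i k - (if i = k then z else 0)) * resolvent n z f k j) = of_bool (i =
      j)"
    using nz ij by (simp add: R sum_divide_distrib[symmetric])
  moreover have "(\<Sum>k<n. (f i k - (if i = k then z else 0)) * resolvent n z f k j) =
     (\<Sum>k<n. f i k * resolvent n z f k j) - (\<Sum>k<n. if i = k then z * resolvent n z f k j else 0)"
    unfolding sum_subtractf[symmetric] by (intro sum.cong) (auto simp: algebra_simps)
  ultimately show "(\<Sum>k<n. f i k * resolvent n z f k j) = z * resolvent n z f i j + of_bool (i = j)"
    using ij by (simp add: diff_eq_eq split del: if_split)
  have "(adj_mat ?A * ?A) $$ (i,j) = det ?A * of_bool (i = j)"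
    using ij by (simp add: adj_mat(3)[of ?A n])
  moreover have "(adj_mat ?A * ?A) $$ (i,j) = (\<Sum>k<n. adj_mat ?A $$ (i,k) * (f k j - (if k = j then
      z else 0)))"
    using ij by (auto simp: times_mat_def scalar_prod_def d sq_mat_def atLeast0LessThan
        adj_mat_def intro!: sum.cong)
  ultimately have "(\<Sum>k<n. resolvent n z f i k * (f k j - (if k = j then z else 0))) = of_bool (i =
      j)"
    using nz ij by (simp add: R sum_divide_distrib[symmetric])
  moreover have "(\<Sum>k<n. resolvent n z f i k * (f k j - (if k = j then z else 0))) =
     (\<Sum>k<n. resolvent n z f i k * f k j) - (\<Sum>k<n. if k = j then z * resolvent n z f i k else 0)"
    unfolding sum_subtractf[symmetric] by (intro sum.cong) (auto simp: algebra_simps)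
  ultimately show "(\<Sum>k<n. resolvent n z f i k * f k j) = z * resolvent n z f i j + of_bool (i = j)"
    using ij by (simp add: diff_eq_eq split del: if_split)
qed

lemma sum_of_bool_mult:
  fixes g :: "nat \<Rightarrow> 'a::comm_semiring_1"
  assumes "j < n"
  shows "(\<Sum>k<n. of_bool (j = k) * g k) = g j" "(\<Sum>k<n. of_bool (k = j) * g k) = g j"
    "(\<Sum>k<n. g k * of_bool (j = k)) = g j" "(\<Sum>k<n. g k * of_bool (k = j)) = g j"
proof -
  have *: "of_bool b * x = (if b then x else 0)" "x * of_bool b = (if b then x else 0)"
    for x :: 'a and b by simp_all
  show "(\<Sum>k<n. of_bool (j = k) * g k) = g j" "(\<Sum>k<n. of_bool (k = j) * g k) = g j"
    "(\<Sum>k<n. g k * of_bool (j = k)) = g j" "(\<Sum>k<n. g k * of_bool (k = j)) = g j"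
    unfolding * using assms by simp_all
qed

text \<open>Second resolvent identity. When \<open>g\<close> or \<open>f\<close> is put between the
  two resolvents, the product collapses through the equation of its own matrix, and the common term
  \<open>z * (\<Sum>k<n. ?R i k * ?S k j)\<close> cancels.\<close>

lemma resolvent_diff:
  assumes f: "hermitian n f" and g: "hermitian n g" and z: "Im z \<noteq> 0" and ij: "i < n" "j < n"
  shows "resolvent n z f i j - resolvent n z g i j =
    (\<Sum>k<n. \<Sum>l<n. resolvent n z f i k * (g k l - f k l) * resolvent n z g l j)"
proof -
  let ?R = "resolvent n z f" and ?S = "resolvent n z g"
  have "(\<Sum>k<n. \<Sum>l<n. ?R i k * g k l * ?S l j) = (\<Sum>k<n. ?R i k * (z * ?S k j + of_bool (k = j)))"
    using ij by (intro sum.cong refl) (simp add: resolvent_right[OF g z, symmetric]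
        sum_distrib_left mult.assoc)
  also have "\<dots> = z * (\<Sum>k<n. ?R i k * ?S k j) + ?R i j"
    using ij by (simp add: distrib_left sum.distrib sum_of_bool_mult sum_distrib_left mult_ac)
  finally have 1: "(\<Sum>k<n. \<Sum>l<n. ?R i k * g k l * ?S l j) = z * (\<Sum>k<n. ?R i k * ?S k j) + ?R i j" .
  have "(\<Sum>k<n. \<Sum>l<n. ?R i k * f k l * ?S l j) = (\<Sum>l<n. \<Sum>k<n. ?R i k * f k l * ?S l j)"
    by (rule sum.swap)
  also have "\<dots> = (\<Sum>l<n. (z * ?R i l + of_bool (i = l)) * ?S l j)"
    using ij by (intro sum.cong refl) (simp add: resolvent_left[OF f z, symmetric]
        sum_distrib_right)
  also have "\<dots> = z * (\<Sum>k<n. ?R i k * ?S k j) + ?S i j"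
    using ij by (simp add: algebra_simps sum.distrib sum_of_bool_mult sum_distrib_left)
  finally have 2: "(\<Sum>k<n. \<Sum>l<n. ?R i k * f k l * ?S l j) = z * (\<Sum>k<n. ?R i k * ?S k j) + ?S i j" .
  have "(\<Sum>k<n. \<Sum>l<n. ?R i k * (g k l - f k l) * ?S l j) =
     (\<Sum>k<n. \<Sum>l<n. ?R i k * g k l * ?S l j) - (\<Sum>k<n. \<Sum>l<n. ?R i k * f k l * ?S l j)"
    by (simp add: sum_subtractf[symmetric] algebra_simps)
  with 1 2 show ?thesis by simp
qed

text \<open>Ward identities. The form of \<open>f\<close> on a row of the resolvent and its
  conjugate is real; the resolvent equation turns it into \<open>z * S + cnj (?R i i)\<close>, and
  imaginary parts are compared.\<close>

lemma
  assumes h: "hermitian n f" and z: "Im z \<noteq> 0" and i: "i < n"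
  shows ward_row: "Im z * (\<Sum>k<n. (cmod (resolvent n z f i k))\<^sup>2) = Im (resolvent n z f i i)"
    and ward_col: "Im z * (\<Sum>k<n. (cmod (resolvent n z f k i))\<^sup>2) = Im (resolvent n z f i i)"
proof -
  let ?R = "resolvent n z f"
  define S where "S = (\<Sum>k<n. ?R i k * cnj (?R i k))"
  define Q where "Q = (\<Sum>k<n. \<Sum>l<n. ?R i k * f k l * cnj (?R i l))"
  have "Q = (\<Sum>l<n. (\<Sum>k<n. ?R i k * f k l) * cnj (?R i l))"
    unfolding Q_def sum_distrib_right by (rule sum.swap)
  also have "\<dots> = (\<Sum>l<n. (z * ?R i l + of_bool (i = l)) * cnj (?R i l))"
    using i by (intro sum.cong refl) (simp add: resolvent_left[OF h z])
  also have "\<dots> = z * S + cnj (?R i i)"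
    using i by (simp add: S_def algebra_simps sum.distrib sum_of_bool_mult sum_distrib_left)
  finally have 1: "Q = z * S + cnj (?R i i)" .
  have "cnj Q = (\<Sum>k<n. \<Sum>l<n. cnj (?R i k) * f l k * ?R i l)"
    unfolding Q_def cnj_sum by (intro sum.cong refl) (simp add: hermitianD[OF h, symmetric])
  also have "\<dots> = (\<Sum>l<n. \<Sum>k<n. ?R i k * f k l * cnj (?R i l))"
    by (intro sum.cong refl) (simp add: mult_ac)
  also have "\<dots> = Q" unfolding Q_def by (rule sum.swap)
  finally have 2: "Im Q = 0" by (metis Reals_cnj_iff complex_is_Real_iff)
  have S: "S = of_real (\<Sum>k<n. (cmod (?R i k))\<^sup>2)"
    unfolding S_def of_real_sum by (intro sum.cong) (simp_all only: complex_norm_square mult_ac)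
  show "Im z * (\<Sum>k<n. (cmod (?R i k))\<^sup>2) = Im (?R i i)"
    using arg_cong[OF 1, of Im] 2 by (simp add: S)
  define S where "S = (\<Sum>k<n. cnj (?R k i) * ?R k i)"
  define Q where "Q = (\<Sum>k<n. \<Sum>l<n. cnj (?R k i) * f k l * ?R l i)"
  have "Q = (\<Sum>k<n. cnj (?R k i) * (\<Sum>l<n. f k l * ?R l i))"
    unfolding Q_def sum_distrib_left by (simp add: mult_ac)
  also have "\<dots> = (\<Sum>k<n. cnj (?R k i) * (z * ?R k i + of_bool (k = i)))"
    using i by (intro sum.cong refl) (simp add: resolvent_right[OF h z])
  also have "\<dots> = z * S + cnj (?R i i)"
    using i by (simp add: S_def algebra_simps sum.distrib sum_of_bool_mult sum_distrib_left)
  finally have 1: "Q = z * S + cnj (?R i i)" .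
  have "cnj Q = (\<Sum>k<n. \<Sum>l<n. ?R k i * f l k * cnj (?R l i))"
    unfolding Q_def cnj_sum by (intro sum.cong refl) (simp add: hermitianD[OF h, symmetric])
  also have "\<dots> = (\<Sum>l<n. \<Sum>k<n. cnj (?R k i) * f k l * ?R l i)"
    by (intro sum.cong refl) (simp add: mult_ac)
  also have "\<dots> = Q" unfolding Q_def by (rule sum.swap)
  finally have 2: "Im Q = 0" by (metis Reals_cnj_iff complex_is_Real_iff)
  have S: "S = of_real (\<Sum>k<n. (cmod (?R k i))\<^sup>2)"
    unfolding S_def of_real_sum by (intro sum.cong) (simp_all only: complex_norm_square mult_ac)
  show "Im z * (\<Sum>k<n. (cmod (?R k i))\<^sup>2) = Im (?R i i)"
    using arg_cong[OF 1, of Im] 2 by (simp add: S)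
qed

text \<open>Keeping only the diagonal term, Ward gives
  \<open>Im z * |G i i|^2 \<le> |G i i|\<close>; the resulting bound on the diagonal is fed back
  into Ward for the whole row.\<close>

lemma
  assumes h: "hermitian n f" and z: "Im z > 0" and i: "i < n"
  shows resolvent_norm_le: "j < n \<Longrightarrow> cmod (resolvent n z f i j) \<le> 1 / Im z"
    and resolvent_row_le: "(\<Sum>k<n. (cmod (resolvent n z f i k))\<^sup>2) \<le> 1 / (Im z)\<^sup>2"
proof -
  let ?R = "resolvent n z f" and ?S = "\<Sum>k<n. (cmod (resolvent n z f i k))\<^sup>2"
  have W: "Im z * ?S = Im (?R i i)" by (rule ward_row[OF h _ i]) (use z in simp)
  have Im_le: "Im (?R i i) \<le> cmod (?R i i)" by (metis abs_Im_le_cmod abs_le_iff)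
  have le: "(cmod (?R i j))\<^sup>2 \<le> ?S" if "j < n" for j
    using that by (intro member_le_sum) auto
  have "Im z * (cmod (?R i i))\<^sup>2 \<le> cmod (?R i i)"
    using W Im_le z i mult_left_mono[OF le[OF i], of "Im z"] by linarith
  then have d: "cmod (?R i i) \<le> 1 / Im z"
    using z by (cases "cmod (?R i i) = 0") (auto simp: power2_eq_square field_simps)
  then have "Im z * ?S \<le> 1 / Im z" using W Im_le by linarith
  then show *: "?S \<le> 1 / (Im z)\<^sup>2" using z by (simp add: field_simps power2_eq_square)
  show "cmod (?R i j) \<le> 1 / Im z" if "j < n"
  proof (rule power2_le_imp_le)
    show "(cmod (?R i j))\<^sup>2 \<le> (1 / Im z)\<^sup>2"
      using le[OF that] * by (simp add: power_divide)
  qed (use z in simp)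
qed

section \<open>The trace of the resolvent as an integral against the spectral distribution\<close>

lemma proots_linear_factors:
  "proots (\<Prod>a\<leftarrow>as. [:- a, 1:]) = mset (as :: 'a::idom list)"
proof (induction as)
  case (Cons a as)
  have "(\<Prod>a\<leftarrow>as. [:- a, 1:]) \<noteq> 0" by (auto simp: prod_list_zero_iff)
  then have "proots ([:- a, 1:] * (\<Prod>a\<leftarrow>as. [:- a, 1:])) = add_mset a (mset as)"
    using Cons by (subst proots_mult) auto
  then show ?case by (simp only: list.map prod_list.Cons mset.simps)
qed simp

lemma sum_count_mult:
  fixes g :: "'a \<Rightarrow> 'b::real_vector"
  shows "(\<Sum>x\<in>set_mset S. real (count S x) *\<^sub>R g x) = (\<Sum>x\<in>#S. g x)"
proof (induction S)
  case (add a S)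
  have "(\<Sum>x\<in>set_mset (add_mset a S). real (count (add_mset a S) x) *\<^sub>R g x) =
    (\<Sum>x\<in>insert a (set_mset S). real (count S x) *\<^sub>R g x + (if x = a then g x else 0))"
    by (intro sum.cong) (auto simp: algebra_simps)
  also have "\<dots> = (\<Sum>x\<in>insert a (set_mset S). real (count S x) *\<^sub>R g x) + g a"
    by (simp add: sum.distrib)
  also have "(\<Sum>x\<in>insert a (set_mset S). real (count S x) *\<^sub>R g x) =
      (\<Sum>x\<in>set_mset S. real (count S x) *\<^sub>R g x)"
    by (rule sum.mono_neutral_right) (auto simp: not_in_iff)
  finally show ?case using add by simp
qed simp

lemma integral_pmf_of_multiset:
  fixes g :: "'a \<Rightarrow> 'b::{banach, second_countable_topology}"
  assumes "S \<noteq> {#}"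
  shows "(\<integral>x. g x \<partial>measure_pmf (pmf_of_multiset S)) = (\<Sum>x\<in>#S. g x) /\<^sub>R real (size S)"
  using assms
  by (subst integral_measure_pmf[where A = "set_mset S"])
     (auto simp: sum_count_mult[symmetric] scaleR_sum_right divide_inverse mult.commute)

text \<open>Holds for every \<open>A\<close> because a pmf always has total mass one. In particular
  it covers n = 0, where the multiset of roots is empty: the criterion for weak convergence asks
  this of all members of the sequence.\<close>

lemma real_distribution_spectral_measure: "real_distribution (spectral_measure A)"
  unfolding spectral_measure_def by (intro prob_space.real_distribution_distr) (auto intro:
      prob_space_measure_pmf)

lemma hermitian_root_char_poly_real:
  assumes h: "hermitian n f" and r: "poly (char_poly (sq_mat n f)) a = 0"
  shows "Im a = 0"
proof -
  have "eigenvalue (sq_mat n f) a"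
    using r by (simp add: eigenvalue_root_char_poly[of _ n])
  then obtain v where v: "v \<in> carrier_vec n" "v \<noteq> 0\<^sub>v n" "sq_mat n f *\<^sub>v v = a \<cdot>\<^sub>v v"
    unfolding eigenvalue_def eigenvector_def by (auto simp: sq_mat_def)
  then obtain i where i: "i < n" "v $ i \<noteq> 0"
    unfolding vec_eq_iff by auto
  have "(\<Sum>j<n. f i j * v $ j) = a * v $ i" if "i < n" for i
  proof -
    have "(sq_mat n f *\<^sub>v v) $ i = (\<Sum>j<n. f i j * v $ j)"
      using v(1) that by (auto simp: sq_mat_def scalar_prod_def atLeast0LessThan intro!: sum.cong)
    then show ?thesis using v that by simp
  qed
  from hermitian_eigenvalue_real[OF h this i] show ?thesis .
qed

lemma index_mult_mat_sum:
  assumes "A \<in> carrier_mat n n" "B \<in> carrier_mat n n" "i < n" "j < n"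
  shows "(A * B) $$ (i, j) = (\<Sum>k<n. A $$ (i, k) * B $$ (k, j))"
  using assms by (auto simp: scalar_prod_def atLeast0LessThan)

text \<open>In a Schur basis the matrix is upper triangular with the eigenvalues on its diagonal,
  hence so is its resolvent, with diagonal entries \<open>1 / (\<lambda> - z)\<close>.\<close>

lemma resolvent_trace_sum_list:
  assumes h: "hermitian n f" and z: "Im z \<noteq> 0"
    and as: "char_poly (sq_mat n f) = (\<Prod>a\<leftarrow>as. [:- a, 1:])"
  shows "(\<Sum>i<n. resolvent n z f i i) = (\<Sum>a\<leftarrow>as. 1 / (a - z))"
proof -
  let ?A = "sq_mat n f" and ?R = "sq_mat n (resolvent n z f)"
  obtain B P Q where dec: "schur_decomposition ?A as = (B, P, Q)" by (metis prod_cases3)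
  note sd = schur_decomposition[OF sq_mat_carrier as dec]
  have wit: "similar_mat_wit ?A B P Q" and ut: "upper_triangular B" and dg: "diag_mat B = as"
    using sd by auto
  have [simp]: "dim_row ?A = n" by (simp add: sq_mat_def)
  have c [simp]: "B \<in> carrier_mat n n" "P \<in> carrier_mat n n" "Q \<in> carrier_mat n n"
    and PQ: "P * Q = 1\<^sub>m n" and QP: "Q * P = 1\<^sub>m n" and A: "?A = P * B * Q"
    using wit unfolding similar_mat_wit_def Let_def by auto
  have Rc [simp]: "?R \<in> carrier_mat n n" by simp
  have RA: "?R * ?A = z \<cdot>\<^sub>m ?R + 1\<^sub>m n"
  proof (rule eq_matI)
    fix i j assume "i < dim_row (z \<cdot>\<^sub>m ?R + 1\<^sub>m n)" "j < dim_col (z \<cdot>\<^sub>m ?R + 1\<^sub>m n)"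
    then have ij: "i < n" "j < n" by auto
    have "(?R * ?A) $$ (i, j) = (\<Sum>k<n. resolvent n z f i k * f k j)"
      using ij by (subst index_mult_mat_sum[of _ n]) (auto simp: sq_mat_def)
    then show "(?R * ?A) $$ (i, j) = (z \<cdot>\<^sub>m ?R + 1\<^sub>m n) $$ (i, j)"
      using resolvent_left[OF h z ij] ij by (simp add: sq_mat_def)
  qed (auto simp: sq_mat_def)
  \<comment> \<open>\<open>X\<close> is the resolvent written in the Schur basis; the equation
    \<open>XB\<close> below says that it inverts \<open>B - z\<close>.\<close>
  define X where "X = Q * ?R * P"
  have Xc [simp]: "X \<in> carrier_mat n n" unfolding X_def by (meson c Rc mult_carrier_mat)
  note [simp] = carrier_matD[OF Xc] carrier_matD[OF c(1)]
  have "X * B = Q * ?R * (P * B)"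
    unfolding X_def by (rule assoc_mult_mat[of _ n n _ n _ n]) (auto intro!: mult_carrier_mat[of _
        n n])
  also have "P * B = P * B * (Q * P)" unfolding QP by (metis c(1,2) mult_carrier_mat
      right_mult_one_mat)
  also have "\<dots> = ?A * P"
    unfolding A by (rule assoc_mult_mat[of _ n n _ n _ n, symmetric]) (auto intro!:
        mult_carrier_mat[of _ n n])
  also have "Q * ?R * (?A * P) = Q * ?R * ?A * P"
    by (rule assoc_mult_mat[of _ n n _ n _ n, symmetric]) (auto intro!: mult_carrier_mat[of _ n n])
  also have "Q * ?R * ?A = Q * (?R * ?A)"
    by (rule assoc_mult_mat[of _ n n _ n _ n]) (auto intro!: mult_carrier_mat[of _ n n])
  also have "\<dots> = z \<cdot>\<^sub>m (Q * ?R) + Q"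
    unfolding RA using mult_smult_distrib[OF c(3) Rc] right_mult_one_mat[OF c(3)]
    by (subst mult_add_distrib_mat[of _ n n _ n]) auto
  also have "\<dots> * P = z \<cdot>\<^sub>m X + 1\<^sub>m n"
    unfolding X_def QP[symmetric]
    using mult_smult_assoc_mat[of "Q * ?R" n n P n] mult_carrier_mat[OF c(3) Rc]
    by (subst add_mult_distrib_mat[of _ n n _ _ n]) auto
  finally have XB: "X * B = z \<cdot>\<^sub>m X + 1\<^sub>m n" .
  have XB': "(\<Sum>k<n. X $$ (i, k) * B $$ (k, j)) = z * X $$ (i, j) + of_bool (i = j)"
    if "i < n" "j < n" for i j
    using that by (subst index_mult_mat_sum[of X n B, symmetric]) (simp_all add: XB)
  have len: "length as = n" and diag: "B $$ (j, j) = as ! j" if "j < n" for j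
    using dg that by (auto simp: diag_mat_def)
  have asr: "a \<in> set as \<Longrightarrow> Im a = 0" for a
    by (rule hermitian_root_char_poly_real[OF h]) (auto simp: as poly_prod_list prod_list_zero_iff)
  have nz: "B $$ (j, j) - z \<noteq> 0" if "j < n" for j
  proof
    assume "B $$ (j, j) - z = 0"
    then have "z = as ! j" using diag[OF that] by simp
    then show False using asr[of "as ! j"] len[OF that] that z by simp
  qed
  have row: "(\<Sum>k<n. X $$ (i, k) * B $$ (k, j)) = (\<Sum>k\<le>j. X $$ (i, k) * B $$ (k, j))"
    if "i < n" "j < n" for i j
    by (rule sum.mono_neutral_right) (use that ut in \<open>auto intro!: upper_triangularD\<close>)
  \<comment> \<open>Column by column from the left: as \<open>B\<close> is upper triangular, entry
    (i, j) of \<open>X * B\<close> involves only columns k \<le> j, and those with k < j already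
    vanish in row i. What remains is \<open>X $$ (i, j)\<close> times a nonzero factor.\<close>
  have low: "j < i \<Longrightarrow> i < n \<Longrightarrow> X $$ (i, j) = 0" for i j
  proof (induction j rule: less_induct)
    case (less j)
    have "(\<Sum>k\<le>j. X $$ (i, k) * B $$ (k, j)) = X $$ (i, j) * B $$ (j, j)"
      using less by (subst sum.remove[of _ j]) (auto intro!: sum.neutral)
    with XB'[of i j] row[of i j] less.prems have "X $$ (i, j) * (B $$ (j, j) - z) = 0"
      by (auto simp: algebra_simps)
    with nz[of j] less.prems show ?case by simp
  qed
  have dX: "X $$ (j, j) = 1 / (as ! j - z)" if j: "j < n" for j
  proof -
    have "(\<Sum>k\<le>j. X $$ (j, k) * B $$ (k, j)) = X $$ (j, j) * B $$ (j, j)"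
      using low j by (subst sum.remove[of _ j]) (auto intro!: sum.neutral)
    with XB'[of j j] row[of j j] j have "X $$ (j, j) * (B $$ (j, j) - z) = 1"
      by (simp add: algebra_simps)
    then show ?thesis using nz[OF j] diag[OF j] by (simp add: field_simps)
  qed
  \<comment> \<open>Cyclicity of the trace by swapping the two sums, then \<open>PQ\<close>.\<close>
  have "(\<Sum>i<n. X $$ (i, i)) = (\<Sum>i<n. \<Sum>k<n. (Q * ?R) $$ (i, k) * P $$ (k, i))"
    unfolding X_def
    by (intro sum.cong refl, subst index_mult_mat_sum[of _ n]) (auto intro!: mult_carrier_mat[of _
        n n])
  also have "\<dots> = (\<Sum>k<n. \<Sum>i<n. P $$ (k, i) * (Q * ?R) $$ (i, k))"
    by (subst sum.swap) (simp add: mult.commute)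
  also have "\<dots> = (\<Sum>k<n. (P * (Q * ?R)) $$ (k, k))"
    by (intro sum.cong refl, subst index_mult_mat_sum[of _ n]) (auto intro!: mult_carrier_mat[of _
        n n])
  also have "P * (Q * ?R) = P * Q * ?R"
    by (rule assoc_mult_mat[of _ n n _ n _ n, symmetric]) auto
  also have "\<dots> = ?R" unfolding PQ by (metis Rc left_mult_one_mat)
  finally have "(\<Sum>i<n. resolvent n z f i i) = (\<Sum>i<n. X $$ (i, i))"
    by (simp add: sq_mat_def)
  also have "\<dots> = (\<Sum>j<n. 1 / (as ! j - z))" by (simp add: dX)
  also have "\<dots> = (\<Sum>a\<leftarrow>as. 1 / (a - z))"
  proof -
    have "n = length as" using dg by (auto simp: diag_mat_def)
    then show ?thesis by (simp add: sum_list_sum_nth atLeast0LessThan)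
  qed
  finally show ?thesis .
qed

text \<open>The trace involves the roots themselves, the measure their real parts; for a Hermitian
  matrix the two agree.\<close>

theorem resolvent_trace_spectral_measure:
  assumes h: "hermitian n f" and z: "Im z \<noteq> 0" and n: "n > 0"
  shows "(\<Sum>i<n. resolvent n z f i i) / of_nat n =
    (\<integral>x. 1 / (complex_of_real x - z) \<partial>spectral_measure (sq_mat n f))"
proof -
  obtain as where as: "char_poly (sq_mat n f) = (\<Prod>a\<leftarrow>as. [:- a, 1:])" and len: "length as = n"
    using char_poly_factorized[OF sq_mat_carrier] by blast
  have asr: "a \<in> set as \<Longrightarrow> Im a = 0" for a
    by (rule hermitian_root_char_poly_real[OF h]) (auto simp: as poly_prod_list prod_list_zero_iff)
  have pr: "proots (char_poly (sq_mat n f)) = mset as"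
    unfolding as by (rule proots_linear_factors)
  have ne: "image_mset Re (mset as) \<noteq> {#}" using len n by auto
  have "(\<integral>x. 1 / (complex_of_real x - z) \<partial>spectral_measure (sq_mat n f)) =
     (\<integral>x. 1 / (complex_of_real x - z) \<partial>measure_pmf (pmf_of_multiset (image_mset Re (mset as))))"
    unfolding spectral_measure_def pr by (subst integral_distr) auto
  also have "\<dots> = (\<Sum>a\<leftarrow>as. 1 / (complex_of_real (Re a) - z)) /\<^sub>R real n"
    by (subst integral_pmf_of_multiset[OF ne])
       (simp add: len multiset.map_comp o_def flip: mset_map sum_mset_sum_list)
  also have "(\<Sum>a\<leftarrow>as. 1 / (complex_of_real (Re a) - z)) = (\<Sum>a\<leftarrow>as. 1 / (a - z))"
    using asr by (intro arg_cong[of _ _ sum_list] map_cong refl) (metis complex_is_Real_iff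
        of_real_Re)
  finally show ?thesis
    by (simp add: resolvent_trace_sum_list[OF h z as] scaleR_conv_of_real divide_inverse
        mult.commute)
qed

section \<open>Measurability of the resolvent entries\<close>

lemma resolvent_cong:
  assumes "\<And>i j. i < n \<Longrightarrow> j < n \<Longrightarrow> f i j = g i j"
  shows "resolvent n z f = resolvent n z g"
proof -
  have "sq_mat n (\<lambda>i j. f i j - (if i = j then z else 0)) =
        sq_mat n (\<lambda>i j. g i j - (if i = j then z else 0))"
    unfolding sq_mat_def by (rule cong_mat) (auto simp: assms)
  then show ?thesis unfolding resolvent_def by presburger
qed

lemma measurable_det_sq_mat:
  fixes F :: "'a \<Rightarrow> nat \<Rightarrow> nat \<Rightarrow> complex"
  assumes "\<And>i j. i < n \<Longrightarrow> j < n \<Longrightarrow> (\<lambda>x. F x i j) \<in> borel_measurable M"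
  shows "(\<lambda>x. det (sq_mat n (F x))) \<in> borel_measurable M"
proof -
  have eq: "det (sq_mat n (F x)) = (\<Sum>p\<in>{p. p permutes {0..<n}}. signof p * (\<Prod>i=0..<n. F x i (p
      i)))" for x
    unfolding det_def by (auto simp: sq_mat_def permutes_in_image intro!: sum.cong prod.cong)
  have pm: "p i < n" if "p permutes {0..<n}" "i < n" for p i
    using permutes_in_image[OF that(1), of i] that(2) by simp
  show ?thesis unfolding eq
    by (intro borel_measurable_sum borel_measurable_times borel_measurable_const
        borel_measurable_prod)
       (use pm in \<open>auto intro!: assms\<close>)
qed

text \<open>Here the cofactor encoding of \<open>resolvent\<close> pays off: numerator and
  denominator are determinants up to sign, hence polynomials in the entries, and the quotient is
  measurable even where the denominator vanishes, since division by zero has the value 0.\<close>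

lemma measurable_resolvent:
  fixes F :: "'a \<Rightarrow> nat \<Rightarrow> nat \<Rightarrow> complex"
  assumes F: "\<And>i j. i < n \<Longrightarrow> j < n \<Longrightarrow> (\<lambda>x. F x i j) \<in> borel_measurable M"
    and ij: "i < n" "j < n"
  shows "(\<lambda>x. resolvent n z (F x) i j) \<in> borel_measurable M"
proof -
  let ?A = "\<lambda>x i j. F x i j - (if i = j then z else 0)"
  have A: "(\<lambda>x. ?A x i j) \<in> borel_measurable M" if "i < n" "j < n" for i j
    using F[OF that] by simp
  have del: "mat_delete (sq_mat n (?A x)) j i =
     sq_mat (n - 1) (\<lambda>i' j'. ?A x (if i' < j then i' else Suc i') (if j' < i then j' else Suc
         j'))" for x
    by (rule eq_matI) (auto simp: mat_delete_def sq_mat_def)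
  have "(\<lambda>x. det (mat_delete (sq_mat n (?A x)) j i)) \<in> borel_measurable M"
    unfolding del by (rule measurable_det_sq_mat, rule A) auto
  moreover have "(\<lambda>x. det (sq_mat n (?A x))) \<in> borel_measurable M"
    by (rule measurable_det_sq_mat) (rule A)
  ultimately show ?thesis
    unfolding resolvent_def Let_def cofactor_def by measurable
qed

section \<open>Comparison of the trace with that of a minor\<close>

text \<open>Schur complement: outside row and column \<open>k\<close> this is the resolvent of the minor
  obtained by deleting row and column \<open>k\<close>.\<close>

definition minor_resolvent :: "nat \<Rightarrow> complex \<Rightarrow> nat \<Rightarrow> (nat \<Rightarrow> nat \<Rightarrow> complex) \<Rightarrow> nat \<Rightarrow> nat \<Rightarrow> complex"
    where
  "minor_resolvent n z k f i j =
     resolvent n z f i j - resolvent n z f i k * resolvent n z f k j / resolvent n z f k k"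

text \<open>By Ward, a zero at (k, k) would make row \<open>k\<close> of the resolvent vanish,
  against entry (k, k) of the resolvent equation. This makes the division in
  \<open>minor_resolvent\<close> a genuine one.\<close>

lemma resolvent_diag_nonzero:
  assumes h: "hermitian n f" and z: "Im z \<noteq> 0" and k: "k < n"
  shows "resolvent n z f k k \<noteq> 0"
proof
  assume 0: "resolvent n z f k k = 0"
  then have "(\<Sum>j<n. (cmod (resolvent n z f k j))\<^sup>2) = 0"
    using ward_row[OF h z k] z by simp
  then have "\<And>j. j < n \<Longrightarrow> resolvent n z f k j = 0"
    by (subst (asm) sum_nonneg_eq_0_iff) auto
  then have "(\<Sum>j<n. resolvent n z f k j * f j k) = 0" by simp
  with resolvent_left[OF h z k k] 0 show False by simp
qed

lemma minor_resolvent_eq_0: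
  assumes h: "hermitian n f" and z: "Im z \<noteq> 0" and k: "k < n"
  shows "minor_resolvent n z k f k j = 0" "minor_resolvent n z k f i k = 0"
  using resolvent_diag_nonzero[OF assms] by (auto simp: minor_resolvent_def)

text \<open>Away from \<open>k\<close> the rank-one correction solves the homogeneous equation,
  because the inhomogeneity for row or column \<open>k\<close> of the resolvent sits at
  \<open>k\<close> alone.\<close>

lemma
  assumes h: "hermitian n f" and z: "Im z \<noteq> 0" and k: "k < n" and ij: "i < n" "j < n"
  shows minor_resolvent_right: "i \<noteq> k \<Longrightarrow> (\<Sum>l<n. f i l * minor_resolvent n z k f l j) =
      z * minor_resolvent n z k f i j + of_bool (i = j)"
    and minor_resolvent_left: "j \<noteq> k \<Longrightarrow> (\<Sum>l<n. minor_resolvent n z k f i l * f l j) =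
      z * minor_resolvent n z k f i j + of_bool (i = j)"
proof -
  let ?R = "resolvent n z f"
  have "(\<Sum>l<n. f i l * minor_resolvent n z k f l j) =
     (\<Sum>l<n. f i l * ?R l j) - (\<Sum>l<n. f i l * ?R l k) * (?R k j / ?R k k)"
    unfolding minor_resolvent_def sum_distrib_right sum_subtractf[symmetric]
    by (intro sum.cong refl) (simp add: algebra_simps)
  then show "(\<Sum>l<n. f i l * minor_resolvent n z k f l j) =
      z * minor_resolvent n z k f i j + of_bool (i = j)" if "i \<noteq> k"
    using that resolvent_right[OF h z ij(1) ij(2)] resolvent_right[OF h z ij(1) k]
    by (simp add: minor_resolvent_def algebra_simps)
  have "(\<Sum>l<n. minor_resolvent n z k f i l * f l j) =
     (\<Sum>l<n. ?R i l * f l j) - (?R i k / ?R k k) * (\<Sum>l<n. ?R k l * f l j)"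
    unfolding minor_resolvent_def sum_distrib_left sum_subtractf[symmetric]
    by (intro sum.cong refl) (simp add: algebra_simps)
  then show "(\<Sum>l<n. minor_resolvent n z k f i l * f l j) =
      z * minor_resolvent n z k f i j + of_bool (i = j)" if "j \<noteq> k"
    using that resolvent_left[OF h z ij(1) ij(2)] resolvent_left[OF h z k ij(2)]
    by (simp add: minor_resolvent_def algebra_simps)
qed

text \<open>Uniqueness of inverses, carried out over the full index range: row and column
  \<open>k\<close> of both minor resolvents vanish, so \<open>f\<close> placed between them may be
  replaced by \<open>g\<close>, and evaluating the product from either side identifies the
  two.\<close>

lemma minor_resolvent_cong:
  assumes f: "hermitian n f" and g: "hermitian n g" and z: "Im z \<noteq> 0" and k: "k < n"
    and eq: "\<And>i j. i < n \<Longrightarrow> j < n \<Longrightarrow> i \<noteq> k \<Longrightarrow> j \<noteq> k \<Longrightarrow> f i j = g i j"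
    and ij: "i < n" "j < n"
  shows "minor_resolvent n z k f i j = minor_resolvent n z k g i j"
proof (cases "i = k \<or> j = k")
  case True
  then show ?thesis using minor_resolvent_eq_0[OF f z k] minor_resolvent_eq_0[OF g z k] by auto
next
  case False
  let ?F = "minor_resolvent n z k f" and ?H = "minor_resolvent n z k g"
  have "(\<Sum>l<n. \<Sum>m<n. ?H i l * f l m * ?F m j) = (\<Sum>l<n. ?H i l * (z * ?F l j + of_bool (l = j)))"
  proof (intro sum.cong refl)
    fix l assume "l \<in> {..<n}"
    then have l: "l < n" by simp
    show "(\<Sum>m<n. ?H i l * f l m * ?F m j) = ?H i l * (z * ?F l j + of_bool (l = j))"
    proof (cases "l = k")
      case True
      then show ?thesis using minor_resolvent_eq_0[OF g z k] by simp
    next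
      case False
      then show ?thesis
        using minor_resolvent_right[OF f z k l ij(2), symmetric]
        by (simp only: sum_distrib_left mult.assoc False not_False_eq_True simp_thms)
    qed
  qed
  also have "\<dots> = z * (\<Sum>l<n. ?H i l * ?F l j) + ?H i j"
    using ij by (simp add: distrib_left sum.distrib sum_of_bool_mult sum_distrib_left mult_ac)
  finally have 1: "(\<Sum>l<n. \<Sum>m<n. ?H i l * f l m * ?F m j) = z * (\<Sum>l<n. ?H i l * ?F l j) + ?H i j" .
  have "(\<Sum>l<n. \<Sum>m<n. ?H i l * f l m * ?F m j) = (\<Sum>l<n. \<Sum>m<n. ?H i l * g l m * ?F m j)"
  proof (intro sum.cong refl)
    fix l m assume "l \<in> {..<n}" "m \<in> {..<n}"
    then show "?H i l * f l m * ?F m j = ?H i l * g l m * ?F m j"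
      using minor_resolvent_eq_0[OF g z k] minor_resolvent_eq_0[OF f z k] eq[of l m]
      by (cases "l = k \<or> m = k") auto
  qed
  also have "\<dots> = (\<Sum>m<n. (\<Sum>l<n. ?H i l * g l m) * ?F m j)"
    unfolding sum_distrib_right by (rule sum.swap)
  also have "\<dots> = (\<Sum>m<n. (z * ?H i m + of_bool (i = m)) * ?F m j)"
  proof (intro sum.cong refl)
    fix m assume "m \<in> {..<n}"
    then have m: "m < n" by simp
    show "(\<Sum>l<n. ?H i l * g l m) * ?F m j = (z * ?H i m + of_bool (i = m)) * ?F m j"
    proof (cases "m = k")
      case True
      then show ?thesis using minor_resolvent_eq_0[OF f z k] by simp
    next
      case False
      then show ?thesis using minor_resolvent_left[OF g z k ij(1) m] by simp
    qed
  qed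
  also have "\<dots> = z * (\<Sum>l<n. ?H i l * ?F l j) + ?F i j"
    using ij by (simp add: algebra_simps sum.distrib sum_of_bool_mult sum_distrib_left)
  finally show ?thesis using 1 by simp
qed

text \<open>AM-GM and the two Ward identities bound the numerator of the difference by
  \<open>Im (?R k k) / Im z\<close>, hence by a multiple of its own denominator. This is why the
  bound contains neither \<open>n\<close> nor the size of the entries.\<close>

lemma resolvent_trace_minor_diff:
  assumes h: "hermitian n f" and z: "Im z > 0" and k: "k < n"
  shows "cmod ((\<Sum>i<n. resolvent n z f i i) - (\<Sum>i<n. minor_resolvent n z k f i i)) \<le> 1 / Im z"
proof -
  let ?R = "resolvent n z f"
  have z0: "Im z \<noteq> 0" using z by simp
  note nz = resolvent_diag_nonzero[OF h z0 k]
  have "(\<Sum>i<n. ?R i i) - (\<Sum>i<n. minor_resolvent n z k f i i) = (\<Sum>i<n. ?R i k * ?R k i) / ?R k k"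
    by (simp add: minor_resolvent_def sum_subtractf sum_divide_distrib)
  also have "cmod \<dots> \<le> 1 / Im z"
  proof -
    have "cmod (\<Sum>i<n. ?R i k * ?R k i) \<le> (\<Sum>i<n. cmod (?R i k) * cmod (?R k i))"
      by (rule order.trans[OF norm_sum]) (simp add: norm_mult)
    also have "\<dots> \<le> (\<Sum>i<n. ((cmod (?R i k))\<^sup>2 + (cmod (?R k i))\<^sup>2) / 2)"
    proof (rule sum_mono)
      fix i show "cmod (?R i k) * cmod (?R k i) \<le> ((cmod (?R i k))\<^sup>2 + (cmod (?R k i))\<^sup>2) / 2"
        using sum_squares_bound[of "cmod (?R i k)" "cmod (?R k i)"] by simp
    qed
    also have "\<dots> = ((\<Sum>i<n. (cmod (?R i k))\<^sup>2) + (\<Sum>i<n. (cmod (?R k i))\<^sup>2)) / 2"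
      by (simp add: sum.distrib sum_divide_distrib[symmetric])
    also have "\<dots> = Im (?R k k) / Im z"
      using ward_row[OF h z0 k] ward_col[OF h z0 k] z by (simp add: field_simps)
    also have "\<dots> \<le> cmod (?R k k) / Im z"
      using z by (intro divide_right_mono) (auto simp: abs_Im_le_cmod order.trans[OF abs_ge_self])
    finally show ?thesis using nz z by (simp add: norm_divide field_simps)
  qed
  finally show ?thesis .
qed

text \<open>Both traces are compared with that of the common minor, at cost 1 / Im z each. The bound
  is uniform however much row and column \<open>k\<close> change, so unbounded entries do no harm to
  concentration.\<close>

theorem resolvent_trace_row_diff:
  assumes f: "hermitian n f" and g: "hermitian n g" and z: "Im z > 0" and k: "k < n"
    and eq: "\<And>i j. i < n \<Longrightarrow> j < n \<Longrightarrow> i \<noteq> k \<Longrightarrow> j \<noteq> k \<Longrightarrow> f i j = g i j"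
  shows "cmod ((\<Sum>i<n. resolvent n z f i i) - (\<Sum>i<n. resolvent n z g i i)) \<le> 2 / Im z"
proof -
  have "(\<Sum>i<n. minor_resolvent n z k f i i) = (\<Sum>i<n. minor_resolvent n z k g i i)"
    by (intro sum.cong refl minor_resolvent_cong[OF f g _ k]) (use eq z in auto)
  then show ?thesis
    using norm_triangle_ineq4[of "(\<Sum>i<n. resolvent n z f i i) - (\<Sum>i<n. minor_resolvent n z k f i i)"
        "(\<Sum>i<n. resolvent n z g i i) - (\<Sum>i<n. minor_resolvent n z k g i i)"]
      resolvent_trace_minor_diff[OF f z k] resolvent_trace_minor_diff[OF g z k] by simp
qed

section \<open>Bounded differences\<close>

lemma (in prob_space) Hoeffding_mgf_range:
  fixes h :: "'a \<Rightarrow> real"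
  assumes h [measurable]: "h \<in> borel_measurable M"
    and bd: "\<And>x. x \<in> space M \<Longrightarrow> \<bar>h x\<bar> \<le> B"
    and diff: "\<And>x y. x \<in> space M \<Longrightarrow> y \<in> space M \<Longrightarrow> \<bar>h x - h y\<bar> \<le> c"
    and l: "l > 0"
  shows "(\<integral>x. exp (l * (h x - expectation h)) \<partial>M) \<le> exp (l\<^sup>2 * c\<^sup>2 / 8)"
proof -
  define a where "a = (INF x\<in>space M. h x)"
  have bb: "bdd_below (h ` space M)"
    by (rule bdd_belowI[of _ "- B"]) (use bd in \<open>auto simp: abs_le_iff minus_le_iff\<close>)
  have a1: "a \<le> h x" if "x \<in> space M" for x
    unfolding a_def using that bb by (intro cINF_lower) auto
  have a2: "h x - c \<le> a" if "x \<in> space M" for x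
    unfolding a_def using diff[OF that] not_empty by (intro cINF_greatest) (auto simp: abs_le_iff
        diff_le_eq add.commute)
  interpret interval_bounded_random_variable M h a "a + c"
    by unfold_locales (use a1 a2 in \<open>auto simp: diff_le_eq\<close>)
  have int: "integrable M (\<lambda>x. exp (l * (h x - expectation h)))"
  proof (rule integrable_const_bound[of _ "exp (l * (B - expectation h))"])
    show "AE x in M. norm (exp (l * (h x - expectation h))) \<le> exp (l * (B - expectation h))"
      using bd l by (intro AE_I2) (auto simp: abs_le_iff)
  qed simp
  have "ennreal (\<integral>x. exp (l * (h x - expectation h)) \<partial>M) =
      (\<integral>\<^sup>+x. ennreal (exp (l * (h x - expectation h))) \<partial>M)"
    using int by (intro nn_integral_eq_integral[symmetric]) auto
  also have "\<dots> \<le> ennreal (exp (l\<^sup>2 * c\<^sup>2 / 8))"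
    using Hoeffdings_lemma_nn_integral[OF l] by simp
  finally show ?thesis by simp
qed

text \<open>McDiarmid's inequality in exponential form. Coordinates are grouped into blocks because
  the number of blocks enters the exponent: \<open>n\<close> columns with oscillation of order 1/n
  give a bound that improves with \<open>n\<close>, whereas about n^2 / 2 single entries with the
  same oscillation would not.\<close>

lemma bounded_differences_mgf:
  fixes M :: "'i \<Rightarrow> 'b measure" and J :: "'k \<Rightarrow> 'i set" and f :: "('i \<Rightarrow> 'b) \<Rightarrow> real"
  assumes prob: "\<And>i. prob_space (M i)" and l: "l > 0"
    and "finite K" "\<And>k. k \<in> K \<Longrightarrow> finite (J k)" "disjoint_family_on J K"
    and "f \<in> borel_measurable (Pi\<^sub>M (\<Union>(J ` K)) M)"
    and "\<And>x. x \<in> space (Pi\<^sub>M (\<Union>(J ` K)) M) \<Longrightarrow> \<bar>f x\<bar> \<le> B"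
    and "\<And>k x y. k \<in> K \<Longrightarrow> x \<in> space (Pi\<^sub>M (\<Union>(J ` K)) M) \<Longrightarrow> y \<in> space (Pi\<^sub>M (\<Union>(J ` K)) M) \<Longrightarrow>
      (\<And>i. i \<in> \<Union>(J ` K) - J k \<Longrightarrow> x i = y i) \<Longrightarrow> \<bar>f x - f y\<bar> \<le> c"
  shows "(\<integral>x. exp (l * (f x - (\<integral>x. f x \<partial>Pi\<^sub>M (\<Union>(J ` K)) M))) \<partial>Pi\<^sub>M (\<Union>(J ` K)) M)
    \<le> exp (l\<^sup>2 * (real (card K) * c\<^sup>2) / 8)"
  using assms(3-)
proof (induction K arbitrary: f rule: finite_induct)
  case empty
  show ?case by (simp add: PiM_empty lebesgue_integral_count_space_finite)
next
  case (insert k K f)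
  let ?U = "\<Union>(J ` K)" and ?V = "J k"
  let ?PU = "Pi\<^sub>M ?U M" and ?PV = "Pi\<^sub>M ?V M" and ?P = "Pi\<^sub>M (?U \<union> ?V) M"
  have UV: "\<Union>(J ` insert k K) = ?U \<union> ?V" by auto
  have fin: "finite ?U" "finite ?V" using insert.hyps insert.prems by auto
  have disj: "?U \<inter> ?V = {}"
    using insert.prems(2) insert.hyps(2) by (fastforce simp: disjoint_family_on_def)
  interpret product_sigma_finite M
    by (simp add: product_sigma_finite_def prob prob_space_imp_sigma_finite)
  interpret PU: prob_space ?PU by (intro prob_space_PiM prob)
  interpret PV: prob_space ?PV by (intro prob_space_PiM prob)
  interpret P: prob_space ?P by (intro prob_space_PiM prob)
  note f = insert.prems(3)[unfolded UV] and bd = insert.prems(4)[unfolded UV]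
    and diff = insert.prems(5)[unfolded UV]
  note [measurable] = f
  have msp: "merge ?U ?V (x, y) \<in> space ?P" if "x \<in> space ?PU" "y \<in> space ?PV" for x y
    using measurable_space[OF measurable_merge[of ?U ?V M], of "(x, y)"] that
    by (auto simp: space_pair_measure)
  have mU: "merge ?U ?V (x, y) i = x i" if "i \<in> ?U" for x y i
    using that by (simp add: merge_def)
  have mV: "merge ?U ?V (x, y) i = y i" if "i \<in> ?V" for x y i
    using that disj by (auto simp: merge_def)
  have mrg [measurable]: "(\<lambda>y. merge ?U ?V (x, y)) \<in> measurable ?PV ?P" if "x \<in> space ?PU" for x
    using that by (rule measurable_Pair1'[THEN measurable_compose[OF _ measurable_merge]])
  have fi: "integrable ?P f"
    by (rule P.integrable_const_bound[of _ B]) (use bd in auto)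
  have fxi: "integrable ?PV (\<lambda>y. f (merge ?U ?V (x, y)))" if "x \<in> space ?PU" for x
    by (rule PV.integrable_const_bound[of _ B]) (use bd msp that in auto)
  \<comment> \<open>Integrating out the new block: \<open>g\<close> inherits the bound and the
    oscillations of \<open>f\<close> over the remaining blocks, so the induction hypothesis applies
    to it, while on each section \<open>f\<close> minus \<open>g\<close> is centred and falls under
    Hoeffding's lemma.\<close>
  define g where "g x = (\<integral>y. f (merge ?U ?V (x, y)) \<partial>?PV)" for x
  have [measurable]: "g \<in> borel_measurable ?PU"
    unfolding g_def by (rule PV.borel_measurable_lebesgue_integral) measurable
  have gb: "\<bar>g x\<bar> \<le> B" if "x \<in> space ?PU" for x
  proof -
    have "\<bar>g x\<bar> \<le> (\<integral>y. \<bar>f (merge ?U ?V (x, y))\<bar> \<partial>?PV)"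
      unfolding g_def by (rule integral_abs_bound)
    also have "\<dots> \<le> (\<integral>y. B \<partial>?PV)"
      using fxi[OF that] bd msp that by (intro integral_mono) auto
    finally show ?thesis by (simp add: PV.prob_space)
  qed
  have gd: "\<bar>g x - g y\<bar> \<le> c" if k': "k' \<in> K" and x: "x \<in> space ?PU" and y: "y \<in> space ?PU"
    and xy: "\<And>i. i \<in> ?U - J k' \<Longrightarrow> x i = y i" for k' x y
  proof -
    have "g x - g y = (\<integral>w. f (merge ?U ?V (x, w)) - f (merge ?U ?V (y, w)) \<partial>?PV)"
      unfolding g_def using fxi x y by simp
    also have "\<bar>\<dots>\<bar> \<le> (\<integral>w. \<bar>f (merge ?U ?V (x, w)) - f (merge ?U ?V (y, w))\<bar> \<partial>?PV)"
      by (rule integral_abs_bound)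
    also have "\<dots> \<le> (\<integral>w. c \<partial>?PV)"
    proof (rule integral_mono)
      fix w assume w: "w \<in> space ?PV"
      show "\<bar>f (merge ?U ?V (x, w)) - f (merge ?U ?V (y, w))\<bar> \<le> c"
      proof (rule diff[of k'])
        fix i assume "i \<in> ?U \<union> ?V - J k'"
        then show "merge ?U ?V (x, w) i = merge ?U ?V (y, w) i"
          using xy[of i] by (cases "i \<in> ?V") (auto simp: mV mU)
      qed (use k' x y w msp in auto)
    qed (use fxi x y in auto)
    finally show ?thesis by (simp add: PV.prob_space)
  qed
  define m where "m = (\<integral>x. f x \<partial>?P)"
  have mg: "m = (\<integral>x. g x \<partial>?PU)"
    unfolding m_def g_def by (rule product_integral_fold[OF disj fin fi])
  have ei: "integrable ?P (\<lambda>x. exp (l * (f x - m)))"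
    by (rule P.integrable_const_bound[of _ "exp (l * (B - m))"])
       (use bd l in \<open>auto simp: abs_le_iff\<close>)
  have gi: "integrable ?PU (\<lambda>x. exp (l * (g x - m)))"
    by (rule PU.integrable_const_bound[of _ "exp (l * (B - m))"])
       (use gb l in \<open>auto simp: abs_le_iff\<close>)
  have inner: "(\<integral>y. exp (l * (f (merge ?U ?V (x, y)) - m)) \<partial>?PV) \<le> exp (l * (g x - m)) * exp (l\<^sup>2
      * c\<^sup>2 / 8)"
    if x: "x \<in> space ?PU" for x
  proof -
    have "(\<integral>y. exp (l * (f (merge ?U ?V (x, y)) - m)) \<partial>?PV) =
        (\<integral>y. exp (l * (g x - m)) * exp (l * (f (merge ?U ?V (x, y)) - g x)) \<partial>?PV)"
      by (simp add: algebra_simps flip: exp_add)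
    also have "\<dots> = exp (l * (g x - m)) * (\<integral>y. exp (l * (f (merge ?U ?V (x, y)) - g x)) \<partial>?PV)"
      by simp
    also have "(\<integral>y. exp (l * (f (merge ?U ?V (x, y)) - g x)) \<partial>?PV) \<le> exp (l\<^sup>2 * c\<^sup>2 / 8)"
      unfolding g_def
    proof (rule PV.Hoeffding_mgf_range[OF _ _ _ l, where B = B])
      show "(\<lambda>y. f (merge ?U ?V (x, y))) \<in> borel_measurable ?PV" using x by measurable
      show "\<bar>f (merge ?U ?V (x, y))\<bar> \<le> B" if "y \<in> space ?PV" for y using that x bd msp by auto
      show "\<bar>f (merge ?U ?V (x, y)) - f (merge ?U ?V (x, y'))\<bar> \<le> c"
        if "y \<in> space ?PV" "y' \<in> space ?PV" for y y'
        by (rule diff[of k]) (use that x msp in \<open>auto simp: merge_def\<close>)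
    qed
    finally show ?thesis by simp
  qed
  have "(\<integral>x. exp (l * (f x - m)) \<partial>?P) =
     (\<integral>x. (\<integral>y. exp (l * (f (merge ?U ?V (x, y)) - m)) \<partial>?PV) \<partial>?PU)"
    by (rule product_integral_fold[OF disj fin ei])
  also have "\<dots> \<le> (\<integral>x. exp (l * (g x - m)) * exp (l\<^sup>2 * c\<^sup>2 / 8) \<partial>?PU)"
  proof (rule integral_mono')
    show "integrable ?PU (\<lambda>x. exp (l * (g x - m)) * exp (l\<^sup>2 * c\<^sup>2 / 8))" using gi by simp
  qed (use inner in auto)
  also have "\<dots> = (\<integral>x. exp (l * (g x - m)) \<partial>?PU) * exp (l\<^sup>2 * c\<^sup>2 / 8)" by simp
  also have "(\<integral>x. exp (l * (g x - m)) \<partial>?PU) \<le> exp (l\<^sup>2 * (real (card K) * c\<^sup>2) / 8)"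
    unfolding mg
    by (rule insert.IH)
       (use insert.prems(1,2) gb gd in \<open>auto simp: disjoint_family_on_def\<close>)
  also have "exp (l\<^sup>2 * (real (card K) * c\<^sup>2) / 8) * exp (l\<^sup>2 * c\<^sup>2 / 8) =
      exp (l\<^sup>2 * (real (card (insert k K)) * c\<^sup>2) / 8)"
    using insert.hyps by (simp add: algebra_simps add_divide_distrib flip: exp_add)
  finally show ?case unfolding UV m_def by simp
qed

section \<open>Weak convergence from Stieltjes transforms\<close>

text \<open>A polynomial \<open>g\<close> near \<open>h\<close> is orthogonal to \<open>h\<close>,
  so the integral of h^2 equals that of (h - g) * h and is as small as the approximation
  error.\<close>

lemma continuous_eq_0_if_moments_0:
  fixes h :: "real \<Rightarrow> real"
  assumes h: "continuous_on {0..1} h" and mom: "\<And>j. integral {0..1} (\<lambda>u. u ^ j * h u) = 0"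
    and x: "x \<in> {0..1}"
  shows "h x = 0"
proof -
  define B where "B = integral {0..1} (\<lambda>u. \<bar>h u\<bar>)"
  have hi: "(\<lambda>u. \<bar>h u\<bar>) integrable_on {0..1}"
    by (intro integrable_continuous_real continuous_intros h)
  have B: "B \<ge> 0" unfolding B_def by (intro integral_nonneg hi) auto
  have le: "integral {0..1} (\<lambda>u. h u * h u) \<le> e * B" if e: "e > 0" for e
  proof -
    obtain g where g: "real_polynomial_function g" "\<And>x. x \<in> {0..1} \<Longrightarrow> \<bar>h x - g x\<bar> < e"
      using Stone_Weierstrass_real_polynomial_function[OF _ h e] by blast
    obtain a n where gs: "g = (\<lambda>x. \<Sum>i\<le>n. a i * x ^ i)"
      using g(1) real_polynomial_function_iff_sum by blast
    have gc: "continuous_on {0..1} g" unfolding gs by (intro continuous_intros)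
    have "integral {0..1} (\<lambda>u. g u * h u) = integral {0..1} (\<lambda>u. \<Sum>i\<le>n. a i * (u ^ i * h u))"
      by (simp add: gs sum_distrib_right mult.assoc)
    also have "\<dots> = (\<Sum>i\<le>n. integral {0..1} (\<lambda>u. a i * (u ^ i * h u)))"
      by (intro integral_sum integrable_continuous_real continuous_intros h) auto
    also have "\<dots> = 0" by (simp add: mom)
    finally have g0: "integral {0..1} (\<lambda>u. g u * h u) = 0" .
    have "integral {0..1} (\<lambda>u. h u * h u) = integral {0..1} (\<lambda>u. h u * h u) - integral {0..1} (\<lambda>u.
        g u * h u)"
      by (simp add: g0)
    also have "\<dots> = integral {0..1} (\<lambda>u. h u * h u - g u * h u)"
      by (intro integral_diff[symmetric] integrable_continuous_real continuous_intros h gc)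
    also have "\<dots> \<le> integral {0..1} (\<lambda>u. e * \<bar>h u\<bar>)"
    proof (intro integral_le integrable_continuous_real continuous_intros h gc)
      fix u :: real assume u: "u \<in> {0..1}"
      have "h u * h u - g u * h u = (h u - g u) * h u" by (simp add: algebra_simps)
      also have "\<dots> \<le> \<bar>h u - g u\<bar> * \<bar>h u\<bar>" by (metis abs_ge_self abs_mult)
      also have "\<dots> \<le> e * \<bar>h u\<bar>" using g(2)[OF u] by (intro mult_right_mono) auto
      finally show "h u * h u - g u * h u \<le> e * \<bar>h u\<bar>" .
    qed
    finally show ?thesis by (simp add: B_def)
  qed
  have "integral {0..1} (\<lambda>u. h u * h u) \<le> 0"
  proof (rule field_le_epsilon)
    fix e :: real assume "e > 0"
    \<comment> \<open>Dividing by \<open>B + 1\<close> instead of \<open>B\<close> keeps the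
      tolerance positive when \<open>B = 0\<close>.\<close>
    then have "integral {0..1} (\<lambda>u. h u * h u) \<le> (e / (B + 1)) * B"
      using B by (intro le) auto
    also have "\<dots> \<le> e" using B \<open>e > 0\<close> by (simp add: field_simps)
    finally show "integral {0..1} (\<lambda>u. h u * h u) \<le> 0 + e" by simp
  qed
  moreover have "integral {0..1} (\<lambda>u. h u * h u) \<ge> 0"
    by (intro integral_nonneg integrable_continuous_real continuous_intros h) auto
  ultimately have "integral {0..1} (\<lambda>u. h u * h u) = 0" by simp
  then have "\<forall>x\<in>{0..1}. h x * h x = 0"
    by (subst (asm) integral_eq_0_iff) (auto intro!: continuous_intros h)
  with x show ?thesis by auto
qed

text \<open>The factor \<open>u\<close> absorbs the singularity of \<open>ln\<close> at 0, where
  boundedness of \<open>\<phi>\<close> suffices. It is also what shifts the points of the Stieltjes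
  transform to k \<ge> 2.\<close>

lemma continuous_on_mult_bounded_ln:
  fixes \<phi> :: "real \<Rightarrow> complex"
  assumes c: "\<And>t. isCont \<phi> t" and b: "\<And>t. norm (\<phi> t) \<le> B"
  shows "continuous_on {0..1} (\<lambda>u. of_real u * \<phi> (ln u))"
  unfolding continuous_on_eq_continuous_within
proof
  fix x :: real assume "x \<in> {0..1}"
  show "continuous (at x within {0..1}) (\<lambda>u. of_real u * \<phi> (ln u))"
  proof (cases "x = 0")
    case False
    with \<open>x \<in> {0..1}\<close> have "x > 0" by auto
    then have "isCont (\<lambda>u. of_real u * \<phi> (ln u)) x"
      by (intro continuous_intros isCont_o2[OF _ c]) auto
    then show ?thesis by (rule continuous_at_imp_continuous_at_within)
  next
    case True
    have "((\<lambda>u. of_real u * \<phi> (ln u)) \<longlongrightarrow> 0) (at 0 within {0..1})"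
    proof (rule Lim_null_comparison)
      show "\<forall>\<^sub>F u in at 0 within {0..1}. norm (of_real u * \<phi> (ln u)) \<le> \<bar>u\<bar> * B"
        by (intro always_eventually) (auto simp: norm_mult intro!: mult_left_mono b)
      show "((\<lambda>u. \<bar>u\<bar> * B) \<longlongrightarrow> 0) (at (0::real) within {0..1})"
        by (auto intro!: tendsto_eq_intros)
    qed
    then show ?thesis by (simp add: True continuous_within)
  qed
qed

text \<open>With c = j + 2 + \<i> x the integrand is u to the power c - 1, with antiderivative u^c /
  c. The latter is differentiated only inside (0, 1); at the endpoint 0 continuity is
  enough.\<close>

lemma integral_power_iexp_ln:
  fixes x :: real
  shows "((\<lambda>u. of_real (u ^ Suc j) * iexp (x * ln u)) has_integral
     1 / (of_nat (j + 2) + \<i> * of_real x)) {0..1}"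
proof -
  define c where "c = of_nat (j + 2) + \<i> * complex_of_real x"
  have c0: "c \<noteq> 0" by (auto simp: c_def complex_eq_iff)
  define F where "F u = of_real (u ^ (j + 2)) * iexp (x * ln u) / c" for u :: real
  have "((\<lambda>u. of_real (u ^ Suc j) * iexp (x * ln u)) has_integral (F 1 - F 0)) {0..1}"
  proof (rule fundamental_theorem_of_calculus_interior)
    have "continuous_on {0..1} (\<lambda>u. of_real u * iexp (x * ln u))"
      by (rule continuous_on_mult_bounded_ln[of "\<lambda>t. iexp (x * t)" 1]) (auto intro!:
          continuous_intros)
    then have "continuous_on {0..1} (\<lambda>u. of_real (u ^ Suc j) * (of_real u * iexp (x * ln u)) / c)"
      using c0 by (intro continuous_on_divide continuous_on_mult[where g = "\<lambda>u. of_real u * iexp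
          (x * ln u)"])
        (auto intro!: continuous_intros)
    then show "continuous_on {0..1} F"
      by (rule continuous_on_cong[THEN iffD1, rotated 2]) (auto simp: F_def)
    fix u :: real assume u: "u \<in> {0<..<1}"
    have "((\<lambda>u. x * ln u) has_real_derivative x / u) (at u)"
      using u by (auto intro!: derivative_eq_intros)
    then have "((\<lambda>u. \<i> * of_real (x * ln u)) has_vector_derivative \<i> * of_real (x / u)) (at u)"
      by (intro has_vector_derivative_mult_right has_vector_derivative_of_real)
         (simp add: has_real_derivative_iff_has_vector_derivative)
    from field_vector_diff_chain_at[OF this DERIV_exp]
    have 1: "((\<lambda>u. iexp (x * ln u)) has_vector_derivative \<i> * of_real (x / u) * iexp (x * ln u))
        (at u)"
      by (simp add: o_def)
    have "((\<lambda>u. u ^ (j + 2)) has_real_derivative real (j + 2) * u ^ Suc j) (at u)"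
      using DERIV_pow[of "j + 2" u] by simp
    then have 2: "((\<lambda>u. complex_of_real (u ^ (j + 2))) has_vector_derivative
        of_real (real (j + 2) * u ^ Suc j)) (at u)"
      by (intro has_vector_derivative_of_real) (simp add:
          has_real_derivative_iff_has_vector_derivative)
    from has_vector_derivative_mult_left[OF has_vector_derivative_mult[OF 2 1], of "1 / c"]
    have "((\<lambda>u. of_real (u ^ (j + 2)) * iexp (x * ln u) / c) has_vector_derivative
      (of_real (u ^ (j + 2)) * (\<i> * of_real (x / u) * iexp (x * ln u)) +
       of_real (real (j + 2) * u ^ Suc j) * iexp (x * ln u)) / c) (at u)"
      by simp
    also have "(of_real (u ^ (j + 2)) * (\<i> * of_real (x / u) * iexp (x * ln u)) +
       of_real (real (j + 2) * u ^ Suc j) * iexp (x * ln u)) / c = of_real (u ^ Suc j) * iexp (x *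
           ln u)"
      using u c0 by (simp add: field_simps c_def)
    finally show "(F has_vector_derivative of_real (u ^ Suc j) * iexp (x * ln u)) (at u)"
      unfolding F_def .
  qed simp
  then show ?thesis by (simp add: F_def c_def)
qed

text \<open>Fubini exchanges the integral in \<open>u\<close> with the one defining
  \<open>char M\<close>. The value is -\<i> times the Stieltjes transform at \<i> (j + 2).\<close>

lemma (in real_distribution) char_moments_stieltjes:
  "((\<lambda>u. of_real (u ^ j) * (of_real u * char M (ln u))) has_integral
      (\<integral>x. 1 / (of_nat (j + 2) + \<i> * of_real x) \<partial>M)) {0..1}"
proof -
  let ?L = "restrict_space lborel {0..1::real}"
  let ?f = "\<lambda>u x. complex_of_real (u ^ Suc j) * iexp (x * ln u)"
  interpret L: prob_space ?L by (rule prob_space_restrict_space) auto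
  interpret P: pair_prob_space ?L M ..
  have [measurable]: "(\<lambda>u. u) \<in> borel_measurable ?L" by (rule measurable_restrict_space1) simp
  have b: "norm (?f u x) \<le> 1" if "u \<in> {0..1}" for u x
    using that by (simp add: norm_mult mult_le_one power_le_one norm_power)
  have int: "integrable (?L \<Otimes>\<^sub>M M) (\<lambda>(u, x). ?f u x)"
    by (rule P.integrable_const_bound[of _ 1])
       (use b in \<open>auto simp: space_pair_measure space_restrict_space split_beta'\<close>)
  have "set_lebesgue_integral lborel {0..1} (\<lambda>u. of_real (u ^ j) * (of_real u * char M (ln u))) =
      (\<integral>u. \<integral>x. ?f u x \<partial>M \<partial>?L)"
    unfolding set_lebesgue_integral_def
    by (subst integral_restrict_space) (auto simp: char_def mult.assoc mult.commute
        mult.left_commute)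
  also have "\<dots> = (\<integral>x. \<integral>u. ?f u x \<partial>?L \<partial>M)"
    using P.Fubini_integral[OF int] by simp
  also have "\<dots> = (\<integral>x. 1 / (of_nat (j + 2) + \<i> * of_real x) \<partial>M)"
  proof (rule Bochner_Integration.integral_cong[OF refl])
    fix x
    have "set_integrable lborel {0..1} (\<lambda>u. ?f u x)"
    proof -
      have "continuous_on {0..1} (\<lambda>u. of_real (u ^ j) * (of_real u * iexp (x * ln u)))"
        by (intro continuous_on_mult continuous_on_mult_bounded_ln[of "\<lambda>t. iexp (x * t)" 1])
           (auto intro!: continuous_intros)
      then show ?thesis by (intro borel_integrable_atLeastAtMost') (simp add: mult_ac)
    qed
    from set_borel_integral_eq_integral(2)[OF this]
    have "(\<integral>u. ?f u x \<partial>?L) = integral {0..1} (\<lambda>u. ?f u x)"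
      by (subst integral_restrict_space) (auto simp: set_lebesgue_integral_def)
    then show "(\<integral>u. ?f u x \<partial>?L) = 1 / (of_nat (j + 2) + \<i> * of_real x)"
      using integral_power_iexp_ln[of j x, THEN integral_unique] by simp
  qed
  finally have eq: "set_lebesgue_integral lborel {0..1} (\<lambda>u. of_real (u ^ j) * (of_real u * char M
      (ln u))) =
      (\<integral>x. 1 / (of_nat (j + 2) + \<i> * of_real x) \<partial>M)" .
  have "continuous_on {0..1} (\<lambda>u. of_real (u ^ j) * (of_real u * char M (ln u)))"
    by (intro continuous_on_mult continuous_on_mult_bounded_ln[of "char M" 1])
       (auto intro!: continuous_intros isCont_char cmod_char_le_1)
  then have "set_integrable lborel {0..1} (\<lambda>u. of_real (u ^ j) * (of_real u * char M (ln u)))"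
    by (rule borel_integrable_atLeastAtMost')
  from set_borel_integral_eq_integral[OF this] eq show ?thesis
    by (metis integrable_integral)
qed


theorem stieltjes_determines_distribution:
  assumes M: "real_distribution M" and N: "real_distribution N"
    and eq: "\<And>k. 2 \<le> k \<Longrightarrow> (\<integral>x. 1 / (complex_of_real x - \<i> * of_nat k) \<partial>M) =
                            (\<integral>x. 1 / (complex_of_real x - \<i> * of_nat k) \<partial>N)"
  shows "M = N"
proof -
  interpret M: real_distribution M by fact
  interpret N: real_distribution N by fact
  have rot: "1 / (of_nat k + \<i> * complex_of_real x) = - \<i> * (1 / (complex_of_real x - \<i> * of_nat
      k))"
    if "2 \<le> k" for k x
  proof -
    have "of_nat k + \<i> * complex_of_real x = \<i> * (complex_of_real x - \<i> * of_nat k)"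
      by (simp add: algebra_simps)
    then show ?thesis by (simp add: divide_inverse)
  qed
  have "(\<integral>x. 1 / (of_nat k + \<i> * complex_of_real x) \<partial>M) =
      (\<integral>x. 1 / (of_nat k + \<i> * complex_of_real x) \<partial>N)" if "2 \<le> k" for k
    unfolding rot[OF that] integral_mult_right_zero eq[OF that] ..
  note eq' = this
  define h where "h u = of_real u * char M (ln u) - of_real u * char N (ln u)" for u
  have hint: "((\<lambda>u. of_real (u ^ j) * h u) has_integral 0) {0..1}" for j
    using has_integral_diff[OF M.char_moments_stieltjes[of j] N.char_moments_stieltjes[of j]]
      eq'[of "j + 2"] by (simp add: h_def right_diff_distrib)
  have hc: "continuous_on {0..1} h"
    unfolding h_def
    by (intro continuous_on_diff continuous_on_mult_bounded_ln[of _ 1])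
       (auto intro!: M.isCont_char N.isCont_char M.cmod_char_le_1 N.cmod_char_le_1)
  have h0: "h u = 0" if "u \<in> {0..1}" for u
  proof -
    have "Re (h u) = 0"
    proof (rule continuous_eq_0_if_moments_0[OF _ _ that])
      fix j show "integral {0..1} (\<lambda>u. u ^ j * Re (h u)) = 0"
        using has_integral_Re[OF hint[of j]] by (intro integral_unique) simp
    qed (intro continuous_intros hc)
    moreover have "Im (h u) = 0"
    proof (rule continuous_eq_0_if_moments_0[OF _ _ that])
      fix j show "integral {0..1} (\<lambda>u. u ^ j * Im (h u)) = 0"
        using has_integral_Im[OF hint[of j]] by (intro integral_unique) simp
    qed (intro continuous_intros hc)
    ultimately show ?thesis by (simp add: complex_eq_iff)
  qed
  \<comment> \<open>The substitution \<open>u = exp t\<close> reaches only t \<le> 0, so the moments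
    see half of each characteristic function; conjugation supplies the other half.\<close>
  have neg: "char M t = char N t" if "t \<le> 0" for t
    using h0[of "exp t"] that by (simp add: h_def flip: right_diff_distrib)
  have cc: "char K t = cnj (char K (- t))" for K :: "real measure" and t
    unfolding char_def by (subst Bochner_Integration.integral_cnj[symmetric]) (simp add: exp_cnj)
  have "char M t = char N t" for t
    by (cases "t \<le> 0") (use neg cc[of M t] cc[of N t] neg[of "- t"] in auto)
  then have "char M = char N" by blast
  with M N show ?thesis by (rule Levy_uniqueness)
qed

section \<open>Tightness and identification of the weak limit\<close>

lemma isCont_stieltjes_kernel:
  "k \<noteq> 0 \<Longrightarrow> isCont (\<lambda>x. 1 / (complex_of_real x - \<i> * of_nat k)) x"
  by (intro continuous_intros) (auto simp: complex_eq_iff)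

lemma norm_stieltjes_kernel_le:
  assumes "k \<noteq> 0" shows "norm (1 / (complex_of_real x - \<i> * of_nat k)) \<le> 1"
proof -
  have "1 \<le> real k" using assms by simp
  also have "\<dots> \<le> norm (complex_of_real x - \<i> * of_nat k)"
    using abs_Im_le_cmod[of "complex_of_real x - \<i> * of_nat k"] by simp
  finally show ?thesis using assms by (subst norm_divide, subst divide_le_eq_1_pos) auto
qed

lemma (in real_distribution) integrable_stieltjes_kernel:
  "k \<noteq> 0 \<Longrightarrow> integrable M (\<lambda>x. 1 / (complex_of_real x - \<i> * of_nat k))"
  by (rule integrable_const_bound[of _ 1])
     (use norm_stieltjes_kernel_le in \<open>auto intro!: borel_measurable_continuous_onI
         continuous_at_imp_continuous_on isCont_stieltjes_kernel\<close>)

lemma Im_stieltjes_kernel: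
  "Im (1 / (complex_of_real x - \<i> * of_nat k)) = real k / (x\<^sup>2 + (real k)\<^sup>2)"
  by (simp add: Im_divide power2_eq_square)

text \<open>The function 2 k^2 / (x^2 + k^2) - 1 is at most 1 everywhere and at most 0 for |x| \<ge>
  k, hence lies below the indicator. The interval is half-open to match the definition of
  \<open>tight\<close>.\<close>

lemma (in real_distribution) measure_ge_stieltjes:
  assumes k: "k \<noteq> 0"
  shows "measure M {- real k<..real k} \<ge>
     2 * (real k * Im (\<integral>x. 1 / (complex_of_real x - \<i> * of_nat k) \<partial>M)) - 1"
proof -
  have i: "integrable M (\<lambda>x. real k / (x\<^sup>2 + (real k)\<^sup>2))"
    using integrable_Im[OF integrable_stieltjes_kernel[OF k]] unfolding Im_stieltjes_kernel .
  have Im: "Im (\<integral>x. 1 / (complex_of_real x - \<i> * of_nat k) \<partial>M) = (\<integral>x. real k / (x\<^sup>2 + (real k)\<^sup>2)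
      \<partial>M)"
    using integral_Im[OF integrable_stieltjes_kernel[OF k]] unfolding Im_stieltjes_kernel by simp
  have "2 * (real k * (\<integral>x. real k / (x\<^sup>2 + (real k)\<^sup>2) \<partial>M)) - 1 =
      (\<integral>x. 2 * (real k * (real k / (x\<^sup>2 + (real k)\<^sup>2))) - 1 \<partial>M)"
  proof -
    have "integrable M (\<lambda>x. 2 * (real k * (real k / (x\<^sup>2 + (real k)\<^sup>2))))"
      by (intro integrable_mult_right i)
    then have "(\<integral>x. 2 * (real k * (real k / (x\<^sup>2 + (real k)\<^sup>2))) - 1 \<partial>M) =
      (\<integral>x. 2 * (real k * (real k / (x\<^sup>2 + (real k)\<^sup>2))) \<partial>M) - (\<integral>x. 1 \<partial>M)"
      by (intro Bochner_Integration.integral_diff) auto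
    then show ?thesis using prob_space by (simp only: integral_mult_right_zero) simp
  qed
  also have "\<dots> \<le> (\<integral>x. indicator {- real k<..real k} x \<partial>M)"
  proof (rule integral_mono)
    fix x :: real
    have *: "real k * real k \<le> x * x" if "x \<notin> {- real k<..real k}"
    proof -
      have "\<bar>real k\<bar> \<le> \<bar>x\<bar>" using that by auto
      then show ?thesis by (metis abs_le_square_iff power2_eq_square)
    qed
    have p: "x\<^sup>2 + (real k)\<^sup>2 > 0" using k by (intro add_nonneg_pos) auto
    show "2 * (real k * (real k / (x\<^sup>2 + (real k)\<^sup>2))) - 1 \<le> indicator {- real k<..real k} x"
      using p * by (cases "x \<in> {- real k<..real k}") (auto simp: field_simps power2_eq_square)
    show "integrable M (\<lambda>x. 2 * (real k * (real k / (x\<^sup>2 + (real k)\<^sup>2))) - 1)"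
      by (intro Bochner_Integration.integrable_diff integrable_mult_right i) auto
  qed (auto intro!: integrable_real_indicator simp: emeasure_eq_measure)
  finally show ?thesis by (simp add: Im)
qed

text \<open>The limit is the total mass, since k^2 / (x^2 + k^2) tends to 1 boundedly. With
  \<open>measure_ge_stieltjes\<close>, the transform at one large k thus certifies almost full mass
  on a bounded interval.\<close>

lemma (in real_distribution) stieltjes_at_infinity:
  "(\<lambda>k. real k * Im (\<integral>x. 1 / (complex_of_real x - \<i> * of_nat k) \<partial>M)) \<longlonglongrightarrow> 1"
proof -
  have "(\<lambda>k. \<integral>x. (real k)\<^sup>2 / (x\<^sup>2 + (real k)\<^sup>2) \<partial>M) \<longlonglongrightarrow> (\<integral>x. 1 \<partial>M)"
  proof (rule integral_dominated_convergence[where w = "\<lambda>_. 1"])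
    have gen: "norm (a / b) \<le> 1" if "0 \<le> a" "a \<le> b" for a b :: real
      using that by (cases "b = 0") (auto simp: divide_le_eq_1)
    show "AE x in M. (\<lambda>k. (real k)\<^sup>2 / (x\<^sup>2 + (real k)\<^sup>2)) \<longlonglongrightarrow> 1"
      by (intro AE_I2) real_asymp
    show "AE x in M. norm ((real k)\<^sup>2 / (x\<^sup>2 + (real k)\<^sup>2)) \<le> 1" for k
      by (intro AE_I2 gen) auto
  qed auto
  moreover have "\<forall>\<^sub>F k in sequentially. (\<integral>x. (real k)\<^sup>2 / (x\<^sup>2 + (real k)\<^sup>2) \<partial>M) =
      real k * Im (\<integral>x. 1 / (complex_of_real x - \<i> * of_nat k) \<partial>M)"
    using eventually_gt_at_top[of 0]
  proof eventually_elim
    case (elim k)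
    then have k: "k \<noteq> 0" by simp
    have "Im (\<integral>x. 1 / (complex_of_real x - \<i> * of_nat k) \<partial>M) = (\<integral>x. real k / (x\<^sup>2 + (real k)\<^sup>2) \<partial>M)"
      using integral_Im[OF integrable_stieltjes_kernel[OF k]] unfolding Im_stieltjes_kernel by simp
    then show ?case by (simp add: power2_eq_square flip: integral_mult_right_zero)
  qed
  ultimately show ?thesis using prob_space by (auto intro: Lim_transform_eventually)
qed

text \<open>Tightness reduces the claim to subsequential limits. The kernel is bounded and
  continuous, so such a limit has the transform of \<open>M\<close> and therefore equals
  \<open>M\<close>.\<close>

theorem weak_conv_stieltjes:
  assumes mu: "\<And>n. real_distribution (\<mu> n)" and M: "real_distribution M"
    and conv: "\<And>k. 2 \<le> k \<Longrightarrow> (\<lambda>n. \<integral>x. 1 / (complex_of_real x - \<i> * of_nat k) \<partial>\<mu> n)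
         \<longlonglongrightarrow> (\<integral>x. 1 / (complex_of_real x - \<i> * of_nat k) \<partial>M)"
  shows "weak_conv_m \<mu> M"
proof (rule tight_subseq_weak_converge[OF mu M])
  let ?S = "\<lambda>k N. Im (\<integral>x. 1 / (complex_of_real x - \<i> * of_nat k) \<partial>N)"
  have pick: "\<exists>k\<ge>2. 2 * (real k * ?S k N) - 1 > 1 - e" if "real_distribution N" "e > 0" for N e
  proof -
    interpret N: real_distribution N by fact
    have "(\<lambda>k. 2 * (real k * ?S k N) - 1) \<longlonglongrightarrow> 2 * 1 - 1"
      by (intro tendsto_intros N.stieltjes_at_infinity)
    then have "\<forall>\<^sub>F k in sequentially. 2 * (real k * ?S k N) - 1 > 1 - e"
      using \<open>e > 0\<close> by (intro order_tendstoD) auto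
    with eventually_ge_at_top[of "2::nat"]
    have "\<forall>\<^sub>F k in sequentially. 2 \<le> k \<and> 2 * (real k * ?S k N) - 1 > 1 - e"
      by eventually_elim auto
    then show ?thesis by (auto simp: eventually_sequentially)
  qed
  show "tight \<mu>" unfolding tight_def
  proof (intro conjI allI impI mu)
    fix e :: real assume e: "e > 0"
    obtain k where k: "k \<ge> 2" "2 * (real k * ?S k M) - 1 > 1 - e" using pick[OF M e] by blast
    have "(\<lambda>n. 2 * (real k * ?S k (\<mu> n)) - 1) \<longlonglongrightarrow> 2 * (real k * ?S k M) - 1"
      by (intro tendsto_intros conv k)
    then have "\<forall>\<^sub>F n in sequentially. 2 * (real k * ?S k (\<mu> n)) - 1 > 1 - e"
      using k by (intro order_tendstoD)
    then obtain N where N: "\<And>n. n \<ge> N \<Longrightarrow> 2 * (real k * ?S k (\<mu> n)) - 1 > 1 - e"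
      by (auto simp: eventually_sequentially)
    \<comment> \<open>The common \<open>k\<close> works only from index \<open>N\<close> on; the
      finitely many earlier distributions get their own \<open>K n\<close>, and the maximum
      \<open>b\<close> serves all of them.\<close>
    obtain K where K: "\<And>n. K n \<ge> 2 \<and> 2 * (real (K n) * ?S (K n) (\<mu> n)) - 1 > 1 - e"
      using pick[OF mu e] by metis
    define b where "b = Max (insert k (K ` {..<N}))"
    have kb: "k \<le> b" "n < N \<Longrightarrow> K n \<le> b" for n by (auto simp: b_def)
    have "1 - e < measure (\<mu> n) {- real b<..real b}" for n
    proof -
      interpret real_distribution "\<mu> n" by (rule mu)
      have mono: "measure (\<mu> n) {- real c<..real c} \<le> measure (\<mu> n) {- real b<..real b}"
        if "c \<le> b" for c using that by (intro finite_measure_mono) auto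
      show ?thesis
      proof (cases "n < N")
        case True
        with K[of n] measure_ge_stieltjes[of "K n"] mono[OF kb(2)[OF True]] show ?thesis by auto
      next
        case False
        with N[of n] measure_ge_stieltjes[of k] mono[OF kb(1)] k show ?thesis by auto
      qed
    qed
    moreover have "- real b < real b" using kb k by auto
    ultimately show "\<exists>a b. a < b \<and> (\<forall>n. 1 - e < measure (\<mu> n) {a<..b})" by blast
  qed
  fix s :: "nat \<Rightarrow> nat" and \<nu> assume s: "strict_mono s" and nu: "real_distribution \<nu>" and w:
      "weak_conv_m (\<mu> \<circ> s) \<nu>"
  have "\<nu> = M"
  proof (rule stieltjes_determines_distribution[OF nu M])
    fix k :: nat assume k: "2 \<le> k"
    have "(\<lambda>n. \<integral>x. 1 / (complex_of_real x - \<i> * of_nat k) \<partial>(\<mu> \<circ> s) n)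
       \<longlonglongrightarrow> (\<integral>x. 1 / (complex_of_real x - \<i> * of_nat k) \<partial>\<nu>)"
      by (rule weak_conv_imp_integral_bdd_continuous_conv[OF _ nu w, where B = 1])
         (use k mu norm_stieltjes_kernel_le isCont_stieltjes_kernel in auto)
    moreover have "(\<lambda>n. \<integral>x. 1 / (complex_of_real x - \<i> * of_nat k) \<partial>(\<mu> \<circ> s) n)
       \<longlonglongrightarrow> (\<integral>x. 1 / (complex_of_real x - \<i> * of_nat k) \<partial>M)"
      using LIMSEQ_subseq_LIMSEQ[OF conv[OF k] s] by (simp add: o_def)
    ultimately show "(\<integral>x. 1 / (complex_of_real x - \<i> * of_nat k) \<partial>\<nu>) =
       (\<integral>x. 1 / (complex_of_real x - \<i> * of_nat k) \<partial>M)" by (rule LIMSEQ_unique)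
  qed
  with w show "weak_conv_m (\<mu> \<circ> s) M" by simp
qed

section \<open>The semicircle distribution\<close>

lemma sqrt_one_minus_half_square: "sqrt (1 - (x / 2)\<^sup>2) = sqrt (4 - x\<^sup>2) / 2"
proof -
  have "1 - (x / 2)\<^sup>2 = (4 - x\<^sup>2) / 4" by (simp add: power_divide field_simps)
  then show ?thesis by (simp only: real_sqrt_divide real_sqrt_four)
qed

lemma integral_sqrt_semicircle:
  "((\<lambda>x. sqrt (4 - x\<^sup>2)) has_integral 2 * pi) {-2..2::real}"
proof -
  define F where "F x = x * sqrt (4 - x\<^sup>2) / 2 + 2 * arcsin (x / 2)" for x :: real
  have "((\<lambda>x. sqrt (4 - x\<^sup>2)) has_integral F 2 - F (-2)) {-2..2}"
  proof (rule fundamental_theorem_of_calculus_interior)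
    show "continuous_on {-2..2} F"
      unfolding F_def by (intro continuous_intros) auto
    fix x :: real assume x: "x \<in> {-2<..<2}"
    have p: "4 - x\<^sup>2 > 0"
      using x abs_square_less_1[of "x / 2"] by (auto simp: power_divide abs_less_iff)
    define r where "r = sqrt (4 - x\<^sup>2)"
    have r: "r > 0" "r * r = 4 - x\<^sup>2" using p by (auto simp: r_def)
    have d1: "((\<lambda>x. sqrt (4 - x\<^sup>2)) has_real_derivative - x / r) (at x)"
      using p by (auto intro!: derivative_eq_intros simp: r_def field_simps)
    have d2: "((\<lambda>x. arcsin (x / 2)) has_real_derivative inverse (r / 2) * (1 / 2)) (at x)"
      using x by (auto intro!: derivative_eq_intros simp: sqrt_one_minus_half_square r_def)
    have "(F has_real_derivative (1 * r + (- x / r) * x) / 2 + 2 * (inverse (r / 2) * (1 / 2)))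
        (at x)"
      unfolding F_def
      using DERIV_add[OF DERIV_cdivide[OF DERIV_mult[OF DERIV_ident d1]] DERIV_cmult[OF d2]] by
          (simp add: r_def)
    also have "(1 * r + (- x / r) * x) / 2 + 2 * (inverse (r / 2) * (1 / 2)) = (r * r + (4 - x\<^sup>2))
        / (2 * r)"
      using r(1) by (simp add: field_simps power2_eq_square)
    also have "\<dots> = r" unfolding r(2)[symmetric] using r(1) by simp
    finally have "(F has_real_derivative sqrt (4 - x\<^sup>2)) (at x)" by (simp add: r_def)
    then show "(F has_vector_derivative sqrt (4 - x\<^sup>2)) (at x)"
      by (simp add: has_real_derivative_iff_has_vector_derivative)
  qed simp
  then show ?thesis by (simp add: F_def)
qed

text \<open>The antiderivative is \<open>- arcsin (x/2) + (b/\<eta>) arctan (b x / (\<eta> sqrt (4 - x\<^sup>2)))\<close> with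
  \<open>b = sqrt (4 + \<eta>\<^sup>2)\<close>; rewriting the arc tangent as an arc sine makes it continuous at the
  endpoints.\<close>

lemma integral_sqrt_semicircle_stieltjes:
  fixes \<eta> :: real
  assumes e: "\<eta> > 0"
  shows "((\<lambda>x. sqrt (4 - x\<^sup>2) / (x\<^sup>2 + \<eta>\<^sup>2)) has_integral pi * (sqrt (4 + \<eta>\<^sup>2) / \<eta> - 1)) {-2..2}"
proof -
  define b where "b = sqrt (4 + \<eta>\<^sup>2)"
  have b: "b > 0" "b * b = 4 + \<eta>\<^sup>2" using e by (auto simp: b_def add_pos_pos)
  \<comment> \<open>The sine of the angle with tangent b x / (\<eta> sqrt (4 - x^2)): the hypotenuse
    simplifies because b^2 x^2 + \<eta>^2 (4 - x^2) = 4 (\<eta>^2 + x^2).\<close>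
  define y where "y x = x * b / (2 * sqrt (\<eta>\<^sup>2 + x\<^sup>2))" for x :: real
  define F where "F x = - arcsin (x / 2) + (b / \<eta>) * arcsin (y x)" for x :: real
  have q: "\<eta>\<^sup>2 + x\<^sup>2 > 0" for x :: real using e by (intro add_pos_nonneg) auto
  have y2: "1 - (y x)\<^sup>2 = (\<eta>\<^sup>2 * (4 - x\<^sup>2)) / (4 * (\<eta>\<^sup>2 + x\<^sup>2))" for x
  proof -
    have "(y x)\<^sup>2 = x\<^sup>2 * (4 + \<eta>\<^sup>2) / (4 * (\<eta>\<^sup>2 + x\<^sup>2))"
      using q[of x] b by (simp add: y_def power_divide power_mult_distrib power2_eq_square[of b])
    then show ?thesis using q[of x] by (simp add: field_simps)
  qed
  have yb: "\<bar>y x\<bar> \<le> 1" if "x \<in> {-2..2}" for x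
  proof -
    have "4 - x\<^sup>2 \<ge> 0"
      using that abs_square_le_1[of "x / 2"] by (auto simp: power_divide abs_le_iff)
    then have "1 - (y x)\<^sup>2 \<ge> 0" unfolding y2 using q[of x] by (intro divide_nonneg_pos
        mult_nonneg_nonneg) auto
    then show ?thesis using abs_square_le_1[of "y x"] by simp
  qed
  have yc: "continuous_on S y" for S
    unfolding y_def using q by (intro continuous_intros) (auto simp: less_imp_neq[THEN not_sym])
  have "((\<lambda>x. sqrt (4 - x\<^sup>2) / (x\<^sup>2 + \<eta>\<^sup>2)) has_integral F 2 - F (-2)) {-2..2}"
  proof (rule fundamental_theorem_of_calculus_interior)
    show "continuous_on {-2..2} F"
      unfolding F_def
      using yb by (intro continuous_intros yc) (auto simp: abs_le_iff minus_le_iff)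
    fix x :: real assume x: "x \<in> {-2<..<2}"
    have p: "4 - x\<^sup>2 > 0"
      using x abs_square_less_1[of "x / 2"] by (auto simp: power_divide abs_less_iff)
    define r where "r = sqrt (4 - x\<^sup>2)"
    define t where "t = sqrt (\<eta>\<^sup>2 + x\<^sup>2)"
    have r: "r > 0" "r * r = 4 - x\<^sup>2" and t: "t > 0" "t * t = \<eta>\<^sup>2 + x\<^sup>2"
      using p q[of x] by (auto simp: r_def t_def)
    have s1: "sqrt (1 - (x / 2)\<^sup>2) = r / 2"
      unfolding r_def by (rule sqrt_one_minus_half_square)
    have s2: "sqrt (1 - (y x)\<^sup>2) = \<eta> * r / (2 * t)"
      unfolding y2 real_sqrt_divide real_sqrt_mult real_sqrt_four using e by (simp add: r_def t_def)
    have "1 - (y x)\<^sup>2 > 0" unfolding y2 using q[of x] e p by (intro divide_pos_pos mult_pos_pos)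
        auto
    then have y1: "-1 < y x" "y x < 1" using abs_square_less_1[of "y x"] by (auto simp:
        abs_less_iff)
    have yd: "(y has_real_derivative b * \<eta>\<^sup>2 / (2 * (t * t * t))) (at x)"
    proof -
      have "((\<lambda>x. sqrt (\<eta>\<^sup>2 + x\<^sup>2)) has_real_derivative x / t) (at x)"
        using q[of x] by (auto intro!: derivative_eq_intros simp: t_def field_simps)
      from DERIV_divide[OF DERIV_cmult_right[OF DERIV_ident, of b] DERIV_cmult[OF this, of 2]]
          t(1) e
      have "(y has_real_derivative (b * (2 * sqrt (\<eta>\<^sup>2 + x\<^sup>2)) - x * b * (2 * (x / t))) /
          (2 * sqrt (\<eta>\<^sup>2 + x\<^sup>2) * (2 * sqrt (\<eta>\<^sup>2 + x\<^sup>2)))) (at x)"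
        unfolding y_def by (simp add: t_def)
      also have "(b * (2 * sqrt (\<eta>\<^sup>2 + x\<^sup>2)) - x * b * (2 * (x / t))) /
          (2 * sqrt (\<eta>\<^sup>2 + x\<^sup>2) * (2 * sqrt (\<eta>\<^sup>2 + x\<^sup>2))) = b * (t * t - x\<^sup>2) / (2 * (t * t * t))"
        unfolding t_def[symmetric] using t(1) by (simp add: field_simps power2_eq_square)
      also have "t * t - x\<^sup>2 = \<eta>\<^sup>2" using t by simp
      finally show ?thesis .
    qed
    have d1: "((\<lambda>x. arcsin (x / 2)) has_real_derivative inverse (r / 2) * (1 / 2)) (at x)"
      using x by (auto intro!: derivative_eq_intros simp: s1)
    have d2: "((\<lambda>x. arcsin (y x)) has_real_derivative inverse (\<eta> * r / (2 * t)) * (b * \<eta>\<^sup>2 / (2 *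
        (t * t * t)))) (at x)"
      using DERIV_chain2[OF DERIV_arcsin[OF y1] yd] by (simp add: s2)
    have "(F has_real_derivative - (inverse (r / 2) * (1 / 2)) +
        (b / \<eta>) * (inverse (\<eta> * r / (2 * t)) * (b * \<eta>\<^sup>2 / (2 * (t * t * t))))) (at x)"
      unfolding F_def by (intro DERIV_add DERIV_minus DERIV_cmult d1 d2)
    also have "- (inverse (r / 2) * (1 / 2)) +
        (b / \<eta>) * (inverse (\<eta> * r / (2 * t)) * (b * \<eta>\<^sup>2 / (2 * (t * t * t)))) = (b * b - t * t) /
            (r * (t * t))"
      using r(1) t(1) e by (simp add: field_simps power2_eq_square)
    also have "b * b - t * t = r * r" using b r t by simp
    also have "r * r / (r * (t * t)) = r / (t * t)" using r(1) by simp
    also have "\<dots> = sqrt (4 - x\<^sup>2) / (x\<^sup>2 + \<eta>\<^sup>2)"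
      unfolding t(2) r_def by (simp only: add.commute)
    finally show "(F has_vector_derivative sqrt (4 - x\<^sup>2) / (x\<^sup>2 + \<eta>\<^sup>2)) (at x)"
      by (simp add: has_real_derivative_iff_has_vector_derivative)
  qed simp
  moreover have "y 2 = 1" "y (-2) = -1"
    using b by (auto simp: y_def b_def add.commute)
  ultimately show ?thesis by (simp add: F_def b_def algebra_simps)
qed

text \<open>Passes from the gauge integral over [-2, 2] to the Lebesgue integral against the
  density. The truncation by \<open>max\<close> matters: \<open>sqrt\<close> is extended as an odd
  function, so the bare root would be negative outside [-2, 2].\<close>

lemma lborel_integral_semicircle_weight:
  fixes g :: "real \<Rightarrow> real"
  assumes g: "continuous_on UNIV g" and I: "((\<lambda>x. sqrt (4 - x\<^sup>2) * g x) has_integral I) {-2..2}"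
  shows "has_bochner_integral lborel (\<lambda>x. sqrt (max (4 - x\<^sup>2) 0) * g x) I"
proof -
  let ?h = "\<lambda>x. sqrt (max (4 - x\<^sup>2) 0) * g x"
  have out: "max (4 - x\<^sup>2) 0 = 0" if "x \<notin> {-2..2}" for x :: real
  proof -
    have "\<not> x\<^sup>2 \<le> 2\<^sup>2" using that by (subst abs_le_square_iff[symmetric]) (auto simp: abs_le_iff)
    then show ?thesis by simp
  qed
  have ins: "max (4 - x\<^sup>2) 0 = 4 - x\<^sup>2" if "x \<in> {-2..2}" for x :: real
  proof -
    have "x\<^sup>2 \<le> 2\<^sup>2" using that by (subst abs_le_square_iff[symmetric]) (auto simp: abs_le_iff)
    then show ?thesis by simp
  qed
  have eq: "indicator {-2..2} x *\<^sub>R ?h x = ?h x" for x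
    using out[of x] by (auto simp: indicator_def)
  have "continuous_on {-2..2} ?h"
    by (intro continuous_intros continuous_on_subset[OF g]) auto
  then have si: "set_integrable lborel {-2..2} ?h" by (rule borel_integrable_atLeastAtMost')
  have "integral {-2..2} ?h = integral {-2..2} (\<lambda>x. sqrt (4 - x\<^sup>2) * g x)"
    by (intro Henstock_Kurzweil_Integration.integral_cong) (simp add: ins)
  then have "set_lebesgue_integral lborel {-2..2} ?h = I"
    using set_borel_integral_eq_integral(2)[OF si] integral_unique[OF I] by simp
  then show ?thesis using si
    unfolding set_lebesgue_integral_def set_integrable_def eq by (simp add:
        has_bochner_integral_iff)
qed

lemma real_distribution_semicircle: "real_distribution semicircle"
proof -
  have hb: "has_bochner_integral lborel (\<lambda>x. sqrt (max (4 - x\<^sup>2) 0) * (1 / (2 * pi))) (2 * pi * (1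
      / (2 * pi)))"
    using lborel_integral_semicircle_weight[of "\<lambda>_. 1 / (2 * pi)"]
      has_integral_mult_left[OF integral_sqrt_semicircle, of "1 / (2 * pi)"] by (simp add:
          mult.commute)
  have "emeasure semicircle (space semicircle) = (\<integral>\<^sup>+x. ennreal (sqrt (max (4 - x\<^sup>2) 0) / (2 *
      pi)) \<partial>lborel)"
    unfolding semicircle_def by (subst emeasure_density) (auto simp: space_density)
  also have "\<dots> = 1"
    using hb
    by (subst nn_integral_eq_integral) (auto simp: has_bochner_integral_iff)
  finally have "prob_space semicircle" by (rule prob_spaceI)
  then interpret prob_space semicircle .
  show ?thesis
    by unfold_locales (auto simp: semicircle_def)
qed

text \<open>The real part vanishes by symmetry; the imaginary part is the integral computed above.
  The value is the root of m^2 + z m + 1 = 0 at z = \<i> \<eta> with positive imaginary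
  part.\<close>

theorem semicircle_stieltjes:
  fixes \<eta> :: real
  assumes e: "\<eta> > 0"
  shows "(\<integral>x. 1 / (complex_of_real x - \<i> * of_real \<eta>) \<partial>semicircle) =
     \<i> * of_real ((sqrt (\<eta>\<^sup>2 + 4) - \<eta>) / 2)"
proof -
  let ?\<rho> = "\<lambda>x. sqrt (max (4 - x\<^sup>2) 0) / (2 * pi)"
  let ?k = "\<lambda>x. 1 / (complex_of_real x - \<i> * of_real \<eta>)"
  have q: "x\<^sup>2 + \<eta>\<^sup>2 \<noteq> 0" for x using e by (simp add: add_nonneg_eq_0_iff)
  have cx: "continuous_on UNIV (\<lambda>x. x / (x\<^sup>2 + \<eta>\<^sup>2))" and cx': "continuous_on UNIV (\<lambda>x. 1 / (x\<^sup>2 +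
      \<eta>\<^sup>2))"
    by (intro continuous_intros ballI q)+
  interpret real_distribution semicircle by (rule real_distribution_semicircle)
  have ki: "integrable semicircle ?k"
  proof (rule integrable_const_bound[of _ "1 / \<eta>"])
    have "norm (?k x) \<le> 1 / \<eta>" for x
    proof -
      have "\<eta> \<le> norm (complex_of_real x - \<i> * of_real \<eta>)"
        using abs_Im_le_cmod[of "complex_of_real x - \<i> * of_real \<eta>"] e by simp
      then show ?thesis using e by (simp add: norm_divide frac_le)
    qed
    then show "AE x in semicircle. norm (?k x) \<le> 1 / \<eta>" by simp
  qed (auto simp: semicircle_def)
  have dens: "(\<integral>x. h x \<partial>semicircle) = (\<integral>x. ?\<rho> x * h x \<partial>lborel)" if [measurable]: "h \<in>
      borel_measurable borel" for h :: "real \<Rightarrow> real"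
    unfolding semicircle_def by (subst integral_density) auto
  have "Im (\<integral>x. ?k x \<partial>semicircle) = (\<integral>x. ?\<rho> x * (\<eta> / (x\<^sup>2 + \<eta>\<^sup>2)) \<partial>lborel)"
    by (subst integral_Im[OF ki, symmetric], subst dens[symmetric])
       (auto simp: Im_divide power2_eq_square intro!: Bochner_Integration.integral_cong)
  also have "\<dots> = (\<eta> / (2 * pi)) * (\<integral>x. sqrt (max (4 - x\<^sup>2) 0) * (1 / (x\<^sup>2 + \<eta>\<^sup>2)) \<partial>lborel)"
    by (subst integral_mult_right_zero[symmetric]) (simp add: mult_ac)
  also have "(\<integral>x. sqrt (max (4 - x\<^sup>2) 0) * (1 / (x\<^sup>2 + \<eta>\<^sup>2)) \<partial>lborel) = pi * (sqrt (4 + \<eta>\<^sup>2) / \<eta> -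
      1)"
    using lborel_integral_semicircle_weight[OF cx'] integral_sqrt_semicircle_stieltjes[OF e]
    by (simp add: has_bochner_integral_iff)
  also have "\<eta> / (2 * pi) * (pi * (sqrt (4 + \<eta>\<^sup>2) / \<eta> - 1)) = (sqrt (\<eta>\<^sup>2 + 4) - \<eta>) / 2"
    using e by (simp add: field_simps)
  finally have Im: "Im (\<integral>x. ?k x \<partial>semicircle) = (sqrt (\<eta>\<^sup>2 + 4) - \<eta>) / 2" .
  define R where "R = (\<integral>x. ?\<rho> x * (x / (x\<^sup>2 + \<eta>\<^sup>2)) \<partial>lborel)"
  have "R = (\<integral>x. ?\<rho> (- x) * (- x / ((- x)\<^sup>2 + \<eta>\<^sup>2)) \<partial>lborel)"
    unfolding R_def using lborel_integral_real_affine[of "-1" "\<lambda>x. ?\<rho> x * (x / (x\<^sup>2 + \<eta>\<^sup>2))" 0] by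
        simp
  also have "\<dots> = - R" unfolding R_def by simp
  finally have "R = 0" by simp
  moreover have "Re (\<integral>x. ?k x \<partial>semicircle) = R"
    unfolding R_def
    by (subst integral_Re[OF ki, symmetric], subst dens[symmetric])
       (auto simp: Re_divide power2_eq_square intro!: Bochner_Integration.integral_cong)
  ultimately show ?thesis using Im by (simp add: complex_eq_iff)
qed

section \<open>Removing a single entry\<close>

text \<open>Both mirror positions are cleared, so that the matrix stays Hermitian and, when the
  upper entries are independent, no longer depends on the removed one.\<close>

definition zero_entry :: "nat \<Rightarrow> nat \<Rightarrow> (nat \<Rightarrow> nat \<Rightarrow> complex) \<Rightarrow> nat \<Rightarrow> nat \<Rightarrow> complex" where
  "zero_entry i j f a b = (if a = i \<and> b = j \<or> a = j \<and> b = i then 0 else f a b)"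

lemma hermitian_zero_entry:
  assumes "hermitian n f" shows "hermitian n (zero_entry i j f)"
  unfolding hermitian_def zero_entry_def
  by (intro allI impI) (simp add: hermitianD[OF assms, symmetric] conj_commute disj_commute)

lemma resolvent_col_le:
  assumes h: "hermitian n f" and z: "Im z > 0" and i: "i < n"
  shows "(\<Sum>k<n. (cmod (resolvent n z f k i))\<^sup>2) \<le> 1 / (Im z)\<^sup>2"
proof -
  have "Im z \<noteq> 0" using z by simp
  from ward_row[OF h this i] ward_col[OF h this i] z
  have "(\<Sum>k<n. (cmod (resolvent n z f k i))\<^sup>2) = (\<Sum>k<n. (cmod (resolvent n z f i k))\<^sup>2)"
    by (metis mult_cancel_left \<open>Im z \<noteq> 0\<close>)
  then show ?thesis using resolvent_row_le[OF h z i] by simp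
qed

text \<open>A rank-two case of the resolvent identity. The diagonal case is separate because there
  the two terms would count the same entry twice.\<close>

lemma resolvent_zero_entry_offdiag:
  assumes h: "hermitian n f" and z: "Im z \<noteq> 0" and ij: "i < n" "j < n" "i \<noteq> j" and ab: "a < n" "b
      < n"
  defines "G \<equiv> resolvent n z f" and "H \<equiv> resolvent n z (zero_entry i j f)"
  shows "H a b - G a b = H a i * f i j * G j b + H a j * cnj (f i j) * G i b"
proof -
  have d: "f k l - zero_entry i j f k l =
      of_bool (k = i) * of_bool (l = j) * f i j + of_bool (k = j) * of_bool (l = i) * f j i" for k l
    using ij(3) by (auto simp: zero_entry_def)
  have "H a b - G a b = (\<Sum>k<n. \<Sum>l<n. H a k * (f k l - zero_entry i j f k l) * G l b)"
    unfolding G_def H_def by (rule resolvent_diff[OF hermitian_zero_entry[OF h] h z ab])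
  also have "\<dots> = (\<Sum>k<n. \<Sum>l<n. (of_bool (k = i) * H a k) * (of_bool (l = j) * (f i j * G l b))
       + (of_bool (k = j) * H a k) * (of_bool (l = i) * (f j i * G l b)))"
    unfolding d by (intro sum.cong refl) (simp add: algebra_simps)
  also have "\<dots> = H a i * (f i j * G j b) + H a j * (f j i * G i b)"
    unfolding sum.distrib sum_product[symmetric] using ij by (simp add: sum_of_bool_mult)
  finally show ?thesis using hermitianD[OF h ij(1,2)] by (simp add: mult.assoc)
qed

lemma resolvent_zero_entry_diag:
  assumes h: "hermitian n f" and z: "Im z \<noteq> 0" and i: "i < n" and ab: "a < n" "b < n"
  defines "G \<equiv> resolvent n z f" and "H \<equiv> resolvent n z (zero_entry i i f)"
  shows "H a b - G a b = H a i * f i i * G i b"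
proof -
  have d: "f k l - zero_entry i i f k l = of_bool (k = i) * of_bool (l = i) * f i i" for k l
    by (auto simp: zero_entry_def)
  have "H a b - G a b = (\<Sum>k<n. \<Sum>l<n. H a k * (f k l - zero_entry i i f k l) * G l b)"
    unfolding G_def H_def by (rule resolvent_diff[OF hermitian_zero_entry[OF h] h z ab])
  also have "\<dots> = (\<Sum>k<n. \<Sum>l<n. (of_bool (k = i) * H a k) * (of_bool (l = i) * (f i i * G l b)))"
    unfolding d by (intro sum.cong refl) (simp add: algebra_simps)
  also have "\<dots> = H a i * (f i i * G i b)"
    unfolding sum_product[symmetric] using i by (simp add: sum_of_bool_mult)
  finally show ?thesis by (simp add: mult.assoc)
qed

section \<open>Second-order expansion in one entry, with explicit errors\<close>

lemma norm_mult_le: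
  fixes a b :: complex
  assumes "norm a \<le> x" "norm b \<le> y" shows "norm (a * b) \<le> x * y"
  unfolding norm_mult using assms by (intro mult_mono) (auto intro: order.trans[OF norm_ge_zero])

context
  fixes n :: nat and z m :: complex and f :: "nat \<Rightarrow> nat \<Rightarrow> complex" and i j :: nat
  assumes h: "hermitian n f" and z: "Im z \<ge> 2" and ij: "i < n" "j < n" and m: "norm m \<le> 1 / 2"
begin

private definition "G = resolvent n z f"
private definition "H = resolvent n z (zero_entry i j f)"
private definition "w = f i j"
private definition "q = min 1 (norm (f i j))"

private lemma half: "1 / Im z \<le> 1 / 2" using z by (simp add: field_simps)

private lemma G_le: "a < n \<Longrightarrow> b < n \<Longrightarrow> norm (G a b) \<le> 1 / 2"
  unfolding G_def using resolvent_norm_le[OF h, of z a b] half z by linarith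

private lemma H_le: "a < n \<Longrightarrow> b < n \<Longrightarrow> norm (H a b) \<le> 1 / 2"
  unfolding H_def using resolvent_norm_le[OF hermitian_zero_entry[OF h, of i j], of z a b] half z
      by linarith

private lemma q: "0 \<le> q" "q \<le> 1" "q \<le> norm w" by (auto simp: q_def w_def)

private lemma zn: "Im z \<noteq> 0" using z by simp

private lemma off: "i \<noteq> j \<Longrightarrow> a < n \<Longrightarrow> b < n \<Longrightarrow> H a b - G a b = H a i * w * G j b + H a j * cnj w * G
    i b"
  unfolding G_def H_def w_def by (rule resolvent_zero_entry_offdiag[OF h zn ij])

private lemma dia: "i = j \<Longrightarrow> a < n \<Longrightarrow> b < n \<Longrightarrow> H a b - G a b = H a i * w * G i b"
  unfolding G_def H_def w_def using resolvent_zero_entry_diag[OF h zn ij(1)] by simp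

private lemma HG: "a < n \<Longrightarrow> b < n \<Longrightarrow> norm (H a b - G a b) \<le> norm w / 2"
proof (cases "i = j")
  case True
  assume ab: "a < n" "b < n"
  have "norm (H a i * w * G i b) \<le> 1 / 2 * norm w * (1 / 2)"
    using ab ij by (intro norm_mult_le G_le H_le order_refl) auto
  also have "\<dots> \<le> norm w / 2" by simp
  finally show ?thesis by (simp only: dia[OF True ab])
next
  case False
  assume ab: "a < n" "b < n"
  have "norm (H a i * w * G j b + H a j * cnj w * G i b) \<le> 1 / 2 * norm w * (1 / 2) + 1 / 2 * norm
      w * (1 / 2)"
    using ab ij by (intro order.trans[OF norm_triangle_ineq] add_mono norm_mult_le G_le H_le) auto
  then show ?thesis by (simp add: off[OF False ab])
qed

text \<open>Both resolvents are bounded by 1/2, so the linear bound saturates at 1. Thanks to this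
  the matrix itself is never truncated: the mean of \<open>q\<close> times |w|^2 is at most
  \<epsilon> times the variance plus the tail beyond \<epsilon>, for every \<epsilon> > 0.\<close>

private lemma HGq: "a < n \<Longrightarrow> b < n \<Longrightarrow> norm (H a b - G a b) \<le> q"
  using HG[of a b] norm_triangle_ineq4[of "H a b" "G a b"] G_le[of a b] H_le[of a b]
      norm_ge_zero[of w]
  unfolding q_def w_def[symmetric] by linarith

private lemma D_le: "norm (cnj (G i i - m)) \<le> 1" "norm (cnj (H i i - m)) \<le> 1"
  using norm_triangle_ineq4[of "G i i" m] norm_triangle_ineq4[of "H i i" m] m G_le[OF ij(1) ij(1)]
      H_le[OF ij(1) ij(1)]
  unfolding complex_mod_cnj by linarith+

private lemma DD: "norm (cnj (G i i - m) - cnj (H i i - m)) = norm (H i i - G i i)"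
proof -
  have "cnj (G i i - m) - cnj (H i i - m) = cnj (G i i - H i i)" by simp
  then show ?thesis unfolding complex_mod_cnj by (metis complex_mod_cnj norm_minus_commute)
qed

text \<open>Discrete product rule; 3/2 = 1/2 + 1, from the bounds on \<open>G i i\<close> and on the
  test factor.\<close>

private lemma DG: "norm (cnj (G i i - m) * G i i - cnj (H i i - m) * H i i) \<le> 3 / 2 * norm (H i i
    - G i i)"
proof -
  have eq: "cnj (G i i - m) * G i i - cnj (H i i - m) * H i i =
    (cnj (G i i - m) - cnj (H i i - m)) * G i i + cnj (H i i - m) * (G i i - H i i)"
    by (simp add: algebra_simps)
  have "norm ((cnj (G i i - m) - cnj (H i i - m)) * G i i + cnj (H i i - m) * (G i i - H i i))
      \<le> norm (H i i - G i i) * (1 / 2) + 1 * norm (H i i - G i i)"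
    by (rule order.trans[OF norm_triangle_ineq add_mono[OF norm_mult_le[OF eq_refl[OF DD] G_le[OF
        ij(1) ij(1)]]
          norm_mult_le[OF D_le(2) eq_refl[OF norm_minus_commute]]]])
  then show ?thesis unfolding eq by linarith
qed

private lemma DGq: "norm (cnj (G i i - m) * G i i - cnj (H i i - m) * H i i) \<le> 3 / 2 * q"
  using DG HGq[OF ij(1) ij(1)] by linarith

text \<open>Used to return from the reduced resolvent to the full one after independence has been
  exploited. The constant 2 rounds up 1/2 + 3/4.\<close>

lemma resolvent_triple_diff_le:
  "norm (cnj (resolvent n z (zero_entry i j f) i i - m) * resolvent n z (zero_entry i j f) j j *
      resolvent n z (zero_entry i j f) i i
      - cnj (resolvent n z f i i - m) * resolvent n z f j j * resolvent n z f i i) \<le> 2 * min 1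
          (norm (f i j))"
proof -
  have eq: "cnj (H i i - m) * H j j * H i i - cnj (G i i - m) * G j j * G i i =
     cnj (H i i - m) * H i i * (H j j - G j j) - G j j * (cnj (G i i - m) * G i i - cnj (H i i -
         m) * H i i)"
    by (simp add: algebra_simps)
  have "norm (cnj (H i i - m) * H i i * (H j j - G j j) - G j j * (cnj (G i i - m) * G i i - cnj
      (H i i - m) * H i i))
      \<le> 1 * (1 / 2) * q + 1 / 2 * (3 / 2 * q)"
    by (rule order.trans[OF norm_triangle_ineq4], rule add_mono; intro norm_mult_le D_le H_le G_le
        HGq DGq ij)
  also have "\<dots> \<le> 2 * q" using q by simp
  finally have "norm (cnj (H i i - m) * H j j * H i i - cnj (G i i - m) * G j j * G i i) \<le> 2 * q"
    unfolding eq .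
  then show ?thesis unfolding G_def H_def q_def .
qed

text \<open>The resolvent with the entry removed is independent of that entry, so in expectation the linear
  term vanishes and only the quadratic one survives.\<close>

lemma resolvent_entry_expansion:
  "norm (f i j * cnj (resolvent n z f i i - m) * resolvent n z f j i
     + of_real ((norm (f i j))\<^sup>2) * (cnj (resolvent n z (zero_entry i j f) i i - m) * resolvent n
         z (zero_entry i j f) j j * resolvent n z (zero_entry i j f) i i)
     - f i j * (cnj (resolvent n z (zero_entry i j f) i i - m) * resolvent n z (zero_entry i j f)
         j i))
   \<le> 3 * (norm (f i j))\<^sup>2 * (min 1 (norm (f i j)) + (norm (resolvent n z f i j))\<^sup>2 + (norm
       (resolvent n z f j i))\<^sup>2)
     + of_bool (i = j) * (norm (f i j))\<^sup>2"
proof -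
  define D D' where "D = cnj (G i i - m)" and "D' = cnj (H i i - m)"
  define g g' where "g = norm (G i j)" and "g' = norm (G j i)"
  have gg: "0 \<le> g" "0 \<le> g'" "g \<le> 1 / 2" "g' \<le> 1 / 2" using G_le ij by (auto simp: g_def g'_def)
  let ?W = "norm w"
  have ww: "of_real ((norm w)\<^sup>2) = w * cnj w" by (rule complex_norm_square)
  have "norm (w * D * G j i + of_real (?W\<^sup>2) * (D' * H j j * H i i) - w * (D' * H j i))
     \<le> 3 * ?W\<^sup>2 * (q + g\<^sup>2 + g'\<^sup>2) + of_bool (i = j) * ?W\<^sup>2"
  proof (cases "i = j")
    \<comment> \<open>On the diagonal no cancellation is sought: the change of the tested resolvent
      costs 3/4 |w|^2 and the quadratic term 1/4 |w|^2. A row contains only one such entry.\<close>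
    case True
    have "norm (w * D * G j i + of_real (?W\<^sup>2) * (D' * H j j * H i i) - w * (D' * H j i)) =
       norm (w * (D * G i i - D' * H i i) + of_real (?W\<^sup>2) * (D' * H i i * H i i))"
      unfolding True[symmetric] by (simp add: algebra_simps)
    also have "\<dots> \<le> ?W * (3 / 2 * (?W / 2)) + ?W\<^sup>2 * (1 * (1 / 2) * (1 / 2))"
    proof (rule order.trans[OF norm_triangle_ineq], rule add_mono)
      have "norm (D * G i i - D' * H i i) \<le> 3 / 2 * (?W / 2)"
        using DG HG[OF ij(1) ij(1)] unfolding D_def D'_def by linarith
      then show "norm (w * (D * G i i - D' * H i i)) \<le> ?W * (3 / 2 * (?W / 2))"
        by (intro norm_mult_le order_refl)
      have "norm (of_real (?W\<^sup>2) :: complex) \<le> ?W\<^sup>2" unfolding norm_of_real by simp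
      then show "norm (of_real (?W\<^sup>2) * (D' * H i i * H i i)) \<le> ?W\<^sup>2 * (1 * (1 / 2) * (1 / 2))"
        unfolding D'_def by (intro norm_mult_le H_le D_le ij)
    qed
    also have "\<dots> = ?W\<^sup>2" by (simp add: power2_eq_square)
    also have "\<dots> \<le> 3 * ?W\<^sup>2 * (q + g\<^sup>2 + g'\<^sup>2) + of_bool (i = j) * ?W\<^sup>2"
      using q True by (simp add: add_nonneg_nonneg)
    finally show ?thesis .
  next
    case False
    have Hji: "norm (H j i) \<le> g' + q" and Hij: "norm (H i j) \<le> g + q"
      using HGq[OF ij(2,1)] HGq[OF ij] norm_triangle_sub[of "H j i" "G j i"] norm_triangle_sub[of
          "H i j" "G i j"]
      by (auto simp: g_def g'_def)
    have Hij': "norm (H i j) \<le> 1 / 2" by (rule H_le[OF ij])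
    have E: "G j i = H j i - (H j i * w * G j i + H j j * cnj w * G i i)"
      using off[OF False ij(2,1)] by (simp add: algebra_simps)
    have "w * D * G j i = w * D * (H j i - (H j i * w * G j i + H j j * cnj w * G i i))"
      by (subst E) simp
    \<comment> \<open>Three errors remain: the change of the test factor, the \<open>w * w\<close>
      term, and the change of \<open>D * G i i\<close>. The mean of \<open>w * w\<close> need not
      vanish, as real symmetric matrices show, so that term is beaten by its two off-diagonal
      resolvent entries.\<close>
    then have X: "w * D * G j i + of_real (?W\<^sup>2) * (D' * H j j * H i i) - w * (D' * H j i) =
       w * (D - D') * H j i - w * w * D * H j i * G j i - w * cnj w * H j j * (D * G i i - D' * H
           i i)"
      unfolding ww by (simp add: algebra_simps)
    \<comment> \<open>The general bound |w| / 2 is too weak here: it would leave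
      \<open>H j i\<close> as the only off-diagonal factor, while Ward sums squares. Expanding at
      (i, i) exhibits a second one.\<close>
    have Hii: "norm (H i i - G i i) \<le> ?W * (g' + norm (H i j)) / 2"
    proof -
      have "norm (H i i * w * G j i + H i j * cnj w * G i i) \<le> 1 / 2 * ?W * g' + norm (H i j) * ?W
          * (1 / 2)"
        using ij by (intro order.trans[OF norm_triangle_ineq] add_mono norm_mult_le G_le H_le)
            (auto simp: g'_def)
      also have "1 / 2 * ?W * g' + norm (H i j) * ?W * (1 / 2) = ?W * (g' + norm (H i j)) / 2"
        by (simp add: algebra_simps)
      finally show ?thesis unfolding off[OF False ij(1) ij(1)] .
    qed
    have "norm (w * (D - D') * H j i) \<le> ?W * (?W * (g' + norm (H i j)) / 2) * (g' + q)"
      using Hji Hii[folded DD, folded D_def D'_def] by (intro norm_mult_le order_refl)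
    also have "\<dots> = ?W\<^sup>2 * ((g' + norm (H i j)) * (g' + q) / 2)" by (simp add: power2_eq_square)
    also have "\<dots> \<le> ?W\<^sup>2 * (q + g\<^sup>2 + g'\<^sup>2)"
    proof (intro mult_left_mono)
      have "(g' + norm (H i j)) * (g' + q) = g'\<^sup>2 + g' * norm (H i j) + q * (g' + norm (H i j))"
        by (simp add: algebra_simps power2_eq_square)
      also have "\<dots> \<le> g'\<^sup>2 + g' * (g + q) + q * 1"
        using Hij Hij' gg q by (intro add_mono mult_left_mono order_refl) auto
      also have "g' * (g + q) \<le> g' * g + q * (1 / 2)"
        using gg q mult_right_mono[of g' "1/2" q] by (simp add: algebra_simps)
      also have "g' * g \<le> (g'\<^sup>2 + g\<^sup>2) / 2" using sum_squares_bound[of g' g] by simp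
      finally have "(g' + norm (H i j)) * (g' + q) \<le> g'\<^sup>2 + ((g'\<^sup>2 + g\<^sup>2) / 2 + q * (1 / 2)) + q"
          by simp
      then have "(g' + norm (H i j)) * (g' + q) / 2 \<le> (g'\<^sup>2 + ((g'\<^sup>2 + g\<^sup>2) / 2 + q * (1 / 2)) +
          q) / 2"
        by (rule divide_right_mono) simp
      also have "\<dots> \<le> q + g\<^sup>2 + g'\<^sup>2"
        using q zero_le_power2[of g] zero_le_power2[of g'] by (simp add: field_simps)
      finally show "(g' + norm (H i j)) * (g' + q) / 2 \<le> q + g\<^sup>2 + g'\<^sup>2" .
    qed simp
    finally have T1: "norm (w * (D - D') * H j i) \<le> ?W\<^sup>2 * (q + g\<^sup>2 + g'\<^sup>2)" .
    have "norm (w * w * D * H j i * G j i) \<le> ?W * ?W * 1 * (g' + q) * g'"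
      using Hji D_le(1) by (intro norm_mult_le) (auto simp: g'_def D_def)
    also have "\<dots> = ?W\<^sup>2 * ((g' + q) * g')" by (simp add: power2_eq_square)
    also have "\<dots> \<le> ?W\<^sup>2 * (q + g\<^sup>2 + g'\<^sup>2)"
    proof (intro mult_left_mono)
      have "q * g' \<le> q * 1" using gg q by (intro mult_left_mono) auto
      moreover have "(g' + q) * g' = g'\<^sup>2 + q * g'" by (simp add: algebra_simps power2_eq_square)
      ultimately show "(g' + q) * g' \<le> q + g\<^sup>2 + g'\<^sup>2" using zero_le_power2[of g] by linarith
    qed simp
    finally have T2: "norm (w * w * D * H j i * G j i) \<le> ?W\<^sup>2 * (q + g\<^sup>2 + g'\<^sup>2)" .
    have "norm (w * cnj w * H j j * (D * G i i - D' * H i i)) \<le> ?W * ?W * (1 / 2) * (3 / 2 * q)"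
      unfolding D_def D'_def by (intro norm_mult_le H_le DGq ij) auto
    also have "\<dots> = ?W\<^sup>2 * (3 / 4 * q)" by (simp add: power2_eq_square)
    also have "\<dots> \<le> ?W\<^sup>2 * (q + g\<^sup>2 + g'\<^sup>2)"
    proof (intro mult_left_mono)
      have "g'\<^sup>2 \<ge> 0" "g\<^sup>2 \<ge> 0" by auto
      then show "3 / 4 * q \<le> q + g\<^sup>2 + g'\<^sup>2" using q by linarith
    qed simp
    finally have T3: "norm (w * cnj w * H j j * (D * G i i - D' * H i i)) \<le> ?W\<^sup>2 * (q + g\<^sup>2 +
        g'\<^sup>2)" .
    show ?thesis unfolding X
      using T1 T2 T3 norm_triangle_ineq4[of "w * (D - D') * H j i - w * w * D * H j i * G j i" "w
          * cnj w * H j j * (D * G i i - D' * H i i)"]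
        norm_triangle_ineq4[of "w * (D - D') * H j i" "w * w * D * H j i * G j i"] False by simp
  qed
  then show ?thesis unfolding D_def D'_def G_def H_def w_def q_def g_def g'_def .
qed

end

section \<open>Random Hermitian matrices\<close>

lemma borel_measurable_cnj [measurable (raw)]:
  "f \<in> borel_measurable M \<Longrightarrow> (\<lambda>x. cnj (f x)) \<in> borel_measurable M"
  by (rule borel_measurable_continuous_on[of cnj]) (auto intro: continuous_intros)

lemma (in prob_space) integrable_mult_bounded:
  fixes u g :: "'a \<Rightarrow> complex"
  assumes u: "integrable M u" and g: "g \<in> borel_measurable M" and b: "\<And>x. x \<in> space M \<Longrightarrow> norm (g x)
      \<le> B"
  shows "integrable M (\<lambda>x. u x * g x)"
proof (rule Bochner_Integration.integrable_bound[of _ "\<lambda>x. B * norm (u x)"])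
  show "integrable M (\<lambda>x. B * norm (u x))" using u by simp
  show "AE x in M. norm (u x * g x) \<le> norm (B * norm (u x))"
  proof (rule AE_I2)
    fix x assume x: "x \<in> space M"
    have "norm (u x * g x) \<le> norm (u x) * B"
      using b[OF x] by (intro norm_mult_le) auto
    then show "norm (u x * g x) \<le> norm (B * norm (u x))" by (simp add: mult.commute)
  qed
qed (use u g in auto)

definition upper :: "nat \<Rightarrow> (nat \<times> nat) set" where
  "upper n = {(i, j). i \<le> j \<and> j < n}"

text \<open>Taking the real part on the diagonal makes the matrix Hermitian for every \<open>x\<close>, which the
  bounded difference argument on the product space requires.\<close>

definition herm_of :: "(nat \<times> nat) set \<Rightarrow> (nat \<times> nat \<Rightarrow> complex) \<Rightarrow> nat \<Rightarrow> nat \<Rightarrow> complex" where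
  "herm_of A x a b = (if a < b then (if (a, b) \<in> A then x (a, b) else 0)
     else if a = b then (if (a, a) \<in> A then of_real (Re (x (a, a))) else 0)
     else (if (b, a) \<in> A then cnj (x (b, a)) else 0))"

lemma hermitian_herm_of: "hermitian n (herm_of A x)"
  by (auto simp: hermitian_def herm_of_def)

lemma measurable_herm_of:
  "(\<lambda>x. herm_of A x a b) \<in> borel_measurable (Pi\<^sub>M A (\<lambda>_. borel))"
proof -
  have *: "(\<lambda>x. x p) \<in> borel_measurable (Pi\<^sub>M A (\<lambda>_. borel))" if "p \<in> A" for p :: "nat \<times> nat"
    using that by (rule measurable_component_singleton)
  consider "a < b" | "a = b" | "b < a" by linarith
  then show ?thesis
  proof cases
    case 1 then show ?thesis by (cases "(a, b) \<in> A") (auto simp: herm_of_def *)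
  next
    case 2 then show ?thesis by (cases "(a, a) \<in> A") (auto simp: herm_of_def * intro!:
        borel_measurable_of_real borel_measurable_Re)
  next
    case 3 then show ?thesis by (cases "(b, a) \<in> A") (auto simp: herm_of_def * intro!:
        borel_measurable_cnj)
  qed
qed

locale random_hermitian = prob_space M for M :: "'a measure" +
  fixes n :: nat and W :: "'a \<Rightarrow> nat \<Rightarrow> nat \<Rightarrow> complex"
  assumes entry_measurable: "\<And>i j. i < n \<Longrightarrow> j < n \<Longrightarrow> (\<lambda>\<omega>. W \<omega> i j) \<in> borel_measurable M"
    and herm: "\<And>\<omega>. \<omega> \<in> space M \<Longrightarrow> hermitian n (W \<omega>)"
    and indep: "indep_vars (\<lambda>_. borel) (\<lambda>(i, j) \<omega>. W \<omega> i j) (upper n)"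
    and upper_mean: "\<And>i j. i \<le> j \<Longrightarrow> j < n \<Longrightarrow> integrable M (\<lambda>\<omega>. W \<omega> i j) \<and> expectation (\<lambda>\<omega>. W \<omega> i j)
        = 0"
    and upper_square: "\<And>i j. i \<le> j \<Longrightarrow> j < n \<Longrightarrow> integrable M (\<lambda>\<omega>. (norm (W \<omega> i j))\<^sup>2)"
begin

lemma conj_entry: "\<omega> \<in> space M \<Longrightarrow> i < n \<Longrightarrow> j < n \<Longrightarrow> cnj (W \<omega> i j) = W \<omega> j i"
  using hermitianD[OF herm, of \<omega> i j] by simp

lemma
  assumes ij: "i < n" "j < n"
  shows entry_integrable: "integrable M (\<lambda>\<omega>. W \<omega> i j)"
    and entry_mean: "expectation (\<lambda>\<omega>. W \<omega> i j) = 0"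
    and entry_square_integrable: "integrable M (\<lambda>\<omega>. (norm (W \<omega> i j))\<^sup>2)"
proof -
  have "integrable M (\<lambda>\<omega>. W \<omega> i j) \<and> expectation (\<lambda>\<omega>. W \<omega> i j) = 0 \<and> integrable M (\<lambda>\<omega>. (norm (W \<omega>
      i j))\<^sup>2)"
  proof (cases "i \<le> j")
    case True
    then show ?thesis using upper_mean[OF True ij(2)] upper_square[OF True ij(2)] by simp
  next
    case False
    then have le: "j \<le> i" by simp
    note up = upper_mean[OF le ij(1)] upper_square[OF le ij(1)]
    have "integrable M (\<lambda>\<omega>. cnj (W \<omega> j i))" "expectation (\<lambda>\<omega>. cnj (W \<omega> j i)) = 0"
      using up(1) by auto
    moreover have "integrable M (\<lambda>\<omega>. W \<omega> i j) \<longleftrightarrow> integrable M (\<lambda>\<omega>. cnj (W \<omega> j i))"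
      by (intro Bochner_Integration.integrable_cong refl) (simp only: conj_entry ij)
    moreover have "expectation (\<lambda>\<omega>. W \<omega> i j) = expectation (\<lambda>\<omega>. cnj (W \<omega> j i))"
      by (intro Bochner_Integration.integral_cong refl) (simp only: conj_entry ij)
    moreover have "integrable M (\<lambda>\<omega>. (norm (W \<omega> i j))\<^sup>2) \<longleftrightarrow> integrable M (\<lambda>\<omega>. (norm (W \<omega> j i))\<^sup>2)"
    proof (intro Bochner_Integration.integrable_cong refl)
      fix \<omega> assume "\<omega> \<in> space M"
      from conj_entry[OF this ij(2,1)] show "(norm (W \<omega> i j))\<^sup>2 = (norm (W \<omega> j i))\<^sup>2"
        by (metis complex_mod_cnj)
    qed
    ultimately show ?thesis using up(2) by simp
  qed
  then show "integrable M (\<lambda>\<omega>. W \<omega> i j)" "expectation (\<lambda>\<omega>. W \<omega> i j) = 0" "integrable M (\<lambda>\<omega>. (norm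
      (W \<omega> i j))\<^sup>2)"
    by blast+
qed

text \<open>With \<open>A = upper n\<close> this rebuilds the matrix, and with one index taken out
  of \<open>A\<close> it gives \<open>zero_entry\<close>. Taking real parts on the diagonal changes
  nothing, because those entries are real.\<close>

lemma herm_of_entries:
  assumes w: "\<omega> \<in> space M" and ab: "a < n" "b < n" and A: "A \<subseteq> upper n"
  shows "herm_of A (restrict (\<lambda>p. (\<lambda>(i, j) \<omega>. W \<omega> i j) p \<omega>) A) a b =
    (if (min a b, max a b) \<in> A then W \<omega> a b else 0)"
proof -
  have "of_real (Re (W \<omega> a a)) = W \<omega> a a"
  proof -
    have "W \<omega> a a \<in> \<real>" using conj_entry[OF w ab(1) ab(1)] by (simp add: Reals_cnj_iff)
    then show ?thesis by simp
  qed
  then show ?thesis using conj_entry[OF w ab(2,1)] by (auto simp: herm_of_def min_def max_def)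
qed

text \<open>The factors are functions of the disjoint coordinate sets \<open>{p}\<close> and
  \<open>upper n - {p}\<close>. An entry below the diagonal is read as the conjugate of its mirror.
  \<open>\<Phi>\<close> is evaluated at a matrix rebuilt by \<open>herm_of\<close>, hence the
  demands that it see only indices below \<open>n\<close> and be measurable over the product
  space.\<close>

lemma expectation_mult_indep_entry:
  fixes g :: "complex \<Rightarrow> complex" and \<Phi> :: "(nat \<Rightarrow> nat \<Rightarrow> complex) \<Rightarrow> complex"
  assumes ij: "i < n" "j < n" and g [measurable]: "g \<in> borel_measurable borel"
    and cong: "\<And>f f'. (\<And>a b. a < n \<Longrightarrow> b < n \<Longrightarrow> f a b = f' a b) \<Longrightarrow> \<Phi> f = \<Phi> f'"
    and meas: "\<And>(N :: (nat \<times> nat \<Rightarrow> complex) measure) F. (\<And>a b. a < n \<Longrightarrow> b < n \<Longrightarrow> (\<lambda>x. F x a b) \<in>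
        borel_measurable N) \<Longrightarrow>
       (\<lambda>x. \<Phi> (F x)) \<in> borel_measurable N"
    and int: "integrable M (\<lambda>\<omega>. g (W \<omega> i j))" "integrable M (\<lambda>\<omega>. \<Phi> (zero_entry i j (W \<omega>)))"
  shows "expectation (\<lambda>\<omega>. g (W \<omega> i j) * \<Phi> (zero_entry i j (W \<omega>))) =
     expectation (\<lambda>\<omega>. g (W \<omega> i j)) * expectation (\<lambda>\<omega>. \<Phi> (zero_entry i j (W \<omega>)))"
proof -
  define p where "p = (min i j, max i j)"
  define A where "A = upper n - {p}"
  let ?X = "\<lambda>p \<omega>. (\<lambda>(i, j) \<omega>. W \<omega> i j) p \<omega>"
  have p: "p \<in> upper n" using ij by (auto simp: p_def upper_def)
  define Y1 where "Y1 x = g (if i \<le> j then x p else cnj (x p))" for x :: "nat \<times> nat \<Rightarrow> complex"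
  define Y2 where "Y2 x = \<Phi> (herm_of A x)" for x
  have [measurable]: "(\<lambda>x. x p) \<in> borel_measurable (Pi\<^sub>M {p} (\<lambda>_. borel))"
    by (rule measurable_component_singleton) simp
  have Y1: "Y1 \<in> borel_measurable (Pi\<^sub>M {p} (\<lambda>_. borel))"
    unfolding Y1_def by (cases "i \<le> j") (simp_all only: if_True if_False, measurable)
  have Y2: "Y2 \<in> borel_measurable (Pi\<^sub>M A (\<lambda>_. borel))"
    unfolding Y2_def by (rule meas) (rule measurable_herm_of)
  have "indep_var (Pi\<^sub>M {p} (\<lambda>_. borel)) (\<lambda>\<omega>. restrict (\<lambda>p. ?X p \<omega>) {p}) (Pi\<^sub>M A (\<lambda>_. borel)) (\<lambda>\<omega>.
      restrict (\<lambda>p. ?X p \<omega>) A)"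
    by (rule indep_var_restrict[OF indep]) (use p in \<open>auto simp: A_def\<close>)
  note iv = indep_var_compose[OF this Y1 Y2]
  have e1: "(Y1 \<circ> (\<lambda>\<omega>. restrict (\<lambda>p. ?X p \<omega>) {p})) \<omega> = g (W \<omega> i j)" if "\<omega> \<in> space M" for \<omega>
    using conj_entry[OF that ij(2,1)] by (auto simp: Y1_def p_def min_def max_def)
  have e2: "(Y2 \<circ> (\<lambda>\<omega>. restrict (\<lambda>p. ?X p \<omega>) A)) \<omega> = \<Phi> (zero_entry i j (W \<omega>))" if "\<omega> \<in> space M"
      for \<omega>
    unfolding Y2_def comp_def
  proof (rule cong)
    fix a b assume ab: "a < n" "b < n"
    have "(min a b, max a b) \<in> A \<longleftrightarrow> \<not> (a = i \<and> b = j \<or> a = j \<and> b = i)"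
      using ab by (auto simp: A_def p_def upper_def min_def max_def split: if_splits)
    then show "herm_of A (restrict (\<lambda>p. ?X p \<omega>) A) a b = zero_entry i j (W \<omega>) a b"
      using herm_of_entries[OF that ab, of A] by (auto simp: A_def zero_entry_def)
  qed
  have i1: "integrable M (Y1 \<circ> (\<lambda>\<omega>. restrict (\<lambda>p. ?X p \<omega>) {p}))"
    using int(1) e1 by (subst Bochner_Integration.integrable_cong[OF refl]) auto
  have i2: "integrable M (Y2 \<circ> (\<lambda>\<omega>. restrict (\<lambda>p. ?X p \<omega>) A))"
    using int(2) e2 by (subst Bochner_Integration.integrable_cong[OF refl]) auto
  have "expectation (\<lambda>\<omega>. g (W \<omega> i j) * \<Phi> (zero_entry i j (W \<omega>))) =
    expectation (\<lambda>\<omega>. (Y1 \<circ> (\<lambda>\<omega>. restrict (\<lambda>p. ?X p \<omega>) {p})) \<omega> * (Y2 \<circ> (\<lambda>\<omega>. restrict (\<lambda>p. ?X p \<omega>)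
        A)) \<omega>)"
    by (intro Bochner_Integration.integral_cong refl) (simp only: e1 e2)
  also have "\<dots> = expectation (Y1 \<circ> (\<lambda>\<omega>. restrict (\<lambda>p. ?X p \<omega>) {p})) * expectation (Y2 \<circ> (\<lambda>\<omega>.
      restrict (\<lambda>p. ?X p \<omega>) A))"
    by (rule indep_var_lebesgue_integral[OF iv i1 i2])
  also have "\<dots> = expectation (\<lambda>\<omega>. g (W \<omega> i j)) * expectation (\<lambda>\<omega>. \<Phi> (zero_entry i j (W \<omega>)))"
    by (intro arg_cong2[of _ _ _ _ "(*)"] Bochner_Integration.integral_cong refl) (simp_all only:
        e1 e2)
  finally show ?thesis .
qed

end

lemma (in prob_space) integrable_bounded:
  fixes g :: "'a \<Rightarrow> 'b::{banach, second_countable_topology}"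
  assumes "g \<in> borel_measurable M" and "\<And>x. x \<in> space M \<Longrightarrow> norm (g x) \<le> B"
  shows "integrable M g"
  by (rule integrable_const_bound[of _ B]) (use assms in auto)

lemma norm_integral_le_integral:
  fixes f :: "'a \<Rightarrow> 'b::{banach, second_countable_topology}"
  assumes "integrable M f" "integrable M g" "\<And>x. x \<in> space M \<Longrightarrow> norm (f x) \<le> g x"
  shows "norm (integral\<^sup>L M f) \<le> integral\<^sup>L M g"
  by (rule order.trans[OF integral_norm_bound integral_mono]) (use assms in auto)

section \<open>The expansion in expectation, controlled by tails\<close>

context random_hermitian
begin

definition variance_entry :: "nat \<Rightarrow> nat \<Rightarrow> real" where
  "variance_entry i j = expectation (\<lambda>\<omega>. (norm (W \<omega> i j))\<^sup>2)"

definition tail_entry :: "real \<Rightarrow> nat \<Rightarrow> nat \<Rightarrow> real" where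
  "tail_entry \<epsilon> i j = expectation (\<lambda>\<omega>. if norm (W \<omega> i j) > \<epsilon> then (norm (W \<omega> i j))\<^sup>2 else 0)"

lemma variance_entry_nonneg: "variance_entry i j \<ge> 0"
  unfolding variance_entry_def by (rule Bochner_Integration.integral_nonneg) auto

lemma variance_entry_commute:
  assumes "i < n" "j < n" shows "variance_entry i j = variance_entry j i"
  unfolding variance_entry_def
proof (intro Bochner_Integration.integral_cong refl)
  fix \<omega> assume "\<omega> \<in> space M"
  from conj_entry[OF this assms] show "(norm (W \<omega> i j))\<^sup>2 = (norm (W \<omega> j i))\<^sup>2"
    by (metis complex_mod_cnj)
qed

lemma tail_integrable:
  assumes ij: "i < n" "j < n"
  shows "integrable M (\<lambda>\<omega>. if norm (W \<omega> i j) > \<epsilon> then (norm (W \<omega> i j))\<^sup>2 else 0)"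
proof (rule Bochner_Integration.integrable_bound[OF entry_square_integrable[OF ij]])
  note [measurable] = entry_measurable[OF ij]
  show "(\<lambda>\<omega>. if norm (W \<omega> i j) > \<epsilon> then (norm (W \<omega> i j))\<^sup>2 else 0) \<in> borel_measurable M" by
      measurable
qed auto

lemma resolvent_measurable: "a < n \<Longrightarrow> b < n \<Longrightarrow> (\<lambda>\<omega>. resolvent n z (W \<omega>) a b) \<in> borel_measurable M"
  by (rule measurable_resolvent) (rule entry_measurable)

lemma resolvent_zero_entry_measurable:
  "a < n \<Longrightarrow> b < n \<Longrightarrow> (\<lambda>\<omega>. resolvent n z (zero_entry i j (W \<omega>)) a b) \<in> borel_measurable M"
  by (rule measurable_resolvent) (cases rule: case_split, auto simp: zero_entry_def intro!:
      measurable_If entry_measurable)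

text \<open>With \<open>P\<close> the probability of exceeding \<epsilon>, the truncated mean is at
  most \<epsilon> + P. The variance is at most \<epsilon>^2 plus the tail; multiplied by
  \<open>P\<close>, the first part is bounded by the tail by Chebyshev and the second since P \<le>
  1.\<close>

lemma variance_mult_truncated_mean:
  assumes ij: "i < n" "j < n" and e: "0 < \<epsilon>"
  shows "variance_entry i j * expectation (\<lambda>\<omega>. min 1 (norm (W \<omega> i j))) \<le> \<epsilon> * variance_entry i j +
      2 * tail_entry \<epsilon> i j"
proof -
  note [measurable] = entry_measurable[OF ij]
  let ?w = "\<lambda>\<omega>. norm (W \<omega> i j)"
  let ?I = "\<lambda>\<omega>. if ?w \<omega> > \<epsilon> then 1 else 0 :: real"
  have iI: "integrable M ?I" by (rule integrable_bounded[of _ 1]) auto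
  have iq: "integrable M (\<lambda>\<omega>. min 1 (?w \<omega>))" by (rule integrable_bounded[of _ 1]) auto
  define P where "P = expectation ?I"
  have P0: "0 \<le> P" unfolding P_def by (rule Bochner_Integration.integral_nonneg) auto
  have "P \<le> expectation (\<lambda>_. 1)" unfolding P_def by (rule integral_mono[OF iI]) auto
  then have P1: "P \<le> 1" by (simp add: prob_space)
  have "expectation (\<lambda>\<omega>. min 1 (?w \<omega>)) \<le> expectation (\<lambda>\<omega>. \<epsilon> + ?I \<omega>)"
    by (rule integral_mono[OF iq]) (use iI e in \<open>auto simp: min_def\<close>)
  also have "\<dots> = \<epsilon> + P" using iI by (simp add: P_def prob_space)
  finally have q: "expectation (\<lambda>\<omega>. min 1 (?w \<omega>)) \<le> \<epsilon> + P" .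
  have "expectation (\<lambda>\<omega>. \<epsilon>\<^sup>2 * ?I \<omega>) \<le> tail_entry \<epsilon> i j"
    unfolding tail_entry_def
  proof (rule integral_mono[OF _ tail_integrable[OF ij]])
    show "integrable M (\<lambda>\<omega>. \<epsilon>\<^sup>2 * ?I \<omega>)" by (intro integrable_mult_right iI)
  qed (use e in \<open>auto intro: power_mono\<close>)
  then have eP: "\<epsilon>\<^sup>2 * P \<le> tail_entry \<epsilon> i j" unfolding P_def integral_mult_right_zero .
  have "variance_entry i j \<le> expectation (\<lambda>\<omega>. \<epsilon>\<^sup>2 + (if ?w \<omega> > \<epsilon> then (?w \<omega>)\<^sup>2 else 0))"
    unfolding variance_entry_def
    by (rule integral_mono[OF entry_square_integrable[OF ij]])
       (use tail_integrable[OF ij] in \<open>auto intro: power_mono\<close>)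
  also have "\<dots> = \<epsilon>\<^sup>2 + tail_entry \<epsilon> i j"
    using tail_integrable[OF ij] by (simp add: tail_entry_def prob_space)
  finally have v: "variance_entry i j \<le> \<epsilon>\<^sup>2 + tail_entry \<epsilon> i j" .
  have t0: "0 \<le> tail_entry \<epsilon> i j" unfolding tail_entry_def by (rule
      Bochner_Integration.integral_nonneg) auto
  have "variance_entry i j * expectation (\<lambda>\<omega>. min 1 (?w \<omega>)) \<le> variance_entry i j * (\<epsilon> + P)"
    by (rule mult_left_mono[OF q variance_entry_nonneg])
  also have "\<dots> = \<epsilon> * variance_entry i j + variance_entry i j * P" by (simp add: algebra_simps)
  also have "variance_entry i j * P \<le> (\<epsilon>\<^sup>2 + tail_entry \<epsilon> i j) * P" by (rule mult_right_mono[OF v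
      P0])
  also have "(\<epsilon>\<^sup>2 + tail_entry \<epsilon> i j) * P = \<epsilon>\<^sup>2 * P + tail_entry \<epsilon> i j * P" by (simp add:
      algebra_simps)
  also have "tail_entry \<epsilon> i j * P \<le> tail_entry \<epsilon> i j" using t0 P1 P0 by (simp add: mult_left_le)
  finally show ?thesis using eP by linarith
qed

context
  fixes z m :: complex
  assumes z: "Im z \<ge> 2" and m: "norm m \<le> 1 / 2"
begin

lemma norm_resolvent_le_half:
  "\<omega> \<in> space M \<Longrightarrow> a < n \<Longrightarrow> b < n \<Longrightarrow> norm (resolvent n z (W \<omega>) a b) \<le> 1 / 2"
  "\<omega> \<in> space M \<Longrightarrow> a < n \<Longrightarrow> b < n \<Longrightarrow> norm (resolvent n z (zero_entry i j (W \<omega>)) a b) \<le> 1 / 2"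
proof -
  have "1 / Im z \<le> 1 / 2" using z by (simp add: field_simps)
  then show "\<omega> \<in> space M \<Longrightarrow> a < n \<Longrightarrow> b < n \<Longrightarrow> norm (resolvent n z (W \<omega>) a b) \<le> 1 / 2"
    "\<omega> \<in> space M \<Longrightarrow> a < n \<Longrightarrow> b < n \<Longrightarrow> norm (resolvent n z (zero_entry i j (W \<omega>)) a b) \<le> 1 / 2"
    using resolvent_norm_le[OF herm, of \<omega> z a b] resolvent_norm_le[OF hermitian_zero_entry[OF
        herm, of \<omega> i j], of z a b] z
    by linarith+
qed

lemma norm_resolvent_diff_le:
  "\<omega> \<in> space M \<Longrightarrow> a < n \<Longrightarrow> norm (resolvent n z (W \<omega>) a a - m) \<le> 1"
  "\<omega> \<in> space M \<Longrightarrow> a < n \<Longrightarrow> norm (resolvent n z (zero_entry i j (W \<omega>)) a a - m) \<le> 1"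
  using norm_resolvent_le_half(1)[of \<omega> a a] norm_resolvent_le_half(2)[of \<omega> a a i j] m
      norm_triangle_ineq4[of "resolvent n z (W \<omega>) a a" m]
    norm_triangle_ineq4[of "resolvent n z (zero_entry i j (W \<omega>)) a a" m] by linarith+

text \<open>In the mean of the pointwise expansion the linear term drops out, the quadratic one
  factorises, and its reduced resolvent is then replaced by the full one. The weights are 5 = 3 + 2
  and 10 = 6 + 4, from the pointwise error and from this replacement.\<close>

lemma entry_error:
  assumes ij: "i < n" "j < n" and e: "0 < \<epsilon>"
  shows "norm (expectation (\<lambda>\<omega>. W \<omega> i j * (cnj (resolvent n z (W \<omega>) i i - m) * resolvent n z (W \<omega>)
      j i)) +
      variance_entry i j * expectation (\<lambda>\<omega>. cnj (resolvent n z (W \<omega>) i i - m) * resolvent n z (W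
          \<omega>) j j * resolvent n z (W \<omega>) i i))
    \<le> 5 * \<epsilon> * variance_entry i j + 10 * tail_entry \<epsilon> i j
      + 3 * \<epsilon>\<^sup>2 * expectation (\<lambda>\<omega>. (norm (resolvent n z (W \<omega>) i j))\<^sup>2 + (norm (resolvent n z (W \<omega>)
          j i))\<^sup>2)
      + of_bool (i = j) * \<epsilon>\<^sup>2"
proof -
  define G where "G = (\<lambda>\<omega>. resolvent n z (W \<omega>))"
  define H where "H = (\<lambda>\<omega>. resolvent n z (zero_entry i j (W \<omega>)))"
  define w where "w = (\<lambda>\<omega>. W \<omega> i j)"
  define P where "P = (\<lambda>\<omega>. cnj (G \<omega> i i - m) * G \<omega> j j * G \<omega> i i)"
  define P0 where "P0 = (\<lambda>\<omega>. cnj (H \<omega> i i - m) * H \<omega> j j * H \<omega> i i)"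
  define Q where "Q = (\<lambda>\<omega>. cnj (G \<omega> i i - m) * G \<omega> j i)"
  define Q0 where "Q0 = (\<lambda>\<omega>. cnj (H \<omega> i i - m) * H \<omega> j i)"
  define X where "X = (\<lambda>\<omega>. w \<omega> * Q \<omega> + of_real ((norm (w \<omega>))\<^sup>2) * P0 \<omega> - w \<omega> * Q0 \<omega>)"
  define \<tau> where "\<tau> = (\<lambda>\<omega>. if norm (w \<omega>) > \<epsilon> then (norm (w \<omega>))\<^sup>2 else 0)"
  define \<gamma> where "\<gamma> = (\<lambda>\<omega>. (norm (G \<omega> i j))\<^sup>2 + (norm (G \<omega> j i))\<^sup>2)"
  have Gm [measurable]: "(\<lambda>\<omega>. G \<omega> a b) \<in> borel_measurable M" if "a < n" "b < n" for a b
    unfolding G_def using that by (rule resolvent_measurable)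
  have Hm [measurable]: "(\<lambda>\<omega>. H \<omega> a b) \<in> borel_measurable M" if "a < n" "b < n" for a b
    unfolding H_def using that by (rule resolvent_zero_entry_measurable)
  have wm [measurable]: "w \<in> borel_measurable M" unfolding w_def using ij by (rule entry_measurable)
  have PQm [measurable]: "P \<in> borel_measurable M" "P0 \<in> borel_measurable M" "Q \<in> borel_measurable
      M" "Q0 \<in> borel_measurable M"
    unfolding P_def P0_def Q_def Q0_def using ij by measurable
  have bP: "norm (P \<omega>) \<le> 1 * (1/2) * (1/2)" "norm (P0 \<omega>) \<le> 1 * (1/2) * (1/2)"
    "norm (Q \<omega>) \<le> 1 * (1/2)" "norm (Q0 \<omega>) \<le> 1 * (1/2)" if "\<omega> \<in> space M" for \<omega>
    unfolding P_def P0_def Q_def Q0_def G_def H_def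
    using norm_resolvent_le_half[OF that] norm_resolvent_diff_le[OF that] ij
    by (intro norm_mult_le; simp only: complex_mod_cnj)+
  have wi: "integrable M w" unfolding w_def by (rule entry_integrable[OF ij])
  have w2i: "integrable M (\<lambda>\<omega>. (norm (w \<omega>))\<^sup>2)" unfolding w_def by (rule
      entry_square_integrable[OF ij])
  have w2ic: "integrable M (\<lambda>\<omega>. complex_of_real ((norm (w \<omega>))\<^sup>2))" using w2i by (rule
      integrable_of_real)
  have iP: "integrable M P" "integrable M P0" "integrable M Q" "integrable M Q0"
    by (rule integrable_bounded[OF PQm(1) bP(1)] integrable_bounded[OF PQm(2) bP(2)]
        integrable_bounded[OF PQm(3) bP(3)] integrable_bounded[OF PQm(4) bP(4)]; assumption)+
  have iwQ: "integrable M (\<lambda>\<omega>. w \<omega> * Q \<omega>)" "integrable M (\<lambda>\<omega>. w \<omega> * Q0 \<omega>)"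
    by (rule integrable_mult_bounded[OF wi PQm(3) bP(3)] integrable_mult_bounded[OF wi PQm(4)
        bP(4)]; assumption)+
  have iwP: "integrable M (\<lambda>\<omega>. of_real ((norm (w \<omega>))\<^sup>2) * P0 \<omega>)"
    by (rule integrable_mult_bounded[OF w2ic PQm(2) bP(2)])
  have \<tau>i: "integrable M \<tau>" unfolding \<tau>_def w_def by (rule tail_integrable[OF ij])
  have qi: "integrable M (\<lambda>\<omega>. min 1 (norm (w \<omega>)))" by (rule integrable_bounded[of _ 1]) auto
  have g1: "(norm (G \<omega> a b))\<^sup>2 \<le> (1/2)\<^sup>2" if "\<omega> \<in> space M" "a < n" "b < n" for \<omega> a b
    unfolding G_def using norm_resolvent_le_half(1)[OF that] by (intro power_mono) auto
  have \<gamma>b: "0 \<le> \<gamma> \<omega>" "\<gamma> \<omega> \<le> 1 / 2" if "\<omega> \<in> space M" for \<omega>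
    using g1[OF that ij] g1[OF that ij(2,1)] by (auto simp: \<gamma>_def power2_eq_square)
  have \<gamma>i: "integrable M \<gamma>"
  proof (rule integrable_bounded)
    show "\<gamma> \<in> borel_measurable M" unfolding \<gamma>_def using ij by measurable
    show "norm (\<gamma> \<omega>) \<le> 1 / 2" if "\<omega> \<in> space M" for \<omega> using \<gamma>b[OF that] by simp
  qed
  have EX: "expectation X = expectation (\<lambda>\<omega>. w \<omega> * Q \<omega>) + expectation (\<lambda>\<omega>. of_real ((norm (w
      \<omega>))\<^sup>2) * P0 \<omega>) -
     expectation (\<lambda>\<omega>. w \<omega> * Q0 \<omega>)"
    unfolding X_def using iwQ iwP by simp
  have "expectation (\<lambda>\<omega>. (\<lambda>x. x) (W \<omega> i j) * (\<lambda>f. cnj (resolvent n z f i i - m) * resolvent n z f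
      j i) (zero_entry i j (W \<omega>))) =
     expectation (\<lambda>\<omega>. (\<lambda>x. x) (W \<omega> i j)) * expectation (\<lambda>\<omega>. (\<lambda>f. cnj (resolvent n z f i i - m) *
         resolvent n z f j i) (zero_entry i j (W \<omega>)))"
  proof (rule expectation_mult_indep_entry[OF ij])
    show "integrable M (\<lambda>\<omega>. (\<lambda>f. cnj (resolvent n z f i i - m) * resolvent n z f j i) (zero_entry
        i j (W \<omega>)))"
      using iP(4) by (simp add: Q0_def H_def)
    show "integrable M (\<lambda>\<omega>. (\<lambda>x. x) (W \<omega> i j))" using wi by (simp add: w_def)
    show "(\<lambda>x. cnj (resolvent n z (F x) i i - m) * resolvent n z (F x) j i) \<in> borel_measurable N"
      if "\<And>a b. a < n \<Longrightarrow> b < n \<Longrightarrow> (\<lambda>x. F x a b) \<in> borel_measurable N" for N :: "(nat \<times> nat \<Rightarrow>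
          complex) measure" and F
      using measurable_resolvent[OF that] ij by measurable
  next
    fix f f' :: "nat \<Rightarrow> nat \<Rightarrow> complex" assume "\<And>a b. a < n \<Longrightarrow> b < n \<Longrightarrow> f a b = f' a b"
    then have "resolvent n z f = resolvent n z f'" by (rule resolvent_cong)
    then show "cnj (resolvent n z f i i - m) * resolvent n z f j i = cnj (resolvent n z f' i i -
        m) * resolvent n z f' j i"
      by simp
  qed simp
  then have E3: "expectation (\<lambda>\<omega>. w \<omega> * Q0 \<omega>) = 0"
    using entry_mean[OF ij] by (simp add: w_def Q0_def H_def)
  have "expectation (\<lambda>\<omega>. (\<lambda>x. of_real ((norm x)\<^sup>2)) (W \<omega> i j) * (\<lambda>f. cnj (resolvent n z f i i - m)
      * resolvent n z f j j * resolvent n z f i i) (zero_entry i j (W \<omega>))) =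
     expectation (\<lambda>\<omega>. (\<lambda>x. of_real ((norm x)\<^sup>2)) (W \<omega> i j)) * expectation (\<lambda>\<omega>. (\<lambda>f. cnj (resolvent
         n z f i i - m) * resolvent n z f j j * resolvent n z f i i) (zero_entry i j (W \<omega>)))"
  proof (rule expectation_mult_indep_entry[OF ij])
    show "integrable M (\<lambda>\<omega>. (\<lambda>f. cnj (resolvent n z f i i - m) * resolvent n z f j j * resolvent n
        z f i i) (zero_entry i j (W \<omega>)))"
      using iP(2) by (simp add: P0_def H_def)
    show "integrable M (\<lambda>\<omega>. (\<lambda>x. complex_of_real ((norm x)\<^sup>2)) (W \<omega> i j))" using w2ic by (simp
        add: w_def)
    show "(\<lambda>x. cnj (resolvent n z (F x) i i - m) * resolvent n z (F x) j j * resolvent n z (F x) i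
        i) \<in> borel_measurable N"
      if "\<And>a b. a < n \<Longrightarrow> b < n \<Longrightarrow> (\<lambda>x. F x a b) \<in> borel_measurable N" for N :: "(nat \<times> nat \<Rightarrow>
          complex) measure" and F
      using measurable_resolvent[OF that] ij by measurable
  next
    fix f f' :: "nat \<Rightarrow> nat \<Rightarrow> complex" assume "\<And>a b. a < n \<Longrightarrow> b < n \<Longrightarrow> f a b = f' a b"
    then have "resolvent n z f = resolvent n z f'" by (rule resolvent_cong)
    then show "cnj (resolvent n z f i i - m) * resolvent n z f j j * resolvent n z f i i = cnj
        (resolvent n z f' i i - m) * resolvent n z f' j j * resolvent n z f' i i"
      by simp
  qed simp
  then have E2: "expectation (\<lambda>\<omega>. of_real ((norm (w \<omega>))\<^sup>2) * P0 \<omega>) = of_real (variance_entry i j)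
      * expectation P0"
    unfolding variance_entry_def by (simp add: w_def P0_def H_def del: of_real_power flip:
        integral_of_real)
  have "expectation (\<lambda>\<omega>. w \<omega> * Q \<omega>) + variance_entry i j * expectation P =
     expectation X - variance_entry i j * expectation (\<lambda>\<omega>. P0 \<omega> - P \<omega>)"
    unfolding EX E2 E3 Bochner_Integration.integral_diff[OF iP(2,1)] right_diff_distrib by simp
  then have N: "norm (expectation (\<lambda>\<omega>. w \<omega> * Q \<omega>) + variance_entry i j * expectation P) \<le>
     norm (expectation X) + variance_entry i j * norm (expectation (\<lambda>\<omega>. P0 \<omega> - P \<omega>))"
    using norm_triangle_ineq4[of "expectation X" "variance_entry i j * expectation (\<lambda>\<omega>. P0 \<omega> - P
        \<omega>)"]
      variance_entry_nonneg[of i j] by (simp add: norm_mult)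
  have "norm (expectation (\<lambda>\<omega>. P0 \<omega> - P \<omega>)) \<le> expectation (\<lambda>\<omega>. 2 * min 1 (norm (w \<omega>)))"
  proof (rule norm_integral_le_integral)
    show "norm (P0 \<omega> - P \<omega>) \<le> 2 * min 1 (norm (w \<omega>))" if "\<omega> \<in> space M" for \<omega>
      using resolvent_triple_diff_le[OF herm[OF that] z ij m] unfolding P0_def P_def G_def H_def
          w_def .
  qed (use iP qi in auto)
  also have "\<dots> = 2 * expectation (\<lambda>\<omega>. min 1 (norm (w \<omega>)))" by simp
  finally have "variance_entry i j * norm (expectation (\<lambda>\<omega>. P0 \<omega> - P \<omega>)) \<le>
      variance_entry i j * (2 * expectation (\<lambda>\<omega>. min 1 (norm (w \<omega>))))"
    by (rule mult_left_mono[OF _ variance_entry_nonneg])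
  with variance_mult_truncated_mean[OF ij e]
  have N2: "variance_entry i j * norm (expectation (\<lambda>\<omega>. P0 \<omega> - P \<omega>)) \<le> 2 * (\<epsilon> * variance_entry i j
      + 2 * tail_entry \<epsilon> i j)"
    by (simp add: w_def)
  have "norm (expectation X) \<le> expectation (\<lambda>\<omega>. 3 * \<epsilon> * (norm (w \<omega>))\<^sup>2 + 6 * \<tau> \<omega> + 3 * \<epsilon>\<^sup>2 * \<gamma> \<omega> +
      of_bool (i = j) * \<epsilon>\<^sup>2)"
  proof (rule norm_integral_le_integral)
    show "integrable M X" unfolding X_def using iwQ iwP by simp
    show "integrable M (\<lambda>\<omega>. 3 * \<epsilon> * (norm (w \<omega>))\<^sup>2 + 6 * \<tau> \<omega> + 3 * \<epsilon>\<^sup>2 * \<gamma> \<omega> + of_bool (i = j) *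
        \<epsilon>\<^sup>2)"
      by (intro Bochner_Integration.integrable_add integrable_mult_right w2i \<tau>i \<gamma>i integrable_const)
    fix \<omega> assume o: "\<omega> \<in> space M"
    let ?w = "(norm (w \<omega>))\<^sup>2"
    have t0: "0 \<le> \<tau> \<omega>" by (simp add: \<tau>_def)
    have b1: "?w * min 1 (norm (w \<omega>)) \<le> \<epsilon> * ?w + \<tau> \<omega>"
    proof (cases "norm (w \<omega>) > \<epsilon>")
      case True
      have "?w * min 1 (norm (w \<omega>)) \<le> ?w * 1" by (intro mult_left_mono) auto
      then show ?thesis using True e by (simp add: \<tau>_def add_increasing)
    next
      case False
      then have "?w * min 1 (norm (w \<omega>)) \<le> ?w * \<epsilon>" by (intro mult_left_mono) auto
      then show ?thesis using False by (simp add: \<tau>_def mult.commute)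
    qed
    \<comment> \<open>Against \<open>\<gamma>\<close> the square is replaced by \<epsilon>^2, not by
      the variance: \<epsilon>^2 is the same for all entries, so that \<open>\<gamma>\<close> can be
      summed along a row by Ward.\<close>
    have b3: "?w \<le> \<epsilon>\<^sup>2 + \<tau> \<omega>"
      using e by (auto simp: \<tau>_def intro: power_mono)
    have "?w * \<gamma> \<omega> \<le> (\<epsilon>\<^sup>2 + \<tau> \<omega>) * \<gamma> \<omega>" by (rule mult_right_mono[OF b3 \<gamma>b(1)[OF o]])
    also have "\<dots> = \<epsilon>\<^sup>2 * \<gamma> \<omega> + \<tau> \<omega> * \<gamma> \<omega>" by (rule distrib_right)
    also have "\<tau> \<omega> * \<gamma> \<omega> \<le> \<tau> \<omega> * (1 / 2)" by (rule mult_left_mono[OF \<gamma>b(2)[OF o] t0])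
    finally have b2: "?w * \<gamma> \<omega> \<le> \<epsilon>\<^sup>2 * \<gamma> \<omega> + \<tau> \<omega> / 2" by simp
    have b4: "of_bool (i = j) * ?w \<le> of_bool (i = j) * \<epsilon>\<^sup>2 + \<tau> \<omega>"
      using b3 t0 by auto
    have "norm (X \<omega>) \<le> 3 * ?w * (min 1 (norm (w \<omega>)) + (norm (G \<omega> i j))\<^sup>2 + (norm (G \<omega> j i))\<^sup>2) +
        of_bool (i = j) * ?w"
      using resolvent_entry_expansion[OF herm[OF o] z ij m]
      unfolding X_def Q_def P0_def Q0_def G_def H_def w_def mult.assoc[of "W \<omega> i j"] .
    also have "\<dots> = 3 * (?w * min 1 (norm (w \<omega>))) + 3 * (?w * \<gamma> \<omega>) + of_bool (i = j) * ?w"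
      by (simp add: \<gamma>_def algebra_simps)
    \<comment> \<open>Tail weights: 3 from \<open>b1\<close>, 3/2 from \<open>b2\<close> and 1 from
      \<open>b4\<close>, rounded up to 6.\<close>
    also have "\<dots> \<le> 3 * \<epsilon> * ?w + 6 * \<tau> \<omega> + 3 * \<epsilon>\<^sup>2 * \<gamma> \<omega> + of_bool (i = j) * \<epsilon>\<^sup>2"
      using b1 b2 b4 t0 by linarith
    finally show "norm (X \<omega>) \<le> 3 * \<epsilon> * ?w + 6 * \<tau> \<omega> + 3 * \<epsilon>\<^sup>2 * \<gamma> \<omega> + of_bool (i = j) * \<epsilon>\<^sup>2" .
  qed
  also have "\<dots> = 3 * \<epsilon> * variance_entry i j + 6 * tail_entry \<epsilon> i j + 3 * \<epsilon>\<^sup>2 * expectation \<gamma> +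
      of_bool (i = j) * \<epsilon>\<^sup>2"
  proof -
    have "expectation \<tau> = tail_entry \<epsilon> i j" "expectation (\<lambda>\<omega>. (norm (w \<omega>))\<^sup>2) = variance_entry i j"
      unfolding tail_entry_def \<tau>_def variance_entry_def w_def by (rule refl)+
    then show ?thesis using w2i \<tau>i \<gamma>i by (simp add: prob_space)
  qed
  finally have N1: "norm (expectation X) \<le>
    3 * \<epsilon> * variance_entry i j + 6 * tail_entry \<epsilon> i j + 3 * \<epsilon>\<^sup>2 * expectation \<gamma> + of_bool (i = j)
        * \<epsilon>\<^sup>2" .
  have "3 * \<epsilon> * v + 6 * t + 3 * \<epsilon>\<^sup>2 * c + d + 2 * (\<epsilon> * v + 2 * t) = 5 * \<epsilon> * v + 10 * t + 3 * \<epsilon>\<^sup>2 *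
      c + d"
    for v t c d :: real by (simp add: algebra_simps)
  from order.trans[OF N add_mono[OF N1 N2], unfolded this]
  have "norm (expectation (\<lambda>\<omega>. w \<omega> * Q \<omega>) + variance_entry i j * expectation P) \<le>
    5 * \<epsilon> * variance_entry i j + 10 * tail_entry \<epsilon> i j + 3 * \<epsilon>\<^sup>2 * expectation \<gamma> + of_bool (i = j)
        * \<epsilon>\<^sup>2" .
  then show ?thesis unfolding P_def Q_def G_def w_def \<gamma>_def .
qed

text \<open>By Ward along row and column, the squares of resolvent entries sum to at most 2/4,
  whatever \<open>n\<close> is; together with the single diagonal term the \<epsilon>^2 weights 3/2
  + 1 stay below 3.\<close>

lemma row_error:
  assumes i: "i < n" and e: "0 < \<epsilon>"
  shows "norm (\<Sum>j<n. expectation (\<lambda>\<omega>. W \<omega> i j * (cnj (resolvent n z (W \<omega>) i i - m) * resolvent n z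
      (W \<omega>) j i)) +
      variance_entry i j * expectation (\<lambda>\<omega>. cnj (resolvent n z (W \<omega>) i i - m) * resolvent n z (W
          \<omega>) j j * resolvent n z (W \<omega>) i i))
    \<le> 5 * \<epsilon> * (\<Sum>j<n. variance_entry i j) + 10 * (\<Sum>j<n. tail_entry \<epsilon> i j) + 3 * \<epsilon>\<^sup>2"
proof -
  let ?\<gamma> = "\<lambda>j \<omega>. (norm (resolvent n z (W \<omega>) i j))\<^sup>2 + (norm (resolvent n z (W \<omega>) j i))\<^sup>2"
  have \<gamma>i: "integrable M (?\<gamma> j)" if j: "j < n" for j
  proof (rule integrable_bounded)
    note [measurable] = resolvent_measurable[OF i j, of z] resolvent_measurable[OF j i, of z]
    show "?\<gamma> j \<in> borel_measurable M" by measurable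
    show "norm (?\<gamma> j \<omega>) \<le> (1/2)\<^sup>2 + (1/2)\<^sup>2" if "\<omega> \<in> space M" for \<omega>
    proof -
      have "?\<gamma> j \<omega> \<le> (1/2)\<^sup>2 + (1/2)\<^sup>2"
        using norm_resolvent_le_half(1)[OF that] i j by (intro add_mono power_mono) auto
      then show ?thesis by simp
    qed
  qed
  have "(\<Sum>j<n. expectation (?\<gamma> j)) = expectation (\<lambda>\<omega>. \<Sum>j<n. ?\<gamma> j \<omega>)"
    using \<gamma>i by (intro Bochner_Integration.integral_sum[symmetric]) auto
  also have "\<dots> \<le> expectation (\<lambda>\<omega>. 1 / 2)"
  proof (rule integral_mono)
    show "integrable M (\<lambda>\<omega>. \<Sum>j<n. ?\<gamma> j \<omega>)" using \<gamma>i by (intro Bochner_Integration.integrable_sum)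
        auto
    fix \<omega> assume o: "\<omega> \<in> space M"
    have z0: "Im z > 0" using z by simp
    have "2\<^sup>2 \<le> (Im z)\<^sup>2" using z by (intro power_mono) auto
    then have "1 / (Im z)\<^sup>2 \<le> 1 / 4" using z by (simp add: field_simps)
    then show "(\<Sum>j<n. ?\<gamma> j \<omega>) \<le> 1 / 2"
      unfolding sum.distrib using resolvent_row_le[OF herm[OF o] z0 i] resolvent_col_le[OF herm[OF
          o] z0 i] by linarith
  qed simp
  finally have g: "(\<Sum>j<n. expectation (?\<gamma> j)) \<le> 1 / 2" by (simp add: prob_space)
  have "norm (\<Sum>j<n. expectation (\<lambda>\<omega>. W \<omega> i j * (cnj (resolvent n z (W \<omega>) i i - m) * resolvent n z
      (W \<omega>) j i)) +
      variance_entry i j * expectation (\<lambda>\<omega>. cnj (resolvent n z (W \<omega>) i i - m) * resolvent n z (W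
          \<omega>) j j * resolvent n z (W \<omega>) i i))
    \<le> (\<Sum>j<n. 5 * \<epsilon> * variance_entry i j + 10 * tail_entry \<epsilon> i j + 3 * \<epsilon>\<^sup>2 * expectation (?\<gamma> j) +
        of_bool (i = j) * \<epsilon>\<^sup>2)"
    by (rule sum_norm_le) (use entry_error[OF i _ e] in simp)
  also have "\<dots> = 5 * \<epsilon> * (\<Sum>j<n. variance_entry i j) + 10 * (\<Sum>j<n. tail_entry \<epsilon> i j) + 3 * \<epsilon>\<^sup>2 *
      (\<Sum>j<n. expectation (?\<gamma> j)) + \<epsilon>\<^sup>2"
    unfolding sum.distrib sum_distrib_left[symmetric] sum_of_bool_mult(1)[OF i] ..
  also have "\<dots> \<le> 5 * \<epsilon> * (\<Sum>j<n. variance_entry i j) + 10 * (\<Sum>j<n. tail_entry \<epsilon> i j) + 3 * \<epsilon>\<^sup>2"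
  proof -
    have "3 * \<epsilon>\<^sup>2 * (\<Sum>j<n. expectation (?\<gamma> j)) \<le> 3 * \<epsilon>\<^sup>2 * (1 / 2)"
      using g by (intro mult_left_mono) auto
    then show ?thesis using zero_le_power2[of \<epsilon>] by linarith
  qed
  finally show ?thesis .
qed

end

end

section \<open>The self-consistent inequality for the diagonal\<close>

context random_hermitian
begin

context
  fixes z m :: complex
  assumes z: "Im z \<ge> 2" and m: "norm m \<le> 1 / 2" and mz: "m\<^sup>2 + z * m + 1 = 0"
begin

private definition "d \<omega> i = resolvent n z (W \<omega>) i i - m"
private definition "e i = expectation (\<lambda>\<omega>. (norm (d \<omega> i))\<^sup>2)"
private definition "r i = (\<Sum>j<n. variance_entry i j)"

private lemma d_meas: "i < n \<Longrightarrow> (\<lambda>\<omega>. d \<omega> i) \<in> borel_measurable M"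
  unfolding d_def using resolvent_measurable[of i i z] by measurable

private lemma d_le: "\<omega> \<in> space M \<Longrightarrow> i < n \<Longrightarrow> norm (d \<omega> i) \<le> 1"
  unfolding d_def by (rule norm_resolvent_diff_le(1)[OF z m])

private lemma d2_int: "i < n \<Longrightarrow> integrable M (\<lambda>\<omega>. (norm (d \<omega> i))\<^sup>2)"
  by (rule integrable_bounded[of _ 1]) (use d_meas[of i] d_le in \<open>auto intro!: power_le_one\<close>)

private lemma e_bounds: "i < n \<Longrightarrow> 0 \<le> e i" "i < n \<Longrightarrow> e i \<le> 1"
proof -
  assume i: "i < n"
  show "0 \<le> e i" unfolding e_def by (rule Bochner_Integration.integral_nonneg) auto
  have "e i \<le> expectation (\<lambda>_. 1)"
    unfolding e_def by (rule integral_mono[OF d2_int[OF i]]) (use d_le i in \<open>auto intro!: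
        power_le_one\<close>)
  then show "e i \<le> 1" by (simp add: prob_space)
qed

text \<open>\<open>S\<close> collects what the averaged quadratic term leaves after subtraction of
  the equation of \<open>m\<close>. It is bounded by \<open>U\<close>, a quadratic form in the
  errors with weights 3/4 and 1/4 plus the defect of the row variance; the left side has |z| \<ge> 2
  to set against it.\<close>

private lemma diagonal_bound:
  assumes i: "i < n" and \<epsilon>: "0 < \<epsilon>"
  shows "2 * e i \<le> 5 * \<epsilon> * r i + 10 * (\<Sum>j<n. tail_entry \<epsilon> i j) + 3 * \<epsilon>\<^sup>2
     + 3 / 4 * (r i * e i) + 1 / 4 * (\<Sum>j<n. variance_entry i j * e j) + \<bar>r i - 1\<bar> / 4"
proof -
  let ?G = "\<lambda>\<omega>. resolvent n z (W \<omega>)"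
  let ?v = "\<lambda>j. complex_of_real (variance_entry i j)"
  define A where "A = (\<lambda>j \<omega>. W \<omega> i j * (cnj (d \<omega> i) * ?G \<omega> j i))"
  define B where "B = (\<lambda>j \<omega>. cnj (d \<omega> i) * ?G \<omega> j j * ?G \<omega> i i)"
  define S where "S = (\<lambda>\<omega>. (\<Sum>j<n. ?v j * (of_real ((norm (d \<omega> i))\<^sup>2) * ?G \<omega> j j + m * cnj (d \<omega> i)
      * d \<omega> j))
      + m\<^sup>2 * of_real (r i - 1) * cnj (d \<omega> i))"
  define U where "U = (\<lambda>\<omega>. (\<Sum>j<n. variance_entry i j * (3 / 4 * (norm (d \<omega> i))\<^sup>2 + 1 / 4 * (norm
      (d \<omega> j))\<^sup>2)) + \<bar>r i - 1\<bar> / 4)"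
  have dm [measurable]: "(\<lambda>\<omega>. d \<omega> j) \<in> borel_measurable M" if "j < n" for j using that by (rule
      d_meas)
  have Gm [measurable]: "(\<lambda>\<omega>. ?G \<omega> a b) \<in> borel_measurable M" if "a < n" "b < n" for a b
    using that by (rule resolvent_measurable)
  note Gb = norm_resolvent_le_half(1)[OF z m]
  have Ai: "integrable M (A j)" if j: "j < n" for j
    unfolding A_def
  proof (rule integrable_mult_bounded[OF entry_integrable[OF i j]])
    show "(\<lambda>\<omega>. cnj (d \<omega> i) * ?G \<omega> j i) \<in> borel_measurable M" using i j by measurable
    show "norm (cnj (d \<omega> i) * ?G \<omega> j i) \<le> 1 * (1 / 2)" if "\<omega> \<in> space M" for \<omega>
      using d_le[OF that i] Gb[OF that j i] by (intro norm_mult_le) (simp_all only: complex_mod_cnj)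
  qed
  have Bi: "integrable M (B j)" if j: "j < n" for j
  proof (rule integrable_bounded)
    show "B j \<in> borel_measurable M" unfolding B_def using i j by measurable
    show "norm (B j \<omega>) \<le> 1 * (1 / 2) * (1 / 2)" if "\<omega> \<in> space M" for \<omega>
      unfolding B_def using d_le[OF that i] Gb[OF that j j] Gb[OF that i i] by (intro
          norm_mult_le) (simp_all only: complex_mod_cnj)
  qed
  have Ui: "integrable M U"
    unfolding U_def using d2_int i
    by (intro Bochner_Integration.integrable_add Bochner_Integration.integrable_sum
        integrable_mult_right integrable_const) auto
  have SU: "norm (S \<omega>) \<le> U \<omega>" if o: "\<omega> \<in> space M" for \<omega>
    unfolding S_def U_def
  proof (intro order.trans[OF norm_triangle_ineq] add_mono sum_norm_le)
    fix j assume "j \<in> {..<n}" then have j: "j < n" by simp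
    have "norm (of_real ((norm (d \<omega> i))\<^sup>2) * ?G \<omega> j j + m * cnj (d \<omega> i) * d \<omega> j)
        \<le> (norm (d \<omega> i))\<^sup>2 * (1 / 2) + 1 / 2 * norm (d \<omega> i) * norm (d \<omega> j)"
      by (intro order.trans[OF norm_triangle_ineq add_mono] norm_mult_le Gb[OF o j j] m) (simp_all
          add: norm_power)
    \<comment> \<open>1/2 comes from |G j j|, and AM-GM gives |m| |d i| |d j| \<le> (|d i|^2 + |d
      j|^2) / 4.\<close>
    also have "\<dots> \<le> 3 / 4 * (norm (d \<omega> i))\<^sup>2 + 1 / 4 * (norm (d \<omega> j))\<^sup>2"
      using sum_squares_bound[of "norm (d \<omega> i)" "norm (d \<omega> j)"] by (simp add: algebra_simps)
    finally show "norm (?v j * (of_real ((norm (d \<omega> i))\<^sup>2) * ?G \<omega> j j + m * cnj (d \<omega> i) * d \<omega> j))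
      \<le> variance_entry i j * (3 / 4 * (norm (d \<omega> i))\<^sup>2 + 1 / 4 * (norm (d \<omega> j))\<^sup>2)"
      using variance_entry_nonneg[of i j] by (intro norm_mult_le) simp_all
  next
    have "norm (m\<^sup>2) \<le> (1 / 2)\<^sup>2" unfolding norm_power using m by (intro power_mono) auto
    then have "norm (m\<^sup>2 * of_real (r i - 1) * cnj (d \<omega> i)) \<le> (1 / 2)\<^sup>2 * \<bar>r i - 1\<bar> * 1"
      using d_le[OF o i] by (intro norm_mult_le) (simp_all only: complex_mod_cnj norm_of_real
          real_norm_def order_refl)
    then show "norm (m\<^sup>2 * of_real (r i - 1) * cnj (d \<omega> i)) \<le> \<bar>r i - 1\<bar> / 4"
      by (simp add: power2_eq_square)
  qed
  have Si: "integrable M S"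
  proof (rule Bochner_Integration.integrable_bound[OF Ui])
    show "S \<in> borel_measurable M" unfolding S_def using i
      by (intro borel_measurable_add borel_measurable_sum borel_measurable_times
          borel_measurable_cnj
          borel_measurable_const borel_measurable_of_real borel_measurable_power
              borel_measurable_norm dm Gm) auto
    show "AE \<omega> in M. norm (S \<omega>) \<le> norm (U \<omega>)"
      by (rule AE_I2, rule order.trans[OF SU]) auto
  qed
  have id: "z * of_real ((norm (d \<omega> i))\<^sup>2) = (\<Sum>j<n. A j \<omega> + ?v j * B j \<omega>) - S \<omega>" if o: "\<omega> \<in> space
      M" for \<omega>
  proof -
    have zn: "Im z \<noteq> 0" using z by simp
    define D where "D = cnj (d \<omega> i)"
    have nd: "of_real ((norm (d \<omega> i))\<^sup>2) = d \<omega> i * D" unfolding D_def by (rule complex_norm_square)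
    have G: "?G \<omega> j j = d \<omega> j + m" for j by (simp add: d_def)
    have rs: "complex_of_real (r i) = (\<Sum>j<n. ?v j)" by (simp add: r_def)
    have "(\<Sum>j<n. A j \<omega>) = D * (\<Sum>j<n. W \<omega> i j * ?G \<omega> j i)"
      unfolding A_def D_def sum_distrib_left by (intro sum.cong refl) (simp add: mult_ac)
    also have "\<dots> = D * (z * (d \<omega> i + m) + 1)"
      using resolvent_right[OF herm[OF o] zn i i] by (simp add: G)
    also have "\<dots> = z * (d \<omega> i * D) + D * (z * m + 1)" by (simp add: algebra_simps)
    also have "z * m + 1 = - m\<^sup>2" using mz by (simp add: eq_neg_iff_add_eq_0 add.assoc add.commute)
    finally have A: "(\<Sum>j<n. A j \<omega>) = z * (d \<omega> i * D) - D * m\<^sup>2" by simp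
    \<comment> \<open>The split is G i i * G j j = d i * G j j + m * d j + m^2; the last part meets
      the -m^2 of \<open>A\<close>, up to the row defect.\<close>
    have "(\<Sum>j<n. ?v j * B j \<omega>) = (\<Sum>j<n. ?v j * (d \<omega> i * D * ?G \<omega> j j + m * D * d \<omega> j) + m\<^sup>2 * D *
        ?v j)"
      unfolding B_def D_def[symmetric] G by (intro sum.cong refl) (simp add: algebra_simps
          power2_eq_square)
    also have "\<dots> = (\<Sum>j<n. ?v j * (d \<omega> i * D * ?G \<omega> j j + m * D * d \<omega> j)) + m\<^sup>2 * D * of_real (r i)"
      unfolding sum.distrib rs sum_distrib_left ..
    finally have B: "(\<Sum>j<n. ?v j * B j \<omega>) = \<dots>" .
    show ?thesis
      unfolding sum.distrib A B S_def nd D_def[symmetric] by (simp add: algebra_simps)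
  qed
  have "z * of_real (e i) = expectation (\<lambda>\<omega>. z * of_real ((norm (d \<omega> i))\<^sup>2))"
    by (simp only: e_def integral_mult_right_zero integral_complex_of_real)
  also have "\<dots> = expectation (\<lambda>\<omega>. (\<Sum>j<n. A j \<omega> + ?v j * B j \<omega>) - S \<omega>)"
    by (intro Bochner_Integration.integral_cong refl id)
  also have "\<dots> = expectation (\<lambda>\<omega>. \<Sum>j<n. A j \<omega> + ?v j * B j \<omega>) - expectation S"
    using Ai Bi Si by (intro Bochner_Integration.integral_diff Bochner_Integration.integrable_sum
        Bochner_Integration.integrable_add integrable_mult_right) auto
  also have "expectation (\<lambda>\<omega>. \<Sum>j<n. A j \<omega> + ?v j * B j \<omega>) = (\<Sum>j<n. expectation (A j) + ?v j *
      expectation (B j))"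
    using Ai Bi by (subst Bochner_Integration.integral_sum) (auto intro!: sum.cong)
  finally have "z * of_real (e i) = (\<Sum>j<n. expectation (A j) + ?v j * expectation (B j)) -
      expectation S" .
  then have "norm (z * of_real (e i)) \<le> norm (\<Sum>j<n. expectation (A j) + ?v j * expectation (B j))
      + norm (expectation S)"
    by (simp only: norm_triangle_ineq4)
  moreover have "2 * e i \<le> norm (z * of_real (e i))"
  proof -
    have "2 \<le> norm z" using z abs_Im_le_cmod[of z] by linarith
    then show ?thesis using e_bounds(1)[OF i] by (simp add: norm_mult mult_right_mono)
  qed
  moreover have "norm (\<Sum>j<n. expectation (A j) + ?v j * expectation (B j)) \<le>
      5 * \<epsilon> * r i + 10 * (\<Sum>j<n. tail_entry \<epsilon> i j) + 3 * \<epsilon>\<^sup>2"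
    using row_error[OF z m i \<epsilon>] unfolding A_def B_def d_def r_def .
  moreover have "norm (expectation S) \<le> expectation U"
    by (rule norm_integral_le_integral[OF Si Ui SU])
  moreover have "expectation U = 3 / 4 * (r i * e i) + 1 / 4 * (\<Sum>j<n. variance_entry i j * e j) +
      \<bar>r i - 1\<bar> / 4"
  proof -
    have "expectation U = expectation (\<lambda>\<omega>. \<Sum>j<n. variance_entry i j * (3 / 4 * (norm (d \<omega> i))\<^sup>2 +
        1 / 4 * (norm (d \<omega> j))\<^sup>2)) + \<bar>r i - 1\<bar> / 4"
      unfolding U_def using d2_int i
      by (subst Bochner_Integration.integral_add)
         (auto intro!: Bochner_Integration.integrable_sum integrable_mult_right simp: prob_space)
    also have "expectation (\<lambda>\<omega>. \<Sum>j<n. variance_entry i j * (3 / 4 * (norm (d \<omega> i))\<^sup>2 + 1 / 4 *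
        (norm (d \<omega> j))\<^sup>2)) =
        (\<Sum>j<n. variance_entry i j * (3 / 4 * e i + 1 / 4 * e j))"
      unfolding e_def using d2_int i by (subst Bochner_Integration.integral_sum) (auto intro!:
          sum.cong)
    also have "\<dots> = (\<Sum>j<n. 3 / 4 * (variance_entry i j * e i) + 1 / 4 * (variance_entry i j * e j))"
      by (intro sum.cong refl) (simp add: algebra_simps)
    also have "\<dots> = 3 / 4 * (r i * e i) + 1 / 4 * (\<Sum>j<n. variance_entry i j * e j)"
      unfolding sum.distrib r_def sum_distrib_left sum_distrib_right ..
    finally show ?thesis .
  qed
  ultimately show ?thesis by linarith
qed

text \<open>Symmetry of the variances turns the coupling into the sum of \<open>r j * e j\<close>,
  so that 1/4 joins 3/4. As \<open>e i \<le> 1\<close>, replacing \<open>r i\<close> by 1 costs |r i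
  - 1|, and one of the two copies of the sum of \<open>e i\<close> is absorbed. Here 8 = 5 + 3, and
  7 rounds up 5 + 1 + 1/4.\<close>

private lemma sum_e_le:
  assumes \<epsilon>: "0 < \<epsilon>" "\<epsilon> \<le> 1"
  shows "(\<Sum>i<n. e i) \<le> 8 * \<epsilon> * real n + 7 * (\<Sum>i<n. \<bar>r i - 1\<bar>) + 10 * (\<Sum>i<n. \<Sum>j<n. tail_entry \<epsilon> i j)"
proof -
  let ?R = "\<Sum>i<n. \<bar>r i - 1\<bar>" and ?T = "\<Sum>i<n. \<Sum>j<n. tail_entry \<epsilon> i j"
  have "2 * (\<Sum>i<n. e i) = (\<Sum>i<n. 2 * e i)" by (rule sum_distrib_left)
  also have "\<dots> \<le> (\<Sum>i<n. 5 * \<epsilon> * r i + 10 * (\<Sum>j<n. tail_entry \<epsilon> i j) + 3 * \<epsilon>\<^sup>2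
     + 3 / 4 * (r i * e i) + 1 / 4 * (\<Sum>j<n. variance_entry i j * e j) + 1 / 4 * \<bar>r i - 1\<bar>)"
  proof (rule sum_mono)
    fix i assume "i \<in> {..<n}"
    then show "2 * e i \<le> 5 * \<epsilon> * r i + 10 * (\<Sum>j<n. tail_entry \<epsilon> i j) + 3 * \<epsilon>\<^sup>2
     + 3 / 4 * (r i * e i) + 1 / 4 * (\<Sum>j<n. variance_entry i j * e j) + 1 / 4 * \<bar>r i - 1\<bar>"
      using diagonal_bound[OF _ \<epsilon>(1), of i] by simp
  qed
  also have "\<dots> = 5 * \<epsilon> * (\<Sum>i<n. r i) + 10 * ?T + real n * (3 * \<epsilon>\<^sup>2) + 3 / 4 * (\<Sum>i<n. r i * e i)
     + 1 / 4 * (\<Sum>i<n. \<Sum>j<n. variance_entry i j * e j) + 1 / 4 * ?R"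
    unfolding sum.distrib sum_distrib_left[symmetric] by simp
  also have "(\<Sum>i<n. \<Sum>j<n. variance_entry i j * e j) = (\<Sum>j<n. \<Sum>i<n. variance_entry i j * e j)"
    by (rule sum.swap)
  also have "\<dots> = (\<Sum>j<n. r j * e j)"
    unfolding r_def sum_distrib_right by (intro sum.cong refl) (simp add: variance_entry_commute)
  finally have 1: "2 * (\<Sum>i<n. e i) \<le> 5 * \<epsilon> * (\<Sum>i<n. r i) + 10 * ?T + real n * (3 * \<epsilon>\<^sup>2) + (\<Sum>i<n. r
      i * e i) + 1 / 4 * ?R"
    by simp
  have "(\<Sum>i<n. r i * e i) \<le> (\<Sum>i<n. e i + \<bar>r i - 1\<bar>)"
  proof (rule sum_mono)
    fix i assume "i \<in> {..<n}" then have i: "i < n" by simp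
    have "(r i - 1) * e i \<le> \<bar>r i - 1\<bar> * 1" using e_bounds[OF i] by (intro mult_mono) auto
    then show "r i * e i \<le> e i + \<bar>r i - 1\<bar>" by (simp add: algebra_simps)
  qed
  then have 2: "(\<Sum>i<n. r i * e i) \<le> (\<Sum>i<n. e i) + ?R" by (simp add: sum.distrib)
  have "(\<Sum>i<n. r i) \<le> (\<Sum>i<n. 1 + \<bar>r i - 1\<bar>)" by (rule sum_mono) auto
  then have "(\<Sum>i<n. r i) \<le> real n + ?R" by (simp add: sum.distrib)
  then have "5 * \<epsilon> * (\<Sum>i<n. r i) \<le> 5 * \<epsilon> * (real n + ?R)" using \<epsilon> by (intro mult_left_mono) auto
  also have "\<dots> = 5 * \<epsilon> * real n + 5 * (\<epsilon> * ?R)" by (simp add: algebra_simps)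
  also have "\<epsilon> * ?R \<le> 1 * ?R" using \<epsilon> by (intro mult_right_mono sum_nonneg) auto
  finally have 3: "5 * \<epsilon> * (\<Sum>i<n. r i) \<le> 5 * \<epsilon> * real n + 5 * ?R" by simp
  have "\<epsilon>\<^sup>2 \<le> \<epsilon>" using \<epsilon> by (simp add: power2_eq_square mult_left_le)
  then have 4: "real n * (3 * \<epsilon>\<^sup>2) \<le> 3 * \<epsilon> * real n"
    using mult_left_mono[of "\<epsilon>\<^sup>2" \<epsilon> "real n * 3"] by (simp add: algebra_simps)
  have "0 \<le> ?R" by (intro sum_nonneg) auto
  with 1 2 3 4 show ?thesis by linarith
qed

text \<open>Passing to first moments by |d| \<le> \<delta> + |d|^2 / \<delta> keeps the estimate
  linear in sums over \<open>i\<close>; \<delta> is fixed only in the final limit.\<close>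

theorem expected_trace_bound:
  assumes \<epsilon>: "0 < \<epsilon>" "\<epsilon> \<le> 1" and \<delta>: "0 < \<delta>" and n: "0 < n"
  shows "norm (expectation (\<lambda>\<omega>. (\<Sum>i<n. resolvent n z (W \<omega>) i i) / of_nat n) - m) \<le> \<delta> +
    (8 * \<epsilon> + 7 * ((\<Sum>i<n. \<bar>(\<Sum>j<n. variance_entry i j) - 1\<bar>) / n) + 10 * ((\<Sum>i<n. \<Sum>j<n. tail_entry \<epsilon>
        i j) / n)) / \<delta>"
proof -
  have di: "integrable M (\<lambda>\<omega>. d \<omega> i)" if "i < n" for i
    using d_meas[OF that] d_le that by (intro integrable_bounded[of _ 1]) auto
  have Gi: "integrable M (\<lambda>\<omega>. resolvent n z (W \<omega>) i i)" if "i < n" for i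
    using resolvent_measurable[OF that that] norm_resolvent_le_half(1)[OF z m] that
    by (intro integrable_bounded[of _ "1/2"]) auto
  have "expectation (\<lambda>\<omega>. (\<Sum>i<n. resolvent n z (W \<omega>) i i) / of_nat n) - m =
     (\<Sum>i<n. expectation (\<lambda>\<omega>. resolvent n z (W \<omega>) i i) - m) / of_nat n"
    using n Gi by (simp add: sum_subtractf field_simps)
  also have "\<dots> = (\<Sum>i<n. expectation (\<lambda>\<omega>. d \<omega> i)) / of_nat n"
    unfolding d_def using Gi prob_space by (intro arg_cong2[of _ _ _ _ "(/)"] sum.cong refl) simp
  finally have eq: "expectation (\<lambda>\<omega>. (\<Sum>i<n. resolvent n z (W \<omega>) i i) / of_nat n) - m = (\<Sum>i<n.
      expectation (\<lambda>\<omega>. d \<omega> i)) / of_nat n" .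
  have "norm (\<Sum>i<n. expectation (\<lambda>\<omega>. d \<omega> i)) \<le> (\<Sum>i<n. \<delta> + e i / \<delta>)"
  proof (rule sum_norm_le)
    fix i assume "i \<in> {..<n}" then have i: "i < n" by simp
    have "norm (expectation (\<lambda>\<omega>. d \<omega> i)) \<le> expectation (\<lambda>\<omega>. \<delta> + (norm (d \<omega> i))\<^sup>2 / \<delta>)"
    proof (rule norm_integral_le_integral[OF di[OF i]])
      show "integrable M (\<lambda>\<omega>. \<delta> + (norm (d \<omega> i))\<^sup>2 / \<delta>)" using d2_int[OF i] by simp
      fix \<omega>
      show "norm (d \<omega> i) \<le> \<delta> + (norm (d \<omega> i))\<^sup>2 / \<delta>"
      proof (cases "norm (d \<omega> i) \<le> \<delta>")
        case True then show ?thesis using \<delta> by (simp add: add_increasing2)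
      next
        case False
        then have "\<delta> * norm (d \<omega> i) \<le> (norm (d \<omega> i))\<^sup>2" by (simp add: power2_eq_square
            mult_right_mono)
        then have "norm (d \<omega> i) \<le> (norm (d \<omega> i))\<^sup>2 / \<delta>" using \<delta> by (simp add: field_simps)
        then show ?thesis using \<delta> by simp
      qed
    qed
    also have "\<dots> = \<delta> + e i / \<delta>" unfolding e_def using d2_int[OF i] by (simp add: prob_space)
    finally show "norm (expectation (\<lambda>\<omega>. d \<omega> i)) \<le> \<delta> + e i / \<delta>" .
  qed
  also have "\<dots> = real n * \<delta> + (\<Sum>i<n. e i) / \<delta>" by (simp add: sum.distrib sum_divide_distrib)
  also have "\<dots> \<le> real n * \<delta> + (8 * \<epsilon> * real n + 7 * (\<Sum>i<n. \<bar>r i - 1\<bar>) + 10 * (\<Sum>i<n. \<Sum>j<n.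
      tail_entry \<epsilon> i j)) / \<delta>"
    using sum_e_le[OF \<epsilon>] \<delta> by (intro add_left_mono divide_right_mono) auto
  finally have "norm (\<Sum>i<n. expectation (\<lambda>\<omega>. d \<omega> i)) / n \<le>
    (real n * \<delta> + (8 * \<epsilon> * real n + 7 * (\<Sum>i<n. \<bar>r i - 1\<bar>) + 10 * (\<Sum>i<n. \<Sum>j<n. tail_entry \<epsilon> i j)) /
        \<delta>) / n"
    by (rule divide_right_mono) simp
  also have "\<dots> = \<delta> + (8 * \<epsilon> + 7 * ((\<Sum>i<n. \<bar>r i - 1\<bar>) / n) + 10 * ((\<Sum>i<n. \<Sum>j<n. tail_entry \<epsilon> i j) /
      n)) / \<delta>"
    using n \<delta> by (simp add: field_simps)
  finally show ?thesis unfolding eq r_def by (simp add: norm_divide)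
qed

end

end

section \<open>Concentration of the normalised trace\<close>

context random_hermitian
begin

text \<open>Column \<open>k\<close> of the upper triangle: changing these coordinates touches only
  row and column \<open>k\<close> of the Hermitian matrix, as in
  \<open>resolvent_trace_row_diff\<close>.\<close>

definition block :: "nat \<Rightarrow> (nat \<times> nat) set" where
  "block k = {(i, j). i \<le> j \<and> j = k}"

lemma upper_eq_blocks: "upper n = \<Union>(block ` {..<n})"
  by (auto simp: upper_def block_def)

context
  fixes z :: complex and \<phi> :: "complex \<Rightarrow> real"
  assumes z: "Im z \<ge> 2" and n: "0 < n"
    and phi: "\<And>a b. \<bar>\<phi> a - \<phi> b\<bar> \<le> norm (a - b)" "\<And>a. \<bar>\<phi> a\<bar> \<le> norm a"
    and phi_meas: "\<phi> \<in> borel_measurable borel"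
begin

private definition "T f = (\<Sum>i<n. resolvent n z f i i) / of_nat n"

private lemma T_bound: "hermitian n f \<Longrightarrow> norm (T f) \<le> 1 / 2"
proof -
  assume h: "hermitian n f"
  have "norm (\<Sum>i<n. resolvent n z f i i) \<le> (\<Sum>i<n. 1 / 2)"
  proof (rule sum_norm_le)
    fix i assume "i \<in> {..<n}"
    then have "norm (resolvent n z f i i) \<le> 1 / Im z" using resolvent_norm_le[OF h] z by simp
    also have "\<dots> \<le> 1 / 2" using z by (simp add: field_simps)
    finally show "norm (resolvent n z f i i) \<le> 1 / 2" .
  qed
  then show ?thesis unfolding T_def using n by (simp add: norm_divide field_simps)
qed

private lemma T_meas: "(\<And>a b. a < n \<Longrightarrow> b < n \<Longrightarrow> (\<lambda>x. F x a b) \<in> borel_measurable N) \<Longrightarrow> (\<lambda>x. T (F x))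
    \<in> borel_measurable N"
  unfolding T_def by (intro borel_measurable_divide borel_measurable_sum measurable_resolvent) auto

private lemma T_cong: "(\<And>a b. a < n \<Longrightarrow> b < n \<Longrightarrow> f a b = g a b) \<Longrightarrow> T f = T g"
  unfolding T_def by (subst resolvent_cong[of n f g z]) auto

text \<open>Moved to the product space of the upper entries, where one column can change while the
  others stay fixed. Each change moves the normalised trace by at most 2 / (n Im z) \<le> 1 / n, and
  there are \<open>n\<close> blocks. \<open>\<phi>\<close> stands for the real or imaginary part or
  their negatives.\<close>

lemma trace_mgf:
  assumes l: "l > 0"
  shows "expectation (\<lambda>\<omega>. exp (l * (\<phi> (T (W \<omega>)) - expectation (\<lambda>\<omega>. \<phi> (T (W \<omega>)))))) \<le> exp (l\<^sup>2 / (8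
      * real n))"
proof -
  let ?X = "\<lambda>p \<omega>. (\<lambda>(i, j) \<omega>. W \<omega> i j) p \<omega>"
  let ?I = "upper n"
  \<comment> \<open>Off the triangle a point mass serves as default value:
    \<open>bounded_differences_mgf\<close> asks for a probability measure at every index.\<close>
  define N where "N p = (if p \<in> ?I then distr M borel (?X p) else return borel 0)" for p
  define f where "f x = \<phi> (T (herm_of ?I x))" for x
  let ?R = "\<lambda>\<omega>. restrict (\<lambda>p. ?X p \<omega>) ?I"
  have rv: "random_variable borel (?X p)" if "p \<in> ?I" for p
    using that entry_measurable by (auto simp: upper_def)
  have Np: "prob_space (N p)" for p
    by (cases "p \<in> ?I") (simp_all add: N_def prob_space_distr[OF rv] prob_space_return del:
        split_paired_All)
  have I0: "?I \<noteq> {}" using n by (auto simp: upper_def)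
  have "distr M (Pi\<^sub>M ?I (\<lambda>_. borel)) ?R = Pi\<^sub>M ?I (\<lambda>p. distr M borel (?X p))"
    by (rule iffD1[OF indep_vars_iff_distr_eq_PiM'[OF I0] indep]) (rule rv)
  also have "\<dots> = Pi\<^sub>M ?I N" by (rule PiM_cong) (auto simp: N_def)
  finally have D: "distr M (Pi\<^sub>M ?I (\<lambda>_. borel)) ?R = Pi\<^sub>M ?I N" .
  have setsN: "sets (Pi\<^sub>M ?I N) = sets (Pi\<^sub>M ?I (\<lambda>_. borel))" by (rule sets_PiM_cong) (auto simp:
      N_def)
  have fm': "f \<in> borel_measurable (Pi\<^sub>M ?I (\<lambda>_. borel))"
    unfolding f_def by (rule measurable_compose[OF T_meas phi_meas]) (rule measurable_herm_of)
  then have fm: "f \<in> borel_measurable (Pi\<^sub>M ?I N)"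
    using measurable_cong_sets[OF setsN refl] by blast
  have Rm: "?R \<in> measurable M (Pi\<^sub>M ?I (\<lambda>_. borel))"
    by (rule measurable_restrict) (rule rv)
  have fR: "f (?R \<omega>) = \<phi> (T (W \<omega>))" if "\<omega> \<in> space M" for \<omega>
    unfolding f_def
  proof (intro arg_cong[of _ _ \<phi>] T_cong)
    fix a b assume ab: "a < n" "b < n"
    then have "(min a b, max a b) \<in> ?I" by (auto simp: upper_def)
    then show "herm_of ?I (?R \<omega>) a b = W \<omega> a b" using herm_of_entries[OF that ab, of ?I] by simp
  qed
  have tr: "(\<integral>x. g (f x) \<partial>Pi\<^sub>M ?I N) = expectation (\<lambda>\<omega>. g (\<phi> (T (W \<omega>))))" if g: "g \<in>
      borel_measurable borel" for g :: "real \<Rightarrow> real"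
  proof -
    have "(\<integral>x. g (f x) \<partial>Pi\<^sub>M ?I N) = expectation (\<lambda>\<omega>. g (f (?R \<omega>)))"
      unfolding D[symmetric] using Rm fm' g by (intro integral_distr) auto
    also have "\<dots> = expectation (\<lambda>\<omega>. g (\<phi> (T (W \<omega>))))"
      by (intro Bochner_Integration.integral_cong refl) (simp only: fR)
    finally show ?thesis .
  qed
  have "(\<integral>x. exp (l * (f x - (\<integral>x. f x \<partial>Pi\<^sub>M (\<Union>(block ` {..<n})) N))) \<partial>Pi\<^sub>M (\<Union>(block ` {..<n})) N)
      \<le> exp (l\<^sup>2 * (real (card {..<n}) * (1 / real n)\<^sup>2) / 8)"
  proof (rule bounded_differences_mgf[OF Np l, where B = "1 / 2"], unfold
      upper_eq_blocks[symmetric])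
    show "finite (block k)" for k
      by (rule finite_subset[of _ "{..k} \<times> {..k}"]) (auto simp: block_def)
    show "disjoint_family_on block {..<n}" by (auto simp: disjoint_family_on_def block_def)
    show "f \<in> borel_measurable (Pi\<^sub>M ?I N)" by (rule fm)
    show "\<bar>f x\<bar> \<le> 1 / 2" for x
      unfolding f_def by (rule order.trans[OF phi(2) T_bound[OF hermitian_herm_of]])
    fix k and x y :: "nat \<times> nat \<Rightarrow> complex"
    assume k: "k \<in> {..<n}" and xy: "\<And>p. p \<in> ?I - block k \<Longrightarrow> x p = y p"
    have "norm ((\<Sum>i<n. resolvent n z (herm_of ?I x) i i) - (\<Sum>i<n. resolvent n z (herm_of ?I y) i
        i)) \<le> 2 / Im z"
    proof (rule resolvent_trace_row_diff[OF hermitian_herm_of hermitian_herm_of])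
      fix a b assume ab: "a < n" "b < n" "a \<noteq> k" "b \<noteq> k"
      have "x (a, b) = y (a, b)" if "(a, b) \<in> ?I" using that ab by (intro xy) (auto simp: block_def)
      moreover have "x (b, a) = y (b, a)" if "(b, a) \<in> ?I" using that ab by (intro xy) (auto simp:
          block_def)
      ultimately show "herm_of ?I x a b = herm_of ?I y a b" by (auto simp: herm_of_def)
    qed (use z k in auto)
    also have "\<dots> \<le> 1" using z by (simp add: field_simps)
    finally have "norm (T (herm_of ?I x) - T (herm_of ?I y)) \<le> 1 / real n"
      unfolding T_def diff_divide_distrib[symmetric] norm_divide by (simp add: divide_right_mono)
    then show "\<bar>f x - f y\<bar> \<le> 1 / real n" unfolding f_def by (rule order.trans[OF phi(1)])
  qed auto
  then have "(\<integral>x. exp (l * (f x - (\<integral>x. f x \<partial>Pi\<^sub>M ?I N))) \<partial>Pi\<^sub>M ?I N) \<le> exp (l\<^sup>2 * (real n * (1 /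
      real n)\<^sup>2) / 8)"
    unfolding upper_eq_blocks[symmetric] by simp
  also have "l\<^sup>2 * (real n * (1 / real n)\<^sup>2) / 8 = l\<^sup>2 / (8 * real n)"
    using n by (simp add: power2_eq_square)
  finally show ?thesis
    using tr[of "\<lambda>u. u"] tr[of "\<lambda>u. exp (l * (u - expectation (\<lambda>\<omega>. \<phi> (T (W \<omega>)))))"] by simp
qed

lemma trace_concentration_upper:
  assumes t: "t > 0"
  shows "prob {\<omega> \<in> space M. \<phi> ((\<Sum>i<n. resolvent n z (W \<omega>) i i) / of_nat n)
     - expectation (\<lambda>\<omega>. \<phi> ((\<Sum>i<n. resolvent n z (W \<omega>) i i) / of_nat n)) \<ge> t} \<le> exp (- 2 * real n *
         t\<^sup>2)"
proof -
  define X where "X \<omega> = \<phi> (T (W \<omega>)) - expectation (\<lambda>\<omega>. \<phi> (T (W \<omega>)))" for \<omega>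
  \<comment> \<open>The minimiser of l^2 / (8 n) - l t, with minimum -2 n t^2.\<close>
  define l where "l = 4 * real n * t"
  have l: "l > 0" using n t by (simp add: l_def)
  have Xm: "X \<in> borel_measurable M"
    unfolding X_def using measurable_compose[OF T_meas phi_meas] entry_measurable by (intro
        borel_measurable_diff) auto
  have Xb: "X \<omega> \<le> 1 / 2 - expectation (\<lambda>\<omega>. \<phi> (T (W \<omega>)))" if "\<omega> \<in> space M" for \<omega>
    using order.trans[OF phi(2) T_bound[OF herm[OF that]]] by (simp add: X_def abs_le_iff)
  have int: "integrable M (\<lambda>\<omega>. exp (l * X \<omega>))"
  proof (rule integrable_bounded)
    show "(\<lambda>\<omega>. exp (l * X \<omega>)) \<in> borel_measurable M" using Xm by measurable
    show "norm (exp (l * X \<omega>)) \<le> exp (l * (1 / 2 - expectation (\<lambda>\<omega>. \<phi> (T (W \<omega>)))))" if "\<omega> \<in> space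
        M" for \<omega>
      using Xb[OF that] l by simp
  qed
  have "prob {\<omega> \<in> space M. X \<omega> \<ge> t} \<le> exp (- l * t) * (\<integral>\<omega>\<in>space M. exp (l * X \<omega>) \<partial>M)"
    by (rule Chernoff_ineq_ge[OF l]) (auto simp: set_integrable_def simp del: real_scaleR_def
        intro!: integrable_mult_indicator int)
  also have "(\<integral>\<omega>\<in>space M. exp (l * X \<omega>) \<partial>M) = expectation (\<lambda>\<omega>. exp (l * X \<omega>))"
    using int by (simp add: set_integral_space)
  also have "\<dots> \<le> exp (l\<^sup>2 / (8 * real n))" unfolding X_def by (rule trace_mgf[OF l])
  also have "exp (- l * t) * exp (l\<^sup>2 / (8 * real n)) = exp (- 2 * real n * t\<^sup>2)"
    using n by (simp add: l_def power2_eq_square flip: exp_add)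
  finally show ?thesis unfolding X_def T_def by simp
qed

end

lemma trace_concentration:
  assumes z: "Im z \<ge> 2" and n: "0 < n" and t: "t > 0"
    and phi: "\<And>a b. \<bar>\<phi> a - \<phi> b\<bar> \<le> norm (a - b)" "\<And>a. \<bar>\<phi> a\<bar> \<le> norm (a :: complex)"
    and phi_meas: "\<phi> \<in> borel_measurable borel"
  shows "prob {\<omega> \<in> space M. \<bar>\<phi> ((\<Sum>i<n. resolvent n z (W \<omega>) i i) / of_nat n)
     - expectation (\<lambda>\<omega>. \<phi> ((\<Sum>i<n. resolvent n z (W \<omega>) i i) / of_nat n))\<bar> \<ge> t} \<le> 2 * exp (- 2 *
         real n * t\<^sup>2)"
proof -
  let ?T = "\<lambda>\<omega>. (\<Sum>i<n. resolvent n z (W \<omega>) i i) / of_nat n"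
  define E where "E = expectation (\<lambda>\<omega>. \<phi> (?T \<omega>))"
  have Tm: "?T \<in> borel_measurable M"
    by (intro borel_measurable_divide borel_measurable_sum resolvent_measurable) auto
  have [measurable]: "(\<lambda>\<omega>. \<phi> (?T \<omega>)) \<in> borel_measurable M" by (rule measurable_compose[OF Tm
      phi_meas])
  have mi: "\<bar>- \<phi> a - - \<phi> b\<bar> \<le> norm (a - b)" for a b
    using phi(1)[of a b] by (simp add: abs_minus_commute)
  have up: "prob {\<omega> \<in> space M. \<phi> (?T \<omega>) - E \<ge> t} \<le> exp (- 2 * real n * t\<^sup>2)"
    unfolding E_def by (rule trace_concentration_upper[OF z n phi phi_meas t])
  have lo: "prob {\<omega> \<in> space M. - \<phi> (?T \<omega>) - - E \<ge> t} \<le> exp (- 2 * real n * t\<^sup>2)"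
    unfolding E_def using trace_concentration_upper[of z "\<lambda>a. - \<phi> a", OF z n mi _ _ t] phi(2)
        phi_meas by simp
  have "prob {\<omega> \<in> space M. \<bar>\<phi> (?T \<omega>) - E\<bar> \<ge> t} \<le>
    prob ({\<omega> \<in> space M. \<phi> (?T \<omega>) - E \<ge> t} \<union> {\<omega> \<in> space M. - \<phi> (?T \<omega>) - - E \<ge> t})"
    by (rule finite_measure_mono) (auto simp: abs_if split: if_splits)
  also have "\<dots> \<le> prob {\<omega> \<in> space M. \<phi> (?T \<omega>) - E \<ge> t} + prob {\<omega> \<in> space M. - \<phi> (?T \<omega>) - - E \<ge> t}"
    by (rule measure_Un_le) measurable
  finally show ?thesis using up lo unfolding E_def by linarith
qed

end

section \<open>From summable tails to almost sure weak convergence\<close>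

text \<open>Borel-Cantelli at each threshold 1 / (k + 1), with countably many null sets united. Only
  summability enters, so matrices of different sizes may be coupled in any way.\<close>

lemma (in prob_space) AE_tendsto_0_if_summable:
  fixes X :: "nat \<Rightarrow> 'a \<Rightarrow> real"
  assumes [measurable]: "\<And>n. X n \<in> borel_measurable M"
    and sum: "\<And>t. t > 0 \<Longrightarrow> summable (\<lambda>n. prob {x \<in> space M. \<bar>X n x\<bar> \<ge> t})"
  shows "AE x in M. (\<lambda>n. X n x) \<longlonglongrightarrow> 0"
proof -
  have "AE x in M. eventually (\<lambda>n. x \<in> space M - {x \<in> space M. \<bar>X n x\<bar> \<ge> 1 / real (Suc k)})
      sequentially" for k
    by (rule borel_cantelli_AE1) (use sum[of "1 / real (Suc k)"] in \<open>auto simp: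
        emeasure_eq_measure\<close>)
  then have "AE x in M. \<forall>k. eventually (\<lambda>n. x \<in> space M - {x \<in> space M. \<bar>X n x\<bar> \<ge> 1 / real (Suc
      k)}) sequentially"
    by (simp add: AE_all_countable)
  then show ?thesis
  proof eventually_elim
    case (elim x)
    show ?case
    proof (rule LIMSEQ_I)
      fix r :: real assume "r > 0"
      then obtain k where k: "1 / real (Suc k) < r" using nat_approx_posE by blast
      from elim obtain N where "\<And>n. n \<ge> N \<Longrightarrow> x \<in> space M - {x \<in> space M. \<bar>X n x\<bar> \<ge> 1 / real (Suc k)}"
        unfolding eventually_sequentially by blast
      then have "\<bar>X n x\<bar> < r" if "n \<ge> N" for n using that k by (fastforce simp: not_le)
      then show "\<exists>N. \<forall>n\<ge>N. norm (X n x - 0) < r" by auto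
    qed
  qed
qed

text \<open>The condition k \<ge> 2 enters through \<open>sqrt (k^2 + 4) \<le> k + 1\<close>, which
  amounts to 2 k \<ge> 3 and makes \<open>s\<close> at most 1/2.\<close>

lemma semicircle_root:
  fixes k :: nat
  assumes "2 \<le> k"
  defines "s \<equiv> (sqrt ((real k)\<^sup>2 + 4) - real k) / 2"
  shows "norm (\<i> * complex_of_real s) \<le> 1 / 2"
    and "(\<i> * complex_of_real s)\<^sup>2 + \<i> * of_nat k * (\<i> * complex_of_real s) + 1 = 0"
proof -
  have "sqrt ((real k)\<^sup>2 + 4) \<le> real k + 1"
    using assms by (intro real_le_lsqrt) (auto simp: power2_eq_square algebra_simps)
  moreover have "real k \<le> sqrt ((real k)\<^sup>2 + 4)" by (rule real_le_rsqrt) simp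
  ultimately have "0 \<le> s" "s \<le> 1 / 2" by (simp_all add: s_def)
  then show "norm (\<i> * complex_of_real s) \<le> 1 / 2" by (simp add: norm_mult)
  define t where "t = sqrt ((real k)\<^sup>2 + 4)"
  have "t * t = (real k)\<^sup>2 + 4" by (simp add: t_def add_nonneg_nonneg)
  then have "s * s + real k * s = 1"
    unfolding s_def t_def[symmetric] by (simp add: field_simps power2_eq_square)
  then have "complex_of_real (s * s + real k * s) = 1" by simp
  then show "(\<i> * complex_of_real s)\<^sup>2 + \<i> * of_nat k * (\<i> * complex_of_real s) + 1 = 0"
    by (simp add: power2_eq_square algebra_simps)
qed

theorem theorem1p2:
  fixes M :: "'a measure" and W :: "nat \<Rightarrow> 'a \<Rightarrow> nat \<Rightarrow> nat \<Rightarrow> complex"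
  assumes P: "prob_space M"
    and meas: "\<And>n i j. i < n \<Longrightarrow> j < n \<Longrightarrow> (\<lambda>\<omega>. W n \<omega> i j) \<in> borel_measurable M"
    and herm: "\<And>n \<omega> i j. \<omega> \<in> space M \<Longrightarrow> i < n \<Longrightarrow> j < n \<Longrightarrow> W n \<omega> j i = cnj (W n \<omega> i j)"
    and indep: "\<And>n. prob_space.indep_vars M (\<lambda>_. borel) (\<lambda>(i,j) \<omega>. W n \<omega> i j)
                        {(i,j). i \<le> j \<and> j < n}"
    and mean0: "\<And>n i j. i \<le> j \<Longrightarrow> j < n \<Longrightarrow>
                  integrable M (\<lambda>\<omega>. W n \<omega> i j) \<and> (\<integral>\<omega>. W n \<omega> i j \<partial>M) = 0"
    and finvar: "\<And>n i j. i \<le> j \<Longrightarrow> j < n \<Longrightarrow> integrable M (\<lambda>\<omega>. (cmod (W n \<omega> i j))\<^sup>2)"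
    and H1: "(\<lambda>n. (1 / real n) * (\<Sum>i<n. \<bar>\<Sum>j<n. cvar M (\<lambda>\<omega>. W n \<omega> i j) - 1 / real n\<bar>))
               \<longlonglongrightarrow> 0"
    and H2: "\<exists>C::real. C \<ge> 0 \<and>
               (\<lambda>n. (1 / real n) * (\<Sum>i<n. max ((\<Sum>j<n. cvar M (\<lambda>\<omega>. W n \<omega> i j)) - C) 0))
               \<longlonglongrightarrow> 0"
    and H3: "\<And>\<epsilon>::real. \<epsilon> > 0 \<Longrightarrow>
               (\<lambda>n. (1 / real n) * (\<Sum>i<n. \<Sum>j<n.
                  (\<integral>\<omega>. (if cmod (W n \<omega> i j) > \<epsilon> then (cmod (W n \<omega> i j))\<^sup>2 else 0) \<partial>M)))
               \<longlonglongrightarrow> 0"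
  shows "AE \<omega> in M. weak_conv_m (\<lambda>n. spectral_measure (sq_mat n (W n \<omega>))) semicircle"
proof -
  interpret prob_space M by (rule P)
  have rh: "random_hermitian M n (W n)" for n
  proof (intro random_hermitian.intro random_hermitian_axioms.intro)
    show "prob_space M" by (rule P)
    show "hermitian n (W n \<omega>)" if "\<omega> \<in> space M" for \<omega>
      unfolding hermitian_def using herm[OF that] by blast
    show "indep_vars (\<lambda>_. borel) (\<lambda>(i, j) \<omega>. W n \<omega> i j) (upper n)"
      unfolding upper_def by (rule indep)
  qed (use meas mean0 finvar in auto)
  interpret R: random_hermitian M n "W n" for n by (rule rh)
  let ?T = "\<lambda>k n \<omega>. (\<Sum>i<n. resolvent n (\<i> * of_nat k) (W n \<omega>) i i) / complex_of_nat n"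
  have cv: "cvar M (\<lambda>\<omega>. W n \<omega> i j) = R.variance_entry n i j" if "i < n" "j < n" for n i j
    unfolding cvar_def R.variance_entry_def R.entry_mean[OF that] by simp
  have a: "(\<lambda>n. (\<Sum>i<n. \<bar>(\<Sum>j<n. R.variance_entry n i j) - 1\<bar>) / real n) \<longlonglongrightarrow> 0"
  proof (rule Lim_transform_eventually[OF H1])
    show "\<forall>\<^sub>F n in sequentially. 1 / real n * (\<Sum>i<n. \<bar>\<Sum>j<n. cvar M (\<lambda>\<omega>. W n \<omega> i j) - 1 / real n\<bar>) =
        (\<Sum>i<n. \<bar>(\<Sum>j<n. R.variance_entry n i j) - 1\<bar>) / real n"
      using eventually_gt_at_top[of 0]
    proof eventually_elim
      case (elim n)
      \<comment> \<open>For n > 0 the \<open>n\<close> terms 1 / n add up to 1, so the inner sum is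
        the defect of the row variance.\<close>
      have "(\<Sum>j<n. cvar M (\<lambda>\<omega>. W n \<omega> i j) - 1 / real n) = (\<Sum>j<n. R.variance_entry n i j) - 1" if
          "i < n" for i
        using that elim by (simp add: sum_subtractf cv)
      then show ?case by simp
    qed
  qed
  have b: "(\<lambda>n. (\<Sum>i<n. \<Sum>j<n. R.tail_entry n \<epsilon> i j) / real n) \<longlonglongrightarrow> 0" if "\<epsilon> > 0" for \<epsilon>
    using H3[OF that] unfolding R.tail_entry_def by simp
  have main: "AE \<omega> in M. (\<lambda>n. ?T k n \<omega>) \<longlonglongrightarrow> (\<integral>x. 1 / (complex_of_real x - \<i> * of_nat k) \<partial>semicircle)"
    if k: "2 \<le> k" for k :: nat
  proof -
    let ?z = "\<i> * complex_of_nat k"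
    define m where "m = \<i> * complex_of_real ((sqrt ((real k)\<^sup>2 + 4) - real k) / 2)"
    have z: "Im ?z \<ge> 2" using k by simp
    have m: "norm m \<le> 1 / 2" "m\<^sup>2 + ?z * m + 1 = 0"
      unfolding m_def by (rule semicircle_root[OF k])+
    have msc: "(\<integral>x. 1 / (complex_of_real x - \<i> * of_nat k) \<partial>semicircle) = m"
      using semicircle_stieltjes[of "real k"] k by (simp add: m_def)
    have Tm [measurable]: "?T k n \<in> borel_measurable M" for n
      by (intro borel_measurable_divide borel_measurable_sum R.resolvent_measurable) auto
    have Tb: "norm (?T k n \<omega>) \<le> 1 / 2" if "\<omega> \<in> space M" for n \<omega>
    proof -
      have "norm (\<Sum>i<n. resolvent n ?z (W n \<omega>) i i) \<le> (\<Sum>i<n. 1 / 2)"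
        by (rule sum_norm_le) (use R.norm_resolvent_le_half(1)[OF z m(1) that] in auto)
      then show ?thesis by (cases "n = 0") (simp_all add: norm_divide field_simps)
    qed
    have Ti: "integrable M (?T k n)" for n
      by (rule integrable_bounded[OF Tm Tb])
    have ET: "(\<lambda>n. expectation (?T k n)) \<longlonglongrightarrow> m"
    proof (rule LIMSEQ_I)
      fix \<gamma> :: real assume g: "\<gamma> > 0"
      \<comment> \<open>In the limit the bound of \<open>expected_trace_bound\<close> is \<delta> +
        8 \<epsilon> / \<delta>; these choices make it at most \<gamma> / 2 + \<gamma> / 4.\<close>
      define \<delta> \<epsilon> where "\<delta> = \<gamma> / 2" and "\<epsilon> = min 1 (\<gamma> * \<delta> / 32)"
      have d: "\<delta> > 0" and e: "\<epsilon> > 0" "\<epsilon> \<le> 1" using g by (auto simp: \<delta>_def \<epsilon>_def)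
      let ?u = "\<lambda>n. \<delta> + (8 * \<epsilon> + 7 * ((\<Sum>i<n. \<bar>(\<Sum>j<n. R.variance_entry n i j) - 1\<bar>) / real n)
          + 10 * ((\<Sum>i<n. \<Sum>j<n. R.tail_entry n \<epsilon> i j) / real n)) / \<delta>"
      have "?u \<longlonglongrightarrow> \<delta> + (8 * \<epsilon> + 7 * 0 + 10 * 0) / \<delta>"
        by (intro tendsto_intros a b e) (use d in simp)
      moreover have "\<delta> + (8 * \<epsilon> + 7 * 0 + 10 * 0) / \<delta> < \<gamma>"
      proof -
        have "\<epsilon> \<le> \<gamma> * \<delta> / 32" by (simp add: \<epsilon>_def)
        then have "8 * \<epsilon> / \<delta> \<le> \<gamma> / 4" using d by (simp add: field_simps)
        then show ?thesis using g by (simp add: \<delta>_def)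
      qed
      ultimately have "\<forall>\<^sub>F n in sequentially. ?u n < \<gamma>" by (rule order_tendstoD)
      with eventually_gt_at_top[of 0]
      have "\<forall>\<^sub>F n in sequentially. norm (expectation (?T k n) - m) < \<gamma>"
      proof eventually_elim
        case (elim n)
        then show ?case using R.expected_trace_bound[OF z m e d, of n] by linarith
      qed
      then show "\<exists>N. \<forall>n\<ge>N. norm (expectation (?T k n) - m) < \<gamma>" by (simp add:
          eventually_sequentially)
    qed
    have conc: "AE \<omega> in M. (\<lambda>n. \<phi> (?T k n \<omega>) - expectation (\<lambda>\<omega>. \<phi> (?T k n \<omega>))) \<longlonglongrightarrow> 0"
      if phi: "\<And>a b. \<bar>\<phi> a - \<phi> b\<bar> \<le> norm (a - b)" "\<And>a. \<bar>\<phi> a\<bar> \<le> norm a"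
        and [measurable]: "\<phi> \<in> borel_measurable borel" for \<phi> :: "complex \<Rightarrow> real"
    proof (rule AE_tendsto_0_if_summable)
      show "(\<lambda>\<omega>. \<phi> (?T k n \<omega>) - expectation (\<lambda>\<omega>. \<phi> (?T k n \<omega>))) \<in> borel_measurable M" for n
        by measurable
      fix t :: real assume t: "t > 0"
      show "summable (\<lambda>n. prob {\<omega> \<in> space M. \<bar>\<phi> (?T k n \<omega>) - expectation (\<lambda>\<omega>. \<phi> (?T k n \<omega>))\<bar> \<ge> t})"
      proof (rule summable_comparison_test'[of "\<lambda>n. 2 * exp (- 2 * t\<^sup>2) ^ n" 1])
        show "summable (\<lambda>n. 2 * exp (- 2 * t\<^sup>2) ^ n)"
          using t by (intro summable_mult summable_geometric) simp
        fix n :: nat assume "n \<ge> 1"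
        then have "prob {\<omega> \<in> space M. \<bar>\<phi> (?T k n \<omega>) - expectation (\<lambda>\<omega>. \<phi> (?T k n \<omega>))\<bar> \<ge> t} \<le> 2 *
            exp (- 2 * real n * t\<^sup>2)"
          by (intro R.trace_concentration[OF z _ t phi]) auto
        then show "norm (prob {\<omega> \<in> space M. \<bar>\<phi> (?T k n \<omega>) - expectation (\<lambda>\<omega>. \<phi> (?T k n \<omega>))\<bar> \<ge> t})
            \<le> 2 * exp (- 2 * t\<^sup>2) ^ n"
          by (simp add: exp_of_nat_mult[symmetric] mult_ac)
      qed
    qed
    have "AE \<omega> in M. (\<lambda>n. Re (?T k n \<omega>) - expectation (\<lambda>\<omega>. Re (?T k n \<omega>))) \<longlonglongrightarrow> 0"
      by (rule conc) (auto simp: abs_Re_le_cmod simp flip: minus_complex.sel)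
    moreover have "AE \<omega> in M. (\<lambda>n. Im (?T k n \<omega>) - expectation (\<lambda>\<omega>. Im (?T k n \<omega>))) \<longlonglongrightarrow> 0"
      by (rule conc) (auto simp: abs_Im_le_cmod simp flip: minus_complex.sel)
    ultimately show ?thesis
    proof eventually_elim
      case (elim \<omega>)
      have "(\<lambda>n. Re (?T k n \<omega>) - expectation (\<lambda>\<omega>. Re (?T k n \<omega>)) + Re (expectation (?T k n))) \<longlonglongrightarrow> 0
          + Re m"
        by (intro tendsto_intros elim(1) ET)
      then have re: "(\<lambda>n. Re (?T k n \<omega>)) \<longlonglongrightarrow> Re m" unfolding integral_Re[OF Ti] by simp
      have "(\<lambda>n. Im (?T k n \<omega>) - expectation (\<lambda>\<omega>. Im (?T k n \<omega>)) + Im (expectation (?T k n))) \<longlonglongrightarrow> 0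
          + Im m"
        by (intro tendsto_intros elim(2) ET)
      then have im: "(\<lambda>n. Im (?T k n \<omega>)) \<longlonglongrightarrow> Im m" unfolding integral_Im[OF Ti] by simp
      show ?case unfolding msc tendsto_complex_iff using re im by blast
    qed
  qed
  \<comment> \<open>The exceptional set of \<open>main\<close> depends on k; since the points are
    countably many, one null set serves them all.\<close>
  have "AE \<omega> in M. \<forall>k. 2 \<le> k \<longrightarrow>
      (\<lambda>n. ?T k n \<omega>) \<longlonglongrightarrow> (\<integral>x. 1 / (complex_of_real x - \<i> * of_nat k) \<partial>semicircle)"
    unfolding AE_all_countable
  proof
    fix k show "AE \<omega> in M. 2 \<le> k \<longrightarrow>
      (\<lambda>n. ?T k n \<omega>) \<longlonglongrightarrow> (\<integral>x. 1 / (complex_of_real x - \<i> * of_nat k) \<partial>semicircle)"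
      by (cases "2 \<le> k") (use main[of k] in simp_all)
  qed
  with AE_space show ?thesis
  proof eventually_elim
    case (elim \<omega>)
    show ?case
    proof (rule weak_conv_stieltjes[OF real_distribution_spectral_measure
        real_distribution_semicircle])
      fix k :: nat assume k: "2 \<le> k"
      show "(\<lambda>n. \<integral>x. 1 / (complex_of_real x - \<i> * of_nat k) \<partial>spectral_measure (sq_mat n (W n \<omega>)))
        \<longlonglongrightarrow> (\<integral>x. 1 / (complex_of_real x - \<i> * of_nat k) \<partial>semicircle)"
      proof (rule Lim_transform_eventually)
        show "(\<lambda>n. ?T k n \<omega>) \<longlonglongrightarrow> (\<integral>x. 1 / (complex_of_real x - \<i> * of_nat k) \<partial>semicircle)"
          using elim(2) k by blast
        show "\<forall>\<^sub>F n in sequentially. ?T k n \<omega> =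
            (\<integral>x. 1 / (complex_of_real x - \<i> * of_nat k) \<partial>spectral_measure (sq_mat n (W n \<omega>)))"
          using eventually_gt_at_top[of 0]
          by eventually_elim (rule resolvent_trace_spectral_measure[OF R.herm[OF elim(1)]], use k
              in auto)
      qed
    qed
  qed
qed



end
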